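(* Let $\mathbb{K}$ be a field, let $V$ be an $\ell$-dimensional vector space over $\mathbb{K}$ with $\ell\ge 1$, and let $\mathcal{A}$ be a central arrangement of hyperplanes in $V$. Then $\mathcal{A}$ is totally free if and only if it has a decomposition $$\mathcal{A}=\mathcal{A}_1\times\mathcal{A}_2\times\cdots\times\mathcal{A}_s,$$ where each $\mathcal{A}_i$ is a central arrangement in $\mathbb{K}^1$ or $\mathbb{K}^2$.
   Context: A central arrangement in a finite-dimensional $\mathbb{K}$-vector space $V$ is a finite (possibly empty) collection of linear hyperplanes of $V$. Let $S=\mathrm{Sym}(V^* )\simeq\mathbb{K}[x_1,\ldots,x_\ell]$ for a basis $x_1,\ldots,x_\ell$ of $V^*$, and let $\mathrm{Der}_{\mathbb{K}}(S)=\bigoplus_{i=1}^{\ell}S\,\partial_{x_i}$ be the $S$-module of $\mathbb{K}$-linear derivations of $S$ to itself. For each $H\in\mathcal{A}$ fix $\alpha_H\in V^*$ with $\ker(\alpha_H)=H$. A multiplicity on $\mathcal{A}$ is a function $m:\mathcal{A}\to\mathbb{Z}_{>0}$; the pair $(\mathcal{A},m)$ is called a multiarrangement. Its logarithmic derivation module is $$D(\mathcal{A},m)=\{\theta\in\mathrm{Der}_{\mathbb{K}}(S)\mid \theta(\alpha_H)\in S\cdot\alpha_H^{m(H)}\text{ for all }H\in\mathcal{A}\}.$$ The multiarrangement $(\mathcal{A},m)$ is free (and $m$ is a free multiplicity on $\mathcal{A}$) if $D(\mathcal{A},m)$ is a free $S$-module. The arrangement $\mathcal{A}$ is totally free if $(\mathcal{A},m)$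 is free for every multiplicity $m:\mathcal{A}\to\mathbb{Z}_{>0}$. For arrangements $\mathcal{A}_i$ in $V_i$ ($i=1,2$), the product $\mathcal{A}_1\times\mathcal{A}_2$ is the arrangement in $V_1\oplus V_2$ given by $$\mathcal{A}_1\times\mathcal{A}_2=\{H_1\oplus V_2\mid H_1\in\mathcal{A}_1\}\cup\{V_1\oplus H_2\mid H_2\in\mathcal{A}_2\},$$ and products of more factors are defined by iteration. A decomposition of $\mathcal{A}$ as a product means a direct sum decomposition $V=V_1\oplus\cdots\oplus V_s$ and arrangements $\mathcal{A}_i$ in $V_i$ such that $\mathcal{A}$ is the product of the $\mathcal{A}_i$; "$\mathcal{A}_i$ is in $\mathbb{K}^d$" means that $\dim V_i=d$. The factors $\mathcal{A}_i$ may be empty. *)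

theory Defs
  imports
    Complex_Main
    "HOL-Library.Poly_Mapping"
    "HOL-Library.Function_Algebras"
    "HOL-Library.Set_Algebras"
    "HOL-Library.FuncSet"
begin

subsection \<open>Polynomials and derivations\<close>

text \<open>
  The polynomial ring $S = K[x_i : i \in I]$ for a finite index type $I$, as the monoid algebra over
  \<open>K\<close> of the monoid of exponent vectors.  Working with formal polynomials, as opposed to
  polynomial functions, matters over finite fields.
\<close>

type_synonym ('i, 'k) mpoly = "('i \<Rightarrow>\<^sub>0 nat) \<Rightarrow>\<^sub>0 'k"

definition Const :: "'k::zero \<Rightarrow> ('i, 'k) mpoly"
  where "Const c = Poly_Mapping.single 0 c"

definition Var :: "'i \<Rightarrow> ('i, 'k::zero_neq_one) mpoly"
  where "Var i = Poly_Mapping.single (Poly_Mapping.single i 1) 1"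

definition derivations :: "(('i, 'k::field) mpoly \<Rightarrow> ('i, 'k) mpoly) set"
  where "derivations = {\<theta>.
    (\<forall>p q. \<theta> (p + q) = \<theta> p + \<theta> q) \<and>
    (\<forall>c p. \<theta> (Const c * p) = Const c * \<theta> p) \<and>
    (\<forall>p q. \<theta> (p * q) = \<theta> p * q + p * \<theta> q)}"

text \<open>The pointwise \<open>S\<close>-module structure; addition of derivations is that of \<open>Function_Algebras\<close>.\<close>

definition der_scale ::
    "('i, 'k::field) mpoly \<Rightarrow> (('i, 'k) mpoly \<Rightarrow> ('i, 'k) mpoly) \<Rightarrow> ('i, 'k) mpoly \<Rightarrow> ('i, 'k) mpoly"
  where "der_scale s \<theta> = (\<lambda>p. s * \<theta> p)"

lemma module_der_scale: "module der_scale"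
  by unfold_locales (auto simp: der_scale_def fun_eq_iff algebra_simps)

lemma subspace_derivations: "module.subspace der_scale derivations"
  by (auto simp: module.subspace_def[OF module_der_scale] derivations_def der_scale_def
      algebra_simps)

definition free_submodule :: "('r::comm_ring_1 \<Rightarrow> 'm::ab_group_add \<Rightarrow> 'm) \<Rightarrow> 'm set \<Rightarrow> bool"
  where "free_submodule scale M \<longleftrightarrow>
    module.subspace scale M \<and>
    (\<exists>E. E \<subseteq> M \<and> \<not> module.dependent scale E \<and> module.span scale E = M)"


subsection \<open>Arrangements\<close>

text \<open>
  Vector spaces are given by a scalar multiplication \<open>scale\<close> as in the locale \<open>vector_space\<close>;
  the factors of a product live in subspaces, so that the ambient space of an arrangement is a
  set \<open>V\<close>.
\<close>

definition hyperplane :: "('k::field \<Rightarrow> 'v::ab_group_add \<Rightarrow> 'v) \<Rightarrow> 'v set \<Rightarrow> 'v set \<Rightarrow> bool"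
  where "hyperplane scale V H \<longleftrightarrow>
    module.subspace scale H \<and> H \<subseteq> V \<and>
    vector_space.dim scale V = vector_space.dim scale H + 1"

definition central_arrangement ::
    "('k::field \<Rightarrow> 'v::ab_group_add \<Rightarrow> 'v) \<Rightarrow> 'v set \<Rightarrow> 'v set set \<Rightarrow> bool"
  where "central_arrangement scale V \<A> \<longleftrightarrow> finite \<A> \<and> (\<forall>H\<in>\<A>. hyperplane scale V H)"

definition indexed_basis :: "('k::field \<Rightarrow> 'v::ab_group_add \<Rightarrow> 'v) \<Rightarrow> ('i \<Rightarrow> 'v) \<Rightarrow> bool"
  where "indexed_basis scale b \<longleftrightarrow>
    inj b \<and> \<not> module.dependent scale (b ` UNIV) \<and> module.span scale (b ` UNIV) = UNIV"

definition defining_form ::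
    "('k::field \<Rightarrow> 'v::ab_group_add \<Rightarrow> 'v) \<Rightarrow> 'v set \<Rightarrow> ('v \<Rightarrow> 'k) \<Rightarrow> bool"
  where "defining_form scale H \<alpha> \<longleftrightarrow> Vector_Spaces.linear scale (*) \<alpha> \<and> {v. \<alpha> v = 0} = H"

text \<open>
  The coordinates $x_i$ are the basis of the dual space which is dual to the basis $b_i$ of \<open>V\<close>.
  In terms of it, a linear form is $\alpha = \sum_i \alpha(b_i) x_i$.
\<close>

definition form_poly :: "('i::finite \<Rightarrow> 'v) \<Rightarrow> ('v \<Rightarrow> 'k::field) \<Rightarrow> ('i, 'k) mpoly"
  where "form_poly b \<alpha> = (\<Sum>i\<in>UNIV. Const (\<alpha> (b i)) * Var i)"

text \<open>
  \<open>\<alpha> H\<close> is the chosen defining form of \<open>H\<close>.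
  Values of \<open>m\<close> and \<open>\<alpha>\<close> outside \<open>\<A>\<close> are irrelevant.
\<close>

definition log_derivations ::
    "('i::finite \<Rightarrow> 'v) \<Rightarrow> ('v set \<Rightarrow> 'v \<Rightarrow> 'k::field) \<Rightarrow> 'v set set \<Rightarrow> ('v set \<Rightarrow> nat) \<Rightarrow>
      (('i, 'k) mpoly \<Rightarrow> ('i, 'k) mpoly) set"
  where "log_derivations b \<alpha> \<A> m =
    {\<theta> \<in> derivations. \<forall>H\<in>\<A>. form_poly b (\<alpha> H) ^ m H dvd \<theta> (form_poly b (\<alpha> H))}"

definition free_multiarrangement ::
    "('i::finite \<Rightarrow> 'v) \<Rightarrow> ('v set \<Rightarrow> 'v \<Rightarrow> 'k::field) \<Rightarrow> 'v set set \<Rightarrow> ('v set \<Rightarrow> nat) \<Rightarrow> bool"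
  where "free_multiarrangement b \<alpha> \<A> m \<longleftrightarrow> free_submodule der_scale (log_derivations b \<alpha> \<A> m)"

definition totally_free ::
    "('i::finite \<Rightarrow> 'v) \<Rightarrow> ('v set \<Rightarrow> 'v \<Rightarrow> 'k::field) \<Rightarrow> 'v set set \<Rightarrow> bool"
  where "totally_free b \<alpha> \<A> \<longleftrightarrow>
    (\<forall>m. (\<forall>H\<in>\<A>. 0 < m H) \<longrightarrow> free_multiarrangement b \<alpha> \<A> m)"

lemma subspace_log_derivations: "module.subspace der_scale (log_derivations b \<alpha> \<A> m)"
  using subspace_derivations
  by (auto simp: module.subspace_def[OF module_der_scale] log_derivations_def der_scale_def)


subsection \<open>Products\<close>

definition direct_sum_decomposition ::
    "('k::field \<Rightarrow> 'v::ab_group_add \<Rightarrow> 'v) \<Rightarrow> nat \<Rightarrow> (nat \<Rightarrow> 'v set) \<Rightarrow> bool"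
  where "direct_sum_decomposition scale s W \<longleftrightarrow>
    (\<forall>i<s. module.subspace scale (W i)) \<and>
    (\<forall>v. \<exists>!f. f \<in> (\<Pi>\<^sub>E i\<in>{..<s}. W i) \<and> v = (\<Sum>i<s. f i))"

text \<open>
  Arrangements are paired here with their ambient spaces, which are independent subspaces of one
  vector space; the internal direct sum is the elementwise sum of \<open>Set_Algebras\<close>.
\<close>

definition arr_prod ::
    "'v::ab_group_add set \<times> 'v set set \<Rightarrow> 'v set \<times> 'v set set \<Rightarrow> 'v set \<times> 'v set set"
  where "arr_prod = (\<lambda>(V1, \<A>1) (V2, \<A>2).
    (V1 + V2, {H1 + V2 | H1. H1 \<in> \<A>1} \<union> {V1 + H2 | H2. H2 \<in> \<A>2}))"

text \<open>The empty arrangement in the zero space is neutral for \<^const>\<open>arr_prod\<close>.\<close>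

primrec arr_prods :: "nat \<Rightarrow> (nat \<Rightarrow> 'v::ab_group_add set \<times> 'v set set) \<Rightarrow> 'v set \<times> 'v set set"
  where
    "arr_prods 0 P = ({0}, {})"
  | "arr_prods (Suc s) P = arr_prod (arr_prods s P) (P s)"

lemma arr_prod_neutral: "arr_prod ({0}, {}) P = P"
  by (cases P) (auto simp: arr_prod_def simp flip: set_zero)

end

theory Submission
  imports Defs "HOL-Computational_Algebra.Polynomial" "HOL-Library.Cardinality"
begin

text \<open>
  Fix a basis \<open>w\<^sub>k\<close> of \<open>V\<close> with dual coordinates \<open>x\<^sub>k\<close>. A derivation \<open>\<theta>\<close> is determined by the vector of the
  polynomials \<open>p\<^sub>k = \<theta>(x\<^sub>k)\<close>, which are arbitrary, and \<open>\<theta>(\<alpha>) = \<Sum>\<^sub>k \<alpha>(w\<^sub>k) p\<^sub>k\<close> for a linear form \<open>\<alpha>\<close>. So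
  \<open>D(\<A>, m)\<close> is a graded submodule of \<open>S\<^sup>\<ell>\<close> given by divisibility conditions.

  Products are totally free. In a basis adapted to the decomposition, the form of every hyperplane
  involves the coordinates of one block of at most two indices. Start from the unit vectors, a basis for
  \<open>m = 0\<close>, and raise the multiplicities one by one, keeping a basis \<open>\<theta>\<^sub>j\<close> in which the entries of each
  vector are homogeneous forms in the coordinates of one block and vanish outside of it. When \<open>m(H) = n\<close>
  is raised, only the at most two vectors in the block of \<open>H\<close> matter. Modulo \<open>\<alpha>\<^sub>H\<close> all forms of degree
  \<open>d\<close> in two coordinates are multiples of one power \<open>t\<^sup>d\<close>, so for these vectors the quotients
  \<open>\<theta>\<^sub>j(\<alpha>\<^sub>H) / \<alpha>\<^sub>H\<^sup>n\<close> are multiples of powers of \<open>t\<close>. The vector with the lowest power eliminates the other one and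
  is itself multiplied by \<open>\<alpha>\<^sub>H\<close> (\<open>vec_basis_pivot\<close>, \<open>adapted_basis_exists\<close>).

  Circuits obstruct freeness. Let coordinates \<open>x\<^sub>k\<close> for \<open>k\<close> in a set \<open>T\<close> with at least three elements, and
  also \<open>\<alpha>\<^sub>0 = \<Sum>\<^sub>k\<^sub>\<in>\<^sub>T a\<^sub>k x\<^sub>k\<close> with all \<open>a\<^sub>k \<noteq> 0\<close>, be defining forms. Choose multiplicities
  \<open>n\<^sub>1 > n\<^sub>2 > N\<close> with large gaps on \<open>x\<^sub>1\<close>, \<open>x\<^sub>2\<close> and the other \<open>x\<^sub>k\<close>, and \<open>1\<close> elsewhere. If \<open>D = D(\<A>, m)\<close> is free, it
  has \<open>\<ell>\<close> homogeneous generators, by a graded version of Nakayama's lemma. An element of degree below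
  \<open>n\<^sub>1\<close> has \<open>p\<^sub>1 = 0\<close>. As \<open>D\<close> contains explicit multiples of all unit vectors, counting generators by
  degree shows that all but one have \<open>p\<^sub>1 = 0\<close>, and all but one of these have \<open>p\<^sub>2 = 0\<close>. This last one, \<open>h\<close>,
  has the property that \<open>g = h\<^sub>2\<close> divides \<open>p\<^sub>2\<close> for all \<open>p \<in> D\<close> with \<open>p\<^sub>1 = 0\<close>. Two explicit elements of \<open>D\<close> and the
  primality of \<open>\<alpha>\<^sub>0\<close> show that \<open>g\<close> divides the product of a power of \<open>x\<^sub>2\<close> and of the \<open>\<alpha>\<^sub>H\<close>, for the hyperplanes \<open>H\<close> of
  multiplicity \<open>1\<close> other than that of \<open>\<alpha>\<^sub>0\<close>. Now restrict to a curve in the hyperplane \<open>\<alpha>\<^sub>0 = 0\<close> on which \<open>x\<^sub>2 = 1\<close>, the other \<open>x\<^sub>k\<close> with \<open>k \<noteq> 1\<close> are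
  different positive powers of a parameter \<open>z\<close>, and no other \<open>\<alpha>\<^sub>H\<close> vanishes: there \<open>g\<close> becomes a nonzero
  polynomial of bounded order at \<open>z = 0\<close>, whereas \<open>\<Sum>\<^sub>k a\<^sub>k h\<^sub>k \<in> S \<alpha>\<^sub>0\<close> and \<open>x\<^sub>k\<^sup>N | h\<^sub>k\<close> force \<open>z\<^sup>N | g\<close>
  (\<open>circuit_imp_not_free\<close>).

  Arrangements without such circuits are products. Choose a basis for which as many coordinates as
  possible are defining forms. The other forms of \<open>\<A>\<close> are combinations of these, of at most two by the
  absence of circuits. If two different pairs of coordinates occurring in this way overlapped, exchanging
  one coordinate would exhibit a circuit. So the pairs are disjoint, and with the
  remaining single indices they are the blocks of a decomposition (\<open>totally_free_imp_blocks\<close>).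
\<close>

section \<open>Polynomials in finitely many variables\<close>

locale ring_homomorphism =
  fixes h :: "'a::comm_ring_1 \<Rightarrow> 'b::comm_ring_1"
  assumes add: "h (x + y) = h x + h y"
    and mult: "h (x * y) = h x * h y"
    and one: "h 1 = 1"
begin

lemma zero: "h 0 = 0"
  using add[of 0 0] by simp

lemma uminus: "h (- x) = - h x"
  using add[of x "- x"] by (simp add: zero eq_neg_iff_add_eq_0 add.commute)

lemma diff: "h (x - y) = h x - h y"
  using add[of x "- y"] by (simp add: uminus)

lemma sum: "h (sum f A) = (\<Sum>a\<in>A. h (f a))"
  by (induction A rule: infinite_finite_induct) (auto simp: zero add)

lemma prod: "h (prod f A) = (\<Prod>a\<in>A. h (f a))"
  by (induction A rule: infinite_finite_induct) (auto simp: one mult)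

lemma power: "h (x ^ n) = h x ^ n"
  by (induction n) (auto simp: one mult)

lemma dvd: "x dvd y \<Longrightarrow> h x dvd h y"
  by (auto simp: dvd_def mult)

end

lemma ring_homomorphism_comp:
  "ring_homomorphism g \<Longrightarrow> ring_homomorphism h \<Longrightarrow> ring_homomorphism (\<lambda>x. g (h x))"
  by (simp add: ring_homomorphism_def)

lemma ring_homomorphism_id: "ring_homomorphism (\<lambda>x. x)"
  by (simp add: ring_homomorphism_def)

lemma ring_homomorphism_Const: "ring_homomorphism Const"
  by unfold_locales (auto simp: Const_def single_add mult_single)

lemma ring_homomorphism_constant_poly: "ring_homomorphism (\<lambda>a. [:a:])"
  by unfold_locales (auto simp: one_pCons)

lemma ring_homomorphism_poly: "ring_homomorphism (\<lambda>p. poly p x)"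
  by unfold_locales auto

lemmas Const_simps = ring_homomorphism.add[OF ring_homomorphism_Const]
  ring_homomorphism.mult[OF ring_homomorphism_Const]
  ring_homomorphism.one[OF ring_homomorphism_Const]
  ring_homomorphism.zero[OF ring_homomorphism_Const]
  ring_homomorphism.diff[OF ring_homomorphism_Const]
  ring_homomorphism.uminus[OF ring_homomorphism_Const]

lemma sum_singles: "p = (\<Sum>e\<in>Poly_Mapping.keys p. Poly_Mapping.single e (Poly_Mapping.lookup p e))"
  by (rule poly_mapping_eqI)
    (auto simp: lookup_sum lookup_single when_def in_keys_iff)

lemma Var_power: "Var i ^ n = Poly_Mapping.single (Poly_Mapping.single i n) 1"
  by (induction n) (auto simp: Var_def mult_single single_add[symmetric] simp flip: single_one)

lemma prod_Var_power:
  "finite I \<Longrightarrow> (\<Prod>i\<in>I. Var (v i) ^ n i) = Poly_Mapping.single (\<Sum>i\<in>I. Poly_Mapping.single (v i) (n i)) 1"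
  by (induction I rule: finite_induct) (auto simp: Var_power mult_single simp flip: single_one)

lemma single_eq_Const_times_Vars:
  fixes e :: "'i::finite \<Rightarrow>\<^sub>0 nat" and a :: "'k::comm_semiring_1"
  shows "Poly_Mapping.single e a = Const a * (\<Prod>i\<in>UNIV. Var i ^ Poly_Mapping.lookup e i)"
proof -
  have "(\<Sum>i\<in>UNIV. Poly_Mapping.single i (Poly_Mapping.lookup e i)) = e"
    by (rule poly_mapping_eqI) (auto simp: lookup_sum lookup_single when_def)
  then show ?thesis
    by (simp add: prod_Var_power Const_def mult_single)
qed

lemma mpoly_induct [case_names Const Var add mult]:
  fixes p :: "('i::finite, 'k::comm_semiring_1) mpoly"
  assumes Const: "\<And>a. P (Const a)" and Var: "\<And>i. P (Var i)"
    and add: "\<And>p q. P p \<Longrightarrow> P q \<Longrightarrow> P (p + q)" and mult: "\<And>p q. P p \<Longrightarrow> P q \<Longrightarrow> P (p * q)"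
  shows "P p"
proof -
  have one: "P 1" using Const[of 1] by (simp add: Const_def)
  have zero: "P 0" using Const[of 0] by (simp add: Const_def)
  have pow: "P (Var i ^ n)" for i n
    by (induction n) (auto intro: one mult Var)
  have prod: "P (\<Prod>i\<in>I. Var i ^ n i)" for I n
    by (induction I rule: infinite_finite_induct) (auto intro: one mult pow)
  have sum: "P (sum f A)" if "\<And>e. e \<in> A \<Longrightarrow> P (f e)" for f and A :: "('i \<Rightarrow>\<^sub>0 nat) set"
    using that by (induction A rule: infinite_finite_induct) (auto intro: zero add)
  show ?thesis
    by (subst sum_singles, rule sum, subst single_eq_Const_times_Vars) (intro mult Const prod)
qed

lemma ring_homomorphism_eqI:
  fixes g h :: "('i::finite, 'k::comm_ring_1) mpoly \<Rightarrow> 'b::comm_ring_1"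
  assumes "ring_homomorphism g" "ring_homomorphism h"
    and "\<And>a. g (Const a) = h (Const a)" "\<And>i. g (Var i) = h (Var i)"
  shows "g p = h p"
proof (induction p rule: mpoly_induct)
qed (auto simp: assms(3,4) ring_homomorphism.add[OF assms(1)] ring_homomorphism.add[OF assms(2)]
      ring_homomorphism.mult[OF assms(1)] ring_homomorphism.mult[OF assms(2)])

definition subst_hom ::
    "('k::comm_ring_1 \<Rightarrow> 'b::comm_ring_1) \<Rightarrow> ('i::finite \<Rightarrow> 'b) \<Rightarrow> ('i, 'k) mpoly \<Rightarrow> 'b"
  where "subst_hom c f p = (\<Sum>e\<in>Poly_Mapping.keys p.
    c (Poly_Mapping.lookup p e) * (\<Prod>i\<in>UNIV. f i ^ Poly_Mapping.lookup e i))"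

lemma subst_hom_superset:
  assumes "ring_homomorphism c" "finite E" "Poly_Mapping.keys p \<subseteq> E"
  shows "subst_hom c f p = (\<Sum>e\<in>E. c (Poly_Mapping.lookup p e) * (\<Prod>i\<in>UNIV. f i ^ Poly_Mapping.lookup e i))"
  unfolding subst_hom_def using assms
  by (intro sum.mono_neutral_left) (auto simp: in_keys_iff ring_homomorphism.zero)

context
  fixes c :: "'k::comm_ring_1 \<Rightarrow> 'b::comm_ring_1" and f :: "'i::finite \<Rightarrow> 'b"
  assumes c: "ring_homomorphism c"
begin

lemma subst_hom_single:
  "subst_hom c f (Poly_Mapping.single e a) = c a * (\<Prod>i\<in>UNIV. f i ^ Poly_Mapping.lookup e i)"
  by (subst subst_hom_superset[OF c, of "{e}"]) auto

lemma subst_hom_Const: "subst_hom c f (Const a) = c a"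
  by (simp add: Const_def subst_hom_single)

lemma subst_hom_Var: "subst_hom c f (Var i) = f i"
proof -
  have "(\<Prod>j\<in>UNIV. f j ^ Poly_Mapping.lookup (Poly_Mapping.single i 1) j) = (\<Prod>j\<in>UNIV. if j = i then f j else 1)"
    by (rule prod.cong) (auto simp: lookup_single when_def)
  then show ?thesis
    by (simp add: Var_def subst_hom_single ring_homomorphism.one[OF c])
qed

lemma subst_hom_add: "subst_hom c f (p + q) = subst_hom c f p + subst_hom c f q"
proof -
  define E where "E = Poly_Mapping.keys p \<union> Poly_Mapping.keys q \<union> Poly_Mapping.keys (p + q)"
  have E: "finite E" "Poly_Mapping.keys p \<subseteq> E" "Poly_Mapping.keys q \<subseteq> E" "Poly_Mapping.keys (p + q) \<subseteq> E"
    by (auto simp: E_def)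
  show ?thesis
    using E by (simp add: subst_hom_superset[OF c E(1)] lookup_add ring_homomorphism.add[OF c]
        distrib_right sum.distrib)
qed

lemma subst_hom_sum: "subst_hom c f (sum g A) = (\<Sum>a\<in>A. subst_hom c f (g a))"
  by (induction A rule: infinite_finite_induct)
    (auto simp: subst_hom_add subst_hom_def[of c f 0])

lemma subst_hom_mult: "subst_hom c f (p * q) = subst_hom c f p * subst_hom c f q"
proof -
  have single: "subst_hom c f (Poly_Mapping.single d a * Poly_Mapping.single e b)
      = subst_hom c f (Poly_Mapping.single d a) * subst_hom c f (Poly_Mapping.single e b)" for d e a b
    by (simp add: mult_single subst_hom_single ring_homomorphism.mult[OF c] lookup_add power_add
        prod.distrib mult_ac)
  show ?thesis
    by (subst (1 3) sum_singles, subst (2 4) sum_singles)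
      (simp add: sum_product subst_hom_sum single del: sum_singles)
qed

lemma ring_homomorphism_subst_hom: "ring_homomorphism (subst_hom c f)"
  using subst_hom_Const[of 1]
  by unfold_locales (auto simp: subst_hom_add subst_hom_mult ring_homomorphism.one[OF c] Const_def)

end

text \<open>
  Exponent vectors over a linearly ordered index type form an ordered monoid, and there the product of
  nonzero polynomials is nonzero; a numbering of the variables embeds every finite index type.
\<close>

lemma mpoly_mult_eq_0:
  fixes p q :: "('i::finite, 'k::idom) mpoly"
  assumes "p * q = 0"
  shows "p = 0 \<or> q = 0"
proof -
  obtain idx :: "'i \<Rightarrow> nat" where idx: "inj idx"
    using finite_imp_inj_to_nat_seg[of "UNIV :: 'i set"] by auto
  define \<phi> :: "('i, 'k) mpoly \<Rightarrow> (nat, 'k) mpoly" where "\<phi> = subst_hom Const (\<lambda>i. Var (idx i))"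
  define g where "g e = (\<Sum>i\<in>UNIV. Poly_Mapping.single (idx i) (Poly_Mapping.lookup e i))" for e :: "'i \<Rightarrow>\<^sub>0 nat"
  have \<phi>: "\<phi> p = (\<Sum>e\<in>Poly_Mapping.keys p. Poly_Mapping.single (g e) (Poly_Mapping.lookup p e))" for p
    by (simp add: \<phi>_def subst_hom_def prod_Var_power g_def Const_def mult_single)
  have lookup_g: "Poly_Mapping.lookup (g e) (idx i) = Poly_Mapping.lookup e i" for e i
    by (auto simp: g_def lookup_sum lookup_single when_def inj_eq[OF idx])
  have "inj g"
    by (rule injI, rule poly_mapping_eqI) (metis lookup_g)
  then have "Poly_Mapping.lookup (\<phi> p) (g e) = Poly_Mapping.lookup p e" for p e
    by (auto simp: \<phi> lookup_sum lookup_single when_def inj_eq in_keys_iff)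
  then have inj: "\<phi> p = 0 \<Longrightarrow> p = 0" for p
    by (metis lookup_zero poly_mapping_eqI)
  interpret \<phi>: ring_homomorphism \<phi>
    unfolding \<phi>_def by (rule ring_homomorphism_subst_hom[OF ring_homomorphism_Const])
  have "\<phi> p * \<phi> q = 0"
    using assms by (metis \<phi>.mult \<phi>.zero)
  then show ?thesis
    using inj by auto
qed


lemma mpoly_mult_eq_0_iff:
  fixes p q :: "('i::finite, 'k::idom) mpoly"
  shows "p * q = 0 \<longleftrightarrow> p = 0 \<or> q = 0"
  using mpoly_mult_eq_0[of p q] by auto

lemma mpoly_power_eq_0_iff:
  fixes p :: "('i::finite, 'k::idom) mpoly"
  shows "p ^ n = 0 \<longleftrightarrow> p = 0 \<and> 0 < n"
  by (induction n) (auto simp: mpoly_mult_eq_0_iff)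

lemma mpoly_prod_eq_0_iff:
  fixes f :: "'a \<Rightarrow> ('i::finite, 'k::idom) mpoly"
  shows "finite A \<Longrightarrow> prod f A = 0 \<longleftrightarrow> (\<exists>a\<in>A. f a = 0)"
  by (induction A rule: finite_induct) (auto simp: mpoly_mult_eq_0_iff)

lemma mpoly_mult_left_cancel:
  fixes p q r :: "('i::finite, 'k::idom) mpoly"
  assumes "p \<noteq> 0" "p * q = p * r"
  shows "q = r"
  using mpoly_mult_eq_0[of p "q - r"] assms by (simp add: algebra_simps)


section \<open>The grading by degree\<close>

text \<open>
  The grading is read off from the ring homomorphism that multiplies every variable by a new
  variable \<open>t\<close>: the component of degree \<open>d\<close> is the coefficient of \<open>t ^ d\<close>.
\<close>

definition grading :: "('i::finite, 'k::comm_ring_1) mpoly \<Rightarrow> ('i, 'k) mpoly poly"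
  where "grading = subst_hom (\<lambda>a. [:Const a:]) (\<lambda>i. monom (Var i) 1)"

definition component :: "nat \<Rightarrow> ('i::finite, 'k::comm_ring_1) mpoly \<Rightarrow> ('i, 'k) mpoly"
  where "component d p = coeff (grading p) d"

definition homogeneous :: "nat \<Rightarrow> ('i::finite, 'k::comm_ring_1) mpoly \<Rightarrow> bool"
  where "homogeneous d p \<longleftrightarrow> grading p = monom p d"

lemma ring_homomorphism_const_poly_Const: "ring_homomorphism (\<lambda>a. [:Const a:])"
  using ring_homomorphism_comp[OF ring_homomorphism_constant_poly ring_homomorphism_Const] .

interpretation grading: ring_homomorphism grading
  unfolding grading_def by (rule ring_homomorphism_subst_hom[OF ring_homomorphism_const_poly_Const])

lemma grading_Const: "grading (Const a) = [:Const a:]"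
  by (simp add: grading_def subst_hom_Const[OF ring_homomorphism_const_poly_Const])

lemma grading_Var: "grading (Var i) = monom (Var i) 1"
  by (simp add: grading_def subst_hom_Var[OF ring_homomorphism_const_poly_Const])

lemma homogeneous_Const: "homogeneous 0 (Const a)"
  by (simp add: homogeneous_def grading_Const monom_0)

lemma homogeneous_Var: "homogeneous 1 (Var i)"
  by (simp add: homogeneous_def grading_Var)

lemma homogeneous_0 [simp]: "homogeneous d 0"
  by (simp add: homogeneous_def grading.zero)

lemma homogeneous_add: "homogeneous d p \<Longrightarrow> homogeneous d q \<Longrightarrow> homogeneous d (p + q)"
  by (simp add: homogeneous_def grading.add add_monom)

lemma homogeneous_sum: "(\<And>a. a \<in> A \<Longrightarrow> homogeneous d (f a)) \<Longrightarrow> homogeneous d (sum f A)"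
  by (induction A rule: infinite_finite_induct) (auto intro: homogeneous_add)

lemma homogeneous_mult: "homogeneous d p \<Longrightarrow> homogeneous e q \<Longrightarrow> homogeneous (d + e) (p * q)"
  by (simp add: homogeneous_def grading.mult mult_monom)

lemma homogeneous_power: "homogeneous d p \<Longrightarrow> homogeneous (d * n) (p ^ n)"
  by (simp add: homogeneous_def grading.power monom_power)

lemma homogeneous_prod:
  "finite A \<Longrightarrow> (\<And>a. a \<in> A \<Longrightarrow> homogeneous 1 (f a)) \<Longrightarrow> homogeneous (card A) (prod f A)"
proof (induction A rule: finite_induct)
  case empty
  then show ?case using homogeneous_Const[of 1] by (simp add: Const_simps)
next
  case (insert a A)
  then show ?case using homogeneous_mult[of 1 "f a" "card A" "prod f A"] by simp
qed

lemma homogeneous_component: "homogeneous d (component d p)"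
proof -
  have "\<forall>d. homogeneous d (component d p)"
  proof (induction p rule: mpoly_induct)
    case (mult p q)
    have "homogeneous d (coeff (grading p) e * coeff (grading q) (d - e))" if "e \<le> d" for d e
      using homogeneous_mult[of e "coeff (grading p) e" "d - e" "coeff (grading q) (d - e)"] mult that
      by (simp add: component_def)
    then show ?case
      by (auto simp: component_def grading.mult coeff_mult intro!: homogeneous_sum)
  qed (auto simp: component_def grading_Const grading_Var grading.add coeff_pCons
      intro: homogeneous_Const homogeneous_Var[simplified] homogeneous_add split: nat.split)
  then show ?thesis by blast
qed

lemma component_sum: "component d (sum f A) = (\<Sum>a\<in>A. component d (f a))"
  by (simp add: component_def grading.sum coeff_sum)

lemma component_homogeneous: "homogeneous e p \<Longrightarrow> component d p = (if d = e then p else 0)"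
  by (simp add: component_def homogeneous_def)

lemma component_mult:
  "component d (p * q) = (\<Sum>e\<le>d. component e p * component (d - e) q)"
  by (simp add: component_def grading.mult coeff_mult)

lemma component_mult_homogeneous:
  assumes "homogeneous e q"
  shows "component d (p * q) = (if e \<le> d then component (d - e) p * q else 0)"
  using assms
  by (simp add: component_def homogeneous_def grading.mult coeff_monom_mult mult.commute[of _ "monom _ _"] mult.commute[of q])

lemma sum_components:
  assumes "degree (grading p) \<le> N"
  shows "p = (\<Sum>d\<le>N. component d p)"
proof -
  have "poly (grading p) 1 = p"
    by (rule ring_homomorphism_eqI[OF ring_homomorphism_comp[OF ring_homomorphism_poly
            grading.ring_homomorphism_axioms] ring_homomorphism_id])
      (auto simp: grading_Const grading_Var poly_monom)
  moreover have "(\<Sum>d\<le>N. component d p) = (\<Sum>d\<le>degree (grading p). component d p)"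
    using assms by (intro sum.mono_neutral_right) (auto simp: component_def coeff_eq_0)
  ultimately show ?thesis
    by (simp add: poly_altdef component_def)
qed

definition constant_term :: "('i::finite, 'k::comm_ring_1) mpoly \<Rightarrow> 'k"
  where "constant_term = subst_hom (\<lambda>a. a) (\<lambda>_. 0)"

interpretation constant_term: ring_homomorphism constant_term
  unfolding constant_term_def by (rule ring_homomorphism_subst_hom[OF ring_homomorphism_id])

lemma constant_term_Const: "constant_term (Const a) = a"
  by (simp add: constant_term_def subst_hom_Const[OF ring_homomorphism_id])

lemma component_0_eq_constant_term: "component 0 p = Const (constant_term p)"
proof -
  have "poly (grading p) 0 = Const (constant_term p)"
    by (rule ring_homomorphism_eqI[OF ring_homomorphism_comp[OF ring_homomorphism_poly
            grading.ring_homomorphism_axioms] ring_homomorphism_comp[OF ring_homomorphism_Const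
            constant_term.ring_homomorphism_axioms]])
      (auto simp: grading_Const grading_Var poly_monom constant_term_def Const_simps
        subst_hom_Const[OF ring_homomorphism_id] subst_hom_Var[OF ring_homomorphism_id])
  then show ?thesis
    by (simp add: component_def poly_0_coeff_0)
qed


section \<open>Derivations\<close>

lemma derivation_sum:
  assumes "\<theta> \<in> derivations"
  shows "\<theta> (sum f A) = (\<Sum>a\<in>A. \<theta> (f a))"
proof -
  have add: "\<theta> (p + q) = \<theta> p + \<theta> q" for p q
    using assms by (auto simp: derivations_def)
  have "\<theta> 0 = 0"
    using add[of 0 0] by simp
  then show ?thesis
    by (induction A rule: infinite_finite_induct) (auto simp: add)
qed

lemma derivation_Const_mult: "\<theta> \<in> derivations \<Longrightarrow> \<theta> (Const c * p) = Const c * \<theta> p"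
  by (auto simp: derivations_def)

lemma derivation_Const:
  assumes "\<theta> \<in> derivations"
  shows "\<theta> (Const c) = 0"
proof -
  have "\<theta> (1 * 1) = \<theta> 1 * 1 + 1 * \<theta> 1"
    using assms unfolding derivations_def by blast
  then have "\<theta> 1 = 0" by simp
  then show ?thesis
    using derivation_Const_mult[OF assms, of c 1] by simp
qed

lemma derivation_eqI:
  fixes \<theta> \<eta> :: "('i::finite, 'k::field) mpoly \<Rightarrow> ('i, 'k) mpoly"
  assumes "\<theta> \<in> derivations" "\<eta> \<in> derivations" "\<And>i. \<theta> (Var i) = \<eta> (Var i)"
  shows "\<theta> = \<eta>"
proof
  fix p
  show "\<theta> p = \<eta> p"
  proof (induction p rule: mpoly_induct)
    case (Const a)
    show ?case by (simp add: derivation_Const assms)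
  qed (use assms in \<open>auto simp: derivations_def\<close>)
qed

text \<open>
  Over the dual numbers, \<open>x\<^sub>i \<mapsto> x\<^sub>i + u\<^sub>i \<epsilon>\<close> extends to a ring homomorphism, and the coefficient of
  \<open>\<epsilon>\<close> in its value at \<open>p\<close> is \<open>\<Sum>\<^sub>i u\<^sub>i \<partial>\<^sub>i p\<close>.
\<close>

lemma derivation_exists:
  fixes u :: "'i::finite \<Rightarrow> ('i, 'k::field) mpoly"
  shows "\<exists>\<theta>\<in>derivations. \<forall>i. \<theta> (Var i) = u i"
proof -
  define h where "h = subst_hom (\<lambda>a. [:Const a:]) (\<lambda>i. [:Var i, u i:])"
  interpret h: ring_homomorphism h
    unfolding h_def by (rule ring_homomorphism_subst_hom[OF ring_homomorphism_const_poly_Const])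
  have h_Const: "h (Const a) = [:Const a:]" and h_Var: "h (Var i) = [:Var i, u i:]" for a i
    by (auto simp: h_def subst_hom_Const[OF ring_homomorphism_const_poly_Const]
        subst_hom_Var[OF ring_homomorphism_const_poly_Const])
  have "poly (h p) 0 = p" for p
    by (rule ring_homomorphism_eqI[OF ring_homomorphism_comp[OF ring_homomorphism_poly
            h.ring_homomorphism_axioms] ring_homomorphism_id]) (auto simp: h_Const h_Var)
  then have h0: "coeff (h p) 0 = p" for p
    by (simp add: poly_0_coeff_0)
  have "(\<lambda>p. coeff (h p) 1) \<in> derivations"
    by (auto simp: derivations_def h.add h.mult coeff_mult h0 h_Const)
  then show ?thesis
    by (rule bexI[rotated]) (simp add: h_Var)
qed


section \<open>Linear forms as polynomials\<close>

locale coordinates = vector_space scale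
  for scale :: "'k::field \<Rightarrow> 'v::ab_group_add \<Rightarrow> 'v" +
  fixes b :: "'i::finite \<Rightarrow> 'v" and \<xi> :: "'i \<Rightarrow> 'v \<Rightarrow> 'k"
  assumes linear_coordinate: "Vector_Spaces.linear scale (*) (\<xi> i)"
    and coordinate_basis: "\<xi> i (b j) = (if i = j then 1 else 0)"
    and coordinate_expansion: "v = (\<Sum>i\<in>UNIV. scale (\<xi> i v) (b i))"

lemma linear_form_add: "Vector_Spaces.linear scale (*) \<beta> \<Longrightarrow> \<beta> (u + v) = \<beta> u + \<beta> v"
  by (simp add: Vector_Spaces.linear_iff)

lemma linear_form_scale: "Vector_Spaces.linear scale (*) \<beta> \<Longrightarrow> \<beta> (scale c v) = c * \<beta> v"
  by (simp add: Vector_Spaces.linear_iff)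

lemma linear_form_0: "Vector_Spaces.linear scale (*) \<beta> \<Longrightarrow> \<beta> 0 = 0"
  using linear_form_add[of scale \<beta> 0 0] unfolding add_0_left by (simp only: add_cancel_right_right)

lemma linear_form_sum: "Vector_Spaces.linear scale (*) \<beta> \<Longrightarrow> \<beta> (sum f A) = (\<Sum>a\<in>A. \<beta> (f a))"
  by (induction A rule: infinite_finite_induct) (auto simp: linear_form_0 linear_form_add)

context coordinates
begin

lemma linear_form_expansion:
  assumes "Vector_Spaces.linear scale (*) \<beta>"
  shows "\<beta> v = (\<Sum>i\<in>UNIV. \<xi> i v * \<beta> (b i))"
  by (subst coordinate_expansion[of v]) (simp add: linear_form_sum[OF assms] linear_form_scale[OF assms])

lemma linear_form_eqI:
  assumes "Vector_Spaces.linear scale (*) \<beta>" "Vector_Spaces.linear scale (*) \<gamma>" "\<And>i. \<beta> (b i) = \<gamma> (b i)"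
  shows "\<beta> = \<gamma>"
  by (rule ext) (metis (no_types, lifting) linear_form_expansion[OF assms(1)]
      linear_form_expansion[OF assms(2)] assms(3) sum.cong)

end

lemma coordinates_exist:
  assumes "vector_space scale" "indexed_basis scale b"
  shows "\<exists>\<xi>. coordinates scale b \<xi>"
proof -
  interpret vector_space scale by fact
  have b: "inj b" "independent (range b)" "span (range b) = UNIV"
    using assms(2) by (auto simp: indexed_basis_def)
  define \<xi> where "\<xi> i v = representation (range b) v (b i)" for i v
  have "coordinates scale b \<xi>"
  proof (rule coordinates.intro[OF assms(1)], unfold coordinates_axioms_def, intro conjI allI, goal_cases)
    case (1 i)
    have "Vector_Spaces.linear scale (*) (\<xi> i)"
      unfolding Vector_Spaces.linear_iff \<xi>_def
      using b by (auto simp: representation_add representation_scale vector_space_def algebra_simps intro: vector_space_axioms)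
    then show ?case .
  next
    case (2 i j)
    then show ?case
      using b by (auto simp: \<xi>_def representation_basis inj_eq)
  next
    case (3 v)
    have "(\<Sum>x\<in>range b. scale (representation (range b) v x) x) = v"
      using b by (intro sum_representation_eq) auto
    then show ?case
      using b by (simp add: \<xi>_def sum.reindex)
  qed
  then show ?thesis by (rule exI[of _ \<xi>])
qed

lemma form_poly_add: "form_poly b (\<lambda>v. \<beta> v + \<gamma> v) = form_poly b \<beta> + form_poly b \<gamma>"
  by (simp add: form_poly_def Const_simps algebra_simps sum.distrib)

lemma form_poly_scale: "form_poly b (\<lambda>v. c * \<beta> v) = Const c * form_poly b \<beta>"
  by (simp add: form_poly_def Const_simps sum_distrib_left mult.assoc)

lemma form_poly_sum: "form_poly b (\<lambda>v. \<Sum>a\<in>A. \<beta> a v) = (\<Sum>a\<in>A. form_poly b (\<beta> a))"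
proof -
  have "form_poly b (\<lambda>v. 0) = 0"
    by (simp add: form_poly_def Const_simps)
  then show ?thesis
    by (induction A rule: infinite_finite_induct) (auto simp: form_poly_add)
qed

lemma homogeneous_form_poly: "homogeneous 1 (form_poly b \<beta>)"
  unfolding form_poly_def
  using homogeneous_mult[OF homogeneous_Const homogeneous_Var] by (intro homogeneous_sum) simp

text \<open>
  The basis \<open>b\<close> gives the variables of the polynomial ring, and the basis \<open>w\<close> is adapted to the
  arrangement. With linear forms written as polynomials in the variables of \<open>b\<close> throughout, the ring
  itself never undergoes a change of coordinates.
\<close>
locale two_bases = b: coordinates scale b \<xi> + w: coordinates scale w \<eta>
  for scale :: "'k::field \<Rightarrow> 'v::ab_group_add \<Rightarrow> 'v"
    and b :: "'i::finite \<Rightarrow> 'v" and \<xi> :: "'i \<Rightarrow> 'v \<Rightarrow> 'k"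
    and w :: "'j::finite \<Rightarrow> 'v" and \<eta> :: "'j \<Rightarrow> 'v \<Rightarrow> 'k"
begin

text \<open>A ring homomorphism may be prescribed on the coordinates of any basis.\<close>

lemma subst_hom_form_poly:
  assumes "ring_homomorphism c" "Vector_Spaces.linear scale (*) \<beta>"
  shows "subst_hom c (\<lambda>i. \<Sum>k\<in>UNIV. c (\<xi> i (w k)) * r k) (form_poly b \<beta>) = (\<Sum>k\<in>UNIV. c (\<beta> (w k)) * r k)"
proof -
  interpret c: ring_homomorphism c by fact
  interpret h: ring_homomorphism "subst_hom c (\<lambda>i. \<Sum>k\<in>UNIV. c (\<xi> i (w k)) * r k)"
    by (rule ring_homomorphism_subst_hom[OF assms(1)])
  have "(\<Sum>i\<in>UNIV. c (\<beta> (b i)) * (\<Sum>k\<in>UNIV. c (\<xi> i (w k)) * r k))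
      = (\<Sum>i\<in>UNIV. \<Sum>k\<in>UNIV. c (\<xi> i (w k) * \<beta> (b i)) * r k)"
    by (simp add: sum_distrib_left c.mult mult_ac)
  also have "\<dots> = (\<Sum>k\<in>UNIV. \<Sum>i\<in>UNIV. c (\<xi> i (w k) * \<beta> (b i)) * r k)"
    by (rule sum.swap)
  also have "\<dots> = (\<Sum>k\<in>UNIV. c (\<beta> (w k)) * r k)"
    by (simp add: b.linear_form_expansion[OF assms(2), of "w _"] c.sum sum_distrib_right)
  finally show ?thesis
    by (simp add: form_poly_def h.sum h.mult subst_hom_Const[OF assms(1)] subst_hom_Var[OF assms(1)])
qed

lemma form_poly_expansion:
  assumes "Vector_Spaces.linear scale (*) \<beta>"
  shows "form_poly b \<beta> = (\<Sum>k\<in>UNIV. Const (\<beta> (w k)) * form_poly b (\<eta> k))"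
proof -
  have "\<beta> = (\<lambda>v. \<Sum>k\<in>UNIV. \<beta> (w k) * \<eta> k v)"
    by (rule ext, subst w.linear_form_expansion[OF assms]) (simp add: mult.commute)
  then have "form_poly b \<beta> = form_poly b (\<lambda>v. \<Sum>k\<in>UNIV. \<beta> (w k) * \<eta> k v)"
    by metis
  then show ?thesis
    by (simp only: form_poly_sum form_poly_scale)
qed

end

context coordinates
begin

lemma form_poly_eq_0D:
  assumes "Vector_Spaces.linear scale (*) \<beta>" "form_poly b \<beta> = 0"
  shows "\<beta> v = 0"
proof -
  interpret h: ring_homomorphism "subst_hom (\<lambda>a::'k. a) (\<lambda>i. \<xi> i v)"
    by (rule ring_homomorphism_subst_hom[OF ring_homomorphism_id])
  have "subst_hom (\<lambda>a. a) (\<lambda>i. \<xi> i v) (form_poly b \<beta>) = (\<Sum>i\<in>UNIV. \<beta> (b i) * \<xi> i v)"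
    by (simp add: form_poly_def h.sum h.mult subst_hom_Const[OF ring_homomorphism_id] subst_hom_Var[OF ring_homomorphism_id])
  also have "\<dots> = \<beta> v"
    by (subst (2) linear_form_expansion[OF assms(1)]) (simp add: mult.commute)
  finally show ?thesis
    by (simp add: assms(2) subst_hom_def)
qed

text \<open>
  If \<open>\<alpha> v = 1\<close>, then \<open>x\<^sub>i \<mapsto> x\<^sub>i - x\<^sub>i(v) \<alpha>\<close> is a ring endomorphism which is the identity modulo \<open>\<alpha>\<close>
  and kills \<open>\<alpha>\<close>: its kernel is the ideal of \<open>\<alpha>\<close>, which is therefore prime.
\<close>

definition kill_form :: "('v \<Rightarrow> 'k) \<Rightarrow> 'v \<Rightarrow> ('i, 'k) mpoly \<Rightarrow> ('i, 'k) mpoly"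
  where "kill_form \<alpha> v = subst_hom Const (\<lambda>i. Var i - Const (\<xi> i v) * form_poly b \<alpha>)"

lemma ring_homomorphism_kill_form: "ring_homomorphism (kill_form \<alpha> v)"
  unfolding kill_form_def by (rule ring_homomorphism_subst_hom[OF ring_homomorphism_Const])

lemma kill_form_Const: "kill_form \<alpha> v (Const a) = Const a"
  by (simp add: kill_form_def subst_hom_Const[OF ring_homomorphism_Const])

lemma kill_form_Var: "kill_form \<alpha> v (Var i) = Var i - Const (\<xi> i v) * form_poly b \<alpha>"
  by (simp add: kill_form_def subst_hom_Var[OF ring_homomorphism_Const])

lemma kill_form_form_poly:
  assumes "Vector_Spaces.linear scale (*) \<beta>"
  shows "kill_form \<alpha> v (form_poly b \<beta>) = form_poly b \<beta> - Const (\<beta> v) * form_poly b \<alpha>"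
proof -
  interpret h: ring_homomorphism "kill_form \<alpha> v" by (rule ring_homomorphism_kill_form)
  interpret c: ring_homomorphism Const by (rule ring_homomorphism_Const)
  have "kill_form \<alpha> v (form_poly b \<beta>)
      = (\<Sum>i\<in>UNIV. Const (\<beta> (b i)) * Var i - Const (\<xi> i v * \<beta> (b i)) * form_poly b \<alpha>)"
    unfolding form_poly_def[of b \<beta>]
    by (simp add: h.sum h.mult kill_form_Const kill_form_Var algebra_simps c.mult)
  also have "\<dots> = form_poly b \<beta> - Const (\<beta> v) * form_poly b \<alpha>"
    by (simp add: sum_subtractf form_poly_def[of b \<beta>] linear_form_expansion[OF assms, of v] c.sum
        sum_distrib_right)
  finally show ?thesis .
qed

lemma form_poly_dvd_iff:
  assumes "Vector_Spaces.linear scale (*) \<alpha>" "\<alpha> v = 1"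
  shows "form_poly b \<alpha> dvd p \<longleftrightarrow> kill_form \<alpha> v p = 0"
proof -
  interpret h: ring_homomorphism "kill_form \<alpha> v" by (rule ring_homomorphism_kill_form)
  have cong: "form_poly b \<alpha> dvd p - kill_form \<alpha> v p" for p
  proof (induction p rule: mpoly_induct)
    case (add p q)
    have "p + q - kill_form \<alpha> v (p + q) = (p - kill_form \<alpha> v p) + (q - kill_form \<alpha> v q)"
      by (simp add: h.add algebra_simps)
    then show ?case using add by (simp only: dvd_add)
  next
    case (mult p q)
    have "p * q - kill_form \<alpha> v (p * q) = (p - kill_form \<alpha> v p) * q + kill_form \<alpha> v p * (q - kill_form \<alpha> v q)"
      by (simp add: h.mult algebra_simps)
    then show ?case using mult by (simp only: dvd_add dvd_mult dvd_mult2)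
  qed (auto simp: kill_form_Const kill_form_Var)
  have "kill_form \<alpha> v (form_poly b \<alpha>) = 0"
    by (simp add: kill_form_form_poly assms Const_simps)
  then show ?thesis
    using h.dvd[of "form_poly b \<alpha>" p] cong[of p] by auto
qed

lemma linear_form_normalize:
  assumes "Vector_Spaces.linear scale (*) \<alpha>" "\<alpha> u \<noteq> 0"
  obtains v where "\<alpha> v = 1"
  using assms linear_form_scale[OF assms(1), of "inverse (\<alpha> u)" u] by simp

lemma form_poly_dvd_multD:
  assumes "Vector_Spaces.linear scale (*) \<alpha>" "\<alpha> u \<noteq> 0" "form_poly b \<alpha> dvd p * q"
  shows "form_poly b \<alpha> dvd p \<or> form_poly b \<alpha> dvd q"
proof -
  obtain v where v: "\<alpha> v = 1"
    using linear_form_normalize assms by blast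
  interpret h: ring_homomorphism "kill_form \<alpha> v" by (rule ring_homomorphism_kill_form)
  show ?thesis
    using assms(3) by (simp add: form_poly_dvd_iff[OF assms(1) v] h.mult mpoly_mult_eq_0_iff)
qed

lemma form_poly_dvd_form_polyD:
  assumes "Vector_Spaces.linear scale (*) \<alpha>" "\<alpha> u \<noteq> 0"
    and "Vector_Spaces.linear scale (*) \<beta>" "form_poly b \<alpha> dvd form_poly b \<beta>"
  shows "\<exists>c. \<forall>x. \<beta> x = c * \<alpha> x"
proof -
  obtain v where v: "\<alpha> v = 1"
    using linear_form_normalize assms by blast
  have lin: "Vector_Spaces.linear scale (*) (\<lambda>x. \<beta> x + (- \<beta> v) * \<alpha> x)"
    using assms(1,3) by (auto simp: Vector_Spaces.linear_iff algebra_simps)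
  have "form_poly b (\<lambda>x. \<beta> x + (- \<beta> v) * \<alpha> x) = kill_form \<alpha> v (form_poly b \<beta>)"
    by (subst form_poly_add, subst form_poly_scale) (simp add: kill_form_form_poly assms Const_simps)
  also have "\<dots> = 0"
    using form_poly_dvd_iff[OF assms(1) v] assms(4) by simp
  finally have zero: "\<beta> x + (- \<beta> v) * \<alpha> x = 0" for x
    by (rule form_poly_eq_0D[OF lin])
  have "\<beta> x = \<beta> v * \<alpha> x" for x
    using zero[of x, folded eq_neg_iff_add_eq_0] by simp
  then show ?thesis by blast
qed

end


section \<open>Graded submodules of a free module\<close>

text \<open>
  By eliminating one unknown together with one equation, without division, so that the result applies
  to coefficients in the field as well as to polynomial coefficients.
\<close>

lemma nontrivial_solution:
  fixes s :: "'a \<Rightarrow> 'b \<Rightarrow> 'r::comm_ring_1"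
  assumes no_zero_divisors: "\<And>x y :: 'r. x * y = 0 \<Longrightarrow> x = 0 \<or> y = 0"
    and "finite F" "finite J" "card F < card J"
  shows "\<exists>t. (\<exists>j\<in>J. t j \<noteq> 0) \<and> (\<forall>f\<in>F. (\<Sum>j\<in>J. t j * s j f) = 0)"
  using assms(2-4)
proof (induction F arbitrary: J s rule: finite_induct)
  case empty
  then obtain j where "j \<in> J" by (metis card_gt_0_iff ex_in_conv card.empty)
  then show ?case by (intro exI[of _ "\<lambda>_. 1"]) auto
next
  case (insert f F)
  show ?case
  proof (cases "\<exists>j\<in>J. s j f \<noteq> 0")
    case False
    then show ?thesis
      using insert.IH[of J s] insert.prems insert.hyps by (auto simp: card_insert_if)
  next
    case True
    then obtain j0 where j0: "j0 \<in> J" "s j0 f \<noteq> 0" by blast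
    have J: "finite (J - {j0})" "card F < card (J - {j0})"
      using insert.prems insert.hyps j0 by auto
    obtain t where t: "\<exists>j\<in>J - {j0}. t j \<noteq> 0"
        "\<forall>g\<in>F. (\<Sum>j\<in>J - {j0}. t j * (s j0 f * s j g - s j f * s j0 g)) = 0"
      using insert.IH[OF J, of "\<lambda>j g. s j0 f * s j g - s j f * s j0 g"] by blast
    define t' where "t' j = (if j = j0 then - (\<Sum>j\<in>J - {j0}. t j * s j f) else s j0 f * t j)" for j
    have split: "(\<Sum>j\<in>J. t' j * s j g) = t' j0 * s j0 g + (\<Sum>j\<in>J - {j0}. s j0 f * t j * s j g)" for g
      using j0 insert.prems by (subst sum.remove[of _ j0]) (auto simp: t'_def intro!: sum.cong)
    have "(\<Sum>j\<in>J. t' j * s j g) = (\<Sum>j\<in>J - {j0}. t j * (s j0 f * s j g - s j f * s j0 g))" for g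
      by (subst split) (simp add: t'_def sum_distrib_right sum_distrib_left algebra_simps sum_subtractf)
    then have "(\<Sum>j\<in>J. t' j * s j g) = 0" if "g \<in> insert f F" for g
      using t(2) that by (auto simp: mult.commute)
    moreover obtain j where "j \<in> J - {j0}" "t j \<noteq> 0"
      using t(1) by blast
    then have "j \<in> J" "t' j \<noteq> 0"
      using no_zero_divisors[of "s j0 f" "t j"] j0 by (auto simp: t'_def)
    ultimately show ?thesis by blast
  qed
qed

definition vec_scale :: "'r::comm_ring_1 \<Rightarrow> ('j \<Rightarrow> 'r) \<Rightarrow> 'j \<Rightarrow> 'r"
  where "vec_scale s u = (\<lambda>j. s * u j)"

interpretation vec: module vec_scale
  by unfold_locales (auto simp: vec_scale_def fun_eq_iff algebra_simps)

lemma vec_sum_apply: "(\<Sum>a\<in>A. f a) j = (\<Sum>a\<in>A. f a j)"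
  by (induction A rule: infinite_finite_induct) auto

definition axis :: "'j \<Rightarrow> 'r::comm_ring_1 \<Rightarrow> 'j \<Rightarrow> 'r"
  where "axis j c = (\<lambda>k. if k = j then c else 0)"

text \<open>
  The form in which the invariance of rank is needed: nonzero multiples of distinct unit vectors are
  linearly independent.
\<close>
lemma card_le_card_spanning:
  fixes c :: "'j \<Rightarrow> 'r::comm_ring_1"
  assumes no_zero_divisors: "\<And>x y :: 'r. x * y = 0 \<Longrightarrow> x = 0 \<or> y = 0"
    and "finite F" "finite J"
    and "\<And>j. j \<in> J \<Longrightarrow> axis j (c j) \<in> vec.span F" "\<And>j. j \<in> J \<Longrightarrow> c j \<noteq> 0"
  shows "card J \<le> card F"
proof (rule ccontr)
  assume "\<not> card J \<le> card F"
  then have less: "card F < card J" by simp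
  have "\<exists>s. axis j (c j) = (\<Sum>f\<in>F. vec_scale (s f) f)" if "j \<in> J" for j
    using assms(4)[OF that] by (auto simp: vec.span_finite[OF assms(2)])
  then obtain s where s: "\<And>j. j \<in> J \<Longrightarrow> axis j (c j) = (\<Sum>f\<in>F. vec_scale (s j f) f)"
    by metis
  obtain t where t: "\<exists>j\<in>J. t j \<noteq> 0" "\<forall>f\<in>F. (\<Sum>j\<in>J. t j * s j f) = 0"
    using nontrivial_solution[OF no_zero_divisors assms(2,3) less, of s] by blast
  have "(\<Sum>j\<in>J. t j * axis j (c j) k) = 0" for k
  proof -
    have "(\<Sum>j\<in>J. t j * axis j (c j) k) = (\<Sum>j\<in>J. \<Sum>f\<in>F. t j * s j f * f k)"
      by (intro sum.cong refl) (simp add: s vec_sum_apply vec_scale_def sum_distrib_left mult.assoc)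
    also have "\<dots> = (\<Sum>f\<in>F. (\<Sum>j\<in>J. t j * s j f) * f k)"
      by (subst sum.swap) (simp add: sum_distrib_right)
    finally show ?thesis using t(2) by simp
  qed
  moreover have "(\<Sum>j\<in>J. t j * axis j (c j) k) = t k * c k" if "k \<in> J" for k
    using that assms(3) by (simp add: axis_def if_distrib[of "(*) _"] cong: if_cong)
  ultimately show False
    using t(1) no_zero_divisors assms(5) by metis
qed

definition vec_component :: "nat \<Rightarrow> ('j \<Rightarrow> ('i::finite, 'k::comm_ring_1) mpoly) \<Rightarrow> 'j \<Rightarrow> ('i, 'k) mpoly"
  where "vec_component d u = (\<lambda>j. component d (u j))"

definition vec_homogeneous :: "nat \<Rightarrow> ('j \<Rightarrow> ('i::finite, 'k::comm_ring_1) mpoly) \<Rightarrow> bool"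
  where "vec_homogeneous d u \<longleftrightarrow> (\<forall>j. homogeneous d (u j))"

lemma vec_component_sum: "vec_component d (sum f A) = (\<Sum>a\<in>A. vec_component d (f a))"
  by (simp add: vec_component_def fun_eq_iff vec_sum_apply component_sum)

lemma vec_component_homogeneous: "vec_homogeneous d u \<Longrightarrow> vec_component d u = u"
  by (simp add: vec_component_def vec_homogeneous_def component_homogeneous[of d])

lemma vec_component_scale_homogeneous:
  "vec_homogeneous e u \<Longrightarrow>
    vec_component d (vec_scale s u) = (if e \<le> d then vec_scale (component (d - e) s) u else 0)"
  by (auto simp: vec_component_def vec_scale_def vec_homogeneous_def fun_eq_iff component_mult_homogeneous[of e])

text \<open>
  Comparison of components: generators of higher degree cannot contribute.
\<close>
lemma homogeneous_in_span:
  assumes "finite G" "\<And>g. g \<in> G \<Longrightarrow> vec_homogeneous (dg g) g"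
    and "u \<in> vec.span G" "vec_homogeneous d u"
  shows "u \<in> vec.span {g\<in>G. dg g \<le> d}"
proof -
  obtain s where s: "u = (\<Sum>g\<in>G. vec_scale (s g) g)"
    using assms(3) by (auto simp: vec.span_finite[OF assms(1)])
  have "u = vec_component d u"
    using assms(4) by (simp add: vec_component_homogeneous)
  also have "\<dots> = (\<Sum>g\<in>G. if dg g \<le> d then vec_scale (component (d - dg g) (s g)) g else 0)"
    unfolding s vec_component_sum by (rule sum.cong) (auto simp: vec_component_scale_homogeneous[OF assms(2)])
  also have "\<dots> \<in> vec.span {g\<in>G. dg g \<le> d}"
    by (intro vec.span_sum) (auto intro: vec.span_scale vec.span_base vec.span_zero)
  finally show ?thesis .
qed

text \<open>
  Graded Nakayama: in a homogeneous generating set of minimal size, no element is a combination of the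
  others, so the residues in \<open>M / (x\<^sub>1, \<dots>, x\<^sub>\<ell>) M\<close> are linearly independent over the field. The
  residues of \<open>E\<close> span this space, which gives the bound on \<open>card G\<close>.
\<close>

lemma homogeneous_generators:
  fixes M :: "('j::finite \<Rightarrow> ('i::finite, 'k::field) mpoly) set"
  assumes "finite E" "vec.span E = M"
    and graded: "\<And>u d. u \<in> M \<Longrightarrow> vec_component d u \<in> M"
  obtains G where "finite G" "card G \<le> card E" "vec.span G = M"
    "\<And>g. g \<in> G \<Longrightarrow> \<exists>d. vec_homogeneous d g"
proof -
  define P where "P G \<longleftrightarrow> finite G \<and> vec.span G = M \<and> (\<forall>g\<in>G. \<exists>d. vec_homogeneous d g)" for G
  have sub: "E \<subseteq> M"
    using assms(2) vec.span_superset by blast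
  have "\<exists>G. P G"
  proof -
    define N where "N = Max (insert 0 ((\<lambda>(e, j). degree (grading (e j))) ` (E \<times> UNIV)))"
    have N: "degree (grading (e j)) \<le> N" if "e \<in> E" for e j
      unfolding N_def using that assms(1) by (intro Max_ge) auto
    define G where "G = (\<lambda>(e, d). vec_component d e) ` (E \<times> {..N})"
    have "G \<subseteq> M"
      using sub graded by (auto simp: G_def)
    moreover have "e \<in> vec.span G" if "e \<in> E" for e
    proof -
      have "e = (\<Sum>d\<le>N. vec_component d e)"
        using sum_components[OF N[OF that]] by (simp add: fun_eq_iff vec_sum_apply vec_component_def)
      also have "\<dots> \<in> vec.span G"
        using that by (intro vec.span_sum vec.span_base) (auto simp: G_def)
      finally show ?thesis .
    qed
    ultimately have "vec.span G = M"
      using assms(2) by (metis vec.span_mono vec.span_span subset_antisym subsetI)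
    moreover have "\<forall>g\<in>G. \<exists>d. vec_homogeneous d g"
      by (auto simp: G_def vec_homogeneous_def vec_component_def intro: homogeneous_component)
    ultimately show ?thesis
      using assms(1) by (intro exI[of _ G]) (auto simp: P_def G_def)
  qed
  then obtain G where "P G" and min: "\<And>G'. P G' \<Longrightarrow> card G \<le> card G'"
    using ex_has_least_nat[of P _ card] by blast
  then have G: "finite G" "vec.span G = M" "\<And>g. g \<in> G \<Longrightarrow> \<exists>d. vec_homogeneous d g"
    by (auto simp: P_def)
  then obtain dg where dg: "\<And>g. g \<in> G \<Longrightarrow> vec_homogeneous (dg g) g"
    by metis
  have "card G \<le> card E"
  proof (rule ccontr)
    assume "\<not> card G \<le> card E"
    then have less: "card E < card G" by simp
    have "\<exists>s. g = (\<Sum>e\<in>E. vec_scale (s e) e)" if "g \<in> G" for g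
    proof -
      have "g \<in> vec.span E"
        using that G(2) assms(2) vec.span_base by blast
      then show ?thesis by (auto simp: vec.span_finite[OF assms(1)])
    qed
    then have "\<forall>g\<in>G. \<exists>s. g = (\<Sum>e\<in>E. vec_scale (s e) e)"
      by blast
    from bchoice[OF this] obtain s where s: "\<And>g. g \<in> G \<Longrightarrow> g = (\<Sum>e\<in>E. vec_scale (s g e) e)"
      by blast
    obtain t where t: "\<exists>g\<in>G. t g \<noteq> 0" "\<forall>e\<in>E. (\<Sum>g\<in>G. t g * constant_term (s g e)) = 0"
      using nontrivial_solution[OF _ assms(1) G(1) less, of "\<lambda>g e. constant_term (s g e)"] by auto
    then obtain g0 where g0: "g0 \<in> G" "t g0 \<noteq> 0" by blast
    define d where "d = dg g0"
    define S where "S e = (\<Sum>g\<in>G. Const (t g) * s g e)" for e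
    define z where "z = (\<Sum>g\<in>G. vec_scale (Const (t g)) g)"
    have z: "z = (\<Sum>e\<in>E. vec_scale (S e) e)"
    proof -
      have "vec_scale a g = (\<Sum>e\<in>E. vec_scale (a * s g e) e)" if "g \<in> G" for a g
        using arg_cong[OF s[OF that], of "vec_scale a"] by (simp add: vec.scale_sum_right)
      then have "z = (\<Sum>g\<in>G. \<Sum>e\<in>E. vec_scale (Const (t g) * s g e) e)"
        unfolding z_def by (intro sum.cong refl)
      also have "\<dots> = (\<Sum>e\<in>E. vec_scale (S e) e)"
        by (subst sum.swap) (simp add: S_def vec.scale_sum_left)
      finally show ?thesis .
    qed
    have S0: "component 0 (S e) = 0" if "e \<in> E" for e
    proof -
      have "constant_term (S e) = 0"
        using t(2) that by (simp add: S_def constant_term.sum constant_term.mult constant_term_Const)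
      then show ?thesis by (simp add: component_0_eq_constant_term Const_simps)
    qed
    let ?L = "vec.span (G - {g0})"
    have lower: "vec_component e u \<in> ?L" if "u \<in> M" "e < d" for e u
    proof -
      have "vec_component e u \<in> vec.span {g\<in>G. dg g \<le> e}"
        using graded[OF that(1)] G(2)
        by (intro homogeneous_in_span[OF G(1) dg])
          (auto simp: vec_homogeneous_def vec_component_def homogeneous_component)
      moreover have "{g\<in>G. dg g \<le> e} \<subseteq> G - {g0}"
        using that(2) by (auto simp: d_def)
      ultimately show ?thesis using vec.span_mono by blast
    qed
    have in_span: "vec_component d z \<in> ?L"
    proof -
      have "vec_component d (vec_scale (S e) e)
          = (\<Sum>j\<le>d. if j = 0 then 0 else vec_scale (component j (S e)) (vec_component (d - j) e))"
        if "e \<in> E" for e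
        using S0[OF that]
        by (auto simp: fun_eq_iff vec_component_def vec_scale_def component_mult vec_sum_apply intro!: sum.cong)
      moreover have "(\<Sum>j\<le>d. if j = 0 then 0 else vec_scale (component j (S e)) (vec_component (d - j) e)) \<in> ?L"
        if "e \<in> E" for e
        using that sub by (intro vec.span_sum) (auto intro!: vec.span_zero vec.span_scale lower)
      ultimately show ?thesis
        unfolding z vec_component_sum by (intro vec.span_sum) simp
    qed
    have split: "vec_component d z
        = vec_scale (Const (t g0)) g0 + (\<Sum>g\<in>G - {g0}. vec_component d (vec_scale (Const (t g)) g))"
    proof -
      have "vec_component d (vec_scale (Const (t g0)) g0) = vec_scale (Const (t g0)) g0"
        using dg[OF g0(1)] homogeneous_mult[OF homogeneous_Const]
        by (intro vec_component_homogeneous) (auto simp: vec_homogeneous_def d_def vec_scale_def)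
      then show ?thesis
        unfolding z_def vec_component_sum using g0 G(1) by (subst sum.remove[of _ g0]) auto
    qed
    have rest: "(\<Sum>g\<in>G - {g0}. vec_component d (vec_scale (Const (t g)) g)) \<in> ?L"
      by (intro vec.span_sum)
        (auto simp: vec_component_scale_homogeneous[OF dg] intro: vec.span_scale vec.span_base vec.span_zero)
    have "vec_scale (Const (t g0)) g0 \<in> ?L"
      using vec.span_diff[OF in_span rest] unfolding split by simp
    from vec.span_scale[OF this, of "Const (inverse (t g0))"] have "g0 \<in> ?L"
      using g0(2) by (simp add: Const_simps(2)[symmetric]) (simp add: Const_simps)
    then have "G \<subseteq> ?L"
      using vec.span_superset[of "G - {g0}"] by blast
    then have "?L = M"
      using G(2) vec.span_mono[of "G - {g0}" G] vec.span_minimal[OF _ vec.subspace_span] by blast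
    then have "P (G - {g0})"
      using G(1,3) by (simp add: P_def)
    from min[OF this] show False
      using card_Diff1_less[OF G(1) g0(1)] by simp
  qed
  with G show thesis by (intro that)
qed


section \<open>Logarithmic derivations in the coordinates of a basis\<close>

text \<open>
  The coordinate vectors \<open>(\<theta>(x\<^sub>k))\<^sub>k\<close> of the logarithmic derivations \<open>\<theta>\<close>, where the \<open>x\<^sub>k\<close> are dual to \<open>w\<close>.
\<close>
definition log_vectors ::
    "('i::finite \<Rightarrow> 'v) \<Rightarrow> ('j::finite \<Rightarrow> 'v) \<Rightarrow> ('v set \<Rightarrow> 'v \<Rightarrow> 'k::field) \<Rightarrow> 'v set set \<Rightarrow>
      ('v set \<Rightarrow> nat) \<Rightarrow> ('j \<Rightarrow> ('i, 'k) mpoly) set"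
  where "log_vectors b w \<alpha> \<A> m =
    {p. \<forall>H\<in>\<A>. form_poly b (\<alpha> H) ^ m H dvd (\<Sum>k\<in>UNIV. Const (\<alpha> H (w k)) * p k)}"

lemma subspace_log_vectors: "vec.subspace (log_vectors b w \<alpha> \<A> m)"
proof (rule vec.subspaceI)
  fix p s assume p: "p \<in> log_vectors b w \<alpha> \<A> m"
  have "(\<Sum>k\<in>UNIV. Const (\<alpha> H (w k)) * vec_scale s p k) = s * (\<Sum>k\<in>UNIV. Const (\<alpha> H (w k)) * p k)" for H
    by (simp add: vec_scale_def sum_distrib_left mult_ac)
  then show "vec_scale s p \<in> log_vectors b w \<alpha> \<A> m"
    using p by (simp add: log_vectors_def)
qed (auto simp: log_vectors_def algebra_simps sum.distrib)

lemma dvd_component: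
  assumes "homogeneous e q" "q dvd p"
  shows "q dvd component d p"
proof -
  obtain s where "p = s * q" using assms(2) by (auto simp: dvd_def mult.commute)
  then show ?thesis
    using component_mult_homogeneous[OF assms(1), of d s] by auto
qed

lemma homogeneous_dvd_lower_degree:
  assumes "homogeneous e q" "homogeneous d p" "q dvd p" "d < e"
  shows "p = 0"
proof -
  obtain s where s: "p = s * q" using assms(3) by (auto simp: dvd_def mult.commute)
  have "p = component d p"
    using assms(2) by (simp add: component_homogeneous[of d])
  also have "\<dots> = 0"
    unfolding s using component_mult_homogeneous[OF assms(1), of d s] assms(4) by simp
  finally show ?thesis .
qed

lemma graded_log_vectors:
  assumes "p \<in> log_vectors b w \<alpha> \<A> m"
  shows "vec_component d p \<in> log_vectors b w \<alpha> \<A> m"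
proof -
  have const: "component d (Const a * q) = Const a * component d q" for a q
    using component_mult_homogeneous[OF homogeneous_Const, of d q a] by (simp add: mult.commute)
  have "component d (\<Sum>k\<in>UNIV. Const (\<alpha> H (w k)) * p k)
      = (\<Sum>k\<in>UNIV. Const (\<alpha> H (w k)) * vec_component d p k)" for H
    by (simp add: component_sum const vec_component_def)
  moreover have hom: "homogeneous (m H) (form_poly b (\<alpha> H) ^ m H)" for H
    using homogeneous_power[OF homogeneous_form_poly[of b "\<alpha> H"], of "m H"] by simp
  moreover have "form_poly b (\<alpha> H) ^ m H dvd component d (\<Sum>k\<in>UNIV. Const (\<alpha> H (w k)) * p k)"
    if "H \<in> \<A>" for H
    using that assms by (intro dvd_component[OF hom]) (simp add: log_vectors_def)
  ultimately show ?thesis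
    by (simp add: log_vectors_def)
qed

text \<open>
  A basis of a graded module may consist of inhomogeneous elements; its size is still bounded by the rank,
  and \<open>homogeneous_generators\<close> turns it into homogeneous generators.
\<close>
lemma vec_independent_card:
  fixes E :: "('j::finite \<Rightarrow> ('i::finite, 'k::field) mpoly) set"
  assumes "vec.independent E"
  shows "finite E \<and> card E \<le> CARD('j)"
proof (rule ccontr)
  assume "\<not> (finite E \<and> card E \<le> CARD('j))"
  then have "\<exists>F\<subseteq>E. finite F \<and> card F = Suc CARD('j)"
    by (metis infinite_arbitrarily_large obtain_subset_with_card_n not_less_eq_eq)
  then obtain F where F: "F \<subseteq> E" "finite F" "CARD('j) < card F"
    by auto
  obtain t where t: "\<exists>f\<in>F. t f \<noteq> 0" "\<forall>k\<in>UNIV. (\<Sum>f\<in>F. t f * f k) = 0"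
    using nontrivial_solution[OF mpoly_mult_eq_0 _ F(2,3), of "\<lambda>f. f"] by auto
  then have "(\<Sum>f\<in>F. vec_scale (t f) f) = 0"
    by (simp add: fun_eq_iff vec_sum_apply vec_scale_def)
  then show False
    using t(1) vec.independentD[OF assms F(2,1), of t] by auto
qed

context two_bases
begin

definition coordinate_vector :: "(('i, 'k) mpoly \<Rightarrow> ('i, 'k) mpoly) \<Rightarrow> 'j \<Rightarrow> ('i, 'k) mpoly"
  where "coordinate_vector \<theta> = (\<lambda>k. \<theta> (form_poly b (\<eta> k)))"

lemma module_hom_coordinate_vector: "module_hom der_scale vec_scale coordinate_vector"
  by (intro module_hom.intro module_hom_axioms.intro module_der_scale vec.module_axioms)
    (auto simp: coordinate_vector_def der_scale_def vec_scale_def)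

lemma derivation_form_poly:
  assumes "\<theta> \<in> derivations" "Vector_Spaces.linear scale (*) \<beta>"
  shows "\<theta> (form_poly b \<beta>) = (\<Sum>k\<in>UNIV. Const (\<beta> (w k)) * coordinate_vector \<theta> k)"
  by (subst form_poly_expansion[OF assms(2)])
    (simp add: derivation_sum[OF assms(1)] derivation_Const_mult[OF assms(1)] coordinate_vector_def)

lemma inj_on_coordinate_vector: "inj_on coordinate_vector derivations"
proof (rule inj_onI)
  fix \<theta> \<theta>' assume *: "\<theta> \<in> derivations" "\<theta>' \<in> derivations" "coordinate_vector \<theta> = coordinate_vector \<theta>'"
  have "Var i = form_poly b (\<xi> i)" for i
    by (simp add: form_poly_def b.coordinate_basis Const_simps if_distrib[of Const] if_distrib[of "\<lambda>x. x * _"] cong: if_cong)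
  then show "\<theta> = \<theta>'"
    using * by (intro derivation_eqI) (auto simp: derivation_form_poly b.linear_coordinate)
qed

lemma coordinate_vector_exists: "\<exists>\<theta>\<in>derivations. coordinate_vector \<theta> = p"
proof -
  define u where "u i = (\<Sum>k\<in>UNIV. Const (\<xi> i (w k)) * p k)" for i
  obtain \<theta> where \<theta>: "\<theta> \<in> derivations" "\<And>i. \<theta> (Var i) = u i"
    using derivation_exists[of u] by blast
  interpret h: ring_homomorphism "subst_hom Const u"
    by (rule ring_homomorphism_subst_hom[OF ring_homomorphism_Const])
  have "\<theta> (form_poly b \<beta>) = subst_hom Const u (form_poly b \<beta>)" for \<beta>
    by (simp add: form_poly_def derivation_sum[OF \<theta>(1)] derivation_Const_mult[OF \<theta>(1)] \<theta>(2) h.sum h.mult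
        subst_hom_Const[OF ring_homomorphism_Const] subst_hom_Var[OF ring_homomorphism_Const])
  moreover have "subst_hom Const u (form_poly b (\<eta> k)) = (\<Sum>j\<in>UNIV. Const (\<eta> k (w j)) * p j)" for k
    unfolding u_def using subst_hom_form_poly[OF ring_homomorphism_Const w.linear_coordinate, of p] .
  ultimately have "coordinate_vector \<theta> = p"
    by (simp add: fun_eq_iff coordinate_vector_def w.coordinate_basis Const_simps if_distrib[of Const]
        if_distrib[of "\<lambda>x. x * _"] cong: if_cong)
  with \<theta>(1) show ?thesis by blast
qed

lemma image_log_derivations:
  assumes "\<And>H. H \<in> \<A> \<Longrightarrow> Vector_Spaces.linear scale (*) (\<alpha> H)"
  shows "coordinate_vector ` log_derivations b \<alpha> \<A> m = log_vectors b w \<alpha> \<A> m"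
proof -
  have "coordinate_vector \<theta> \<in> log_vectors b w \<alpha> \<A> m \<longleftrightarrow> \<theta> \<in> log_derivations b \<alpha> \<A> m"
    if "\<theta> \<in> derivations" for \<theta>
    using that assms by (auto simp: log_derivations_def log_vectors_def derivation_form_poly)
  moreover have "log_derivations b \<alpha> \<A> m \<subseteq> derivations"
    by (auto simp: log_derivations_def)
  ultimately show ?thesis
    using coordinate_vector_exists by (auto simp: image_iff) (metis)
qed

lemma free_imp_small_generating_set:
  assumes "\<And>H. H \<in> \<A> \<Longrightarrow> Vector_Spaces.linear scale (*) (\<alpha> H)"
    and "free_multiarrangement b \<alpha> \<A> m"
  obtains E where "finite E" "card E \<le> CARD('j)" "vec.span E = log_vectors b w \<alpha> \<A> m"
proof -
  interpret f: module_hom der_scale vec_scale coordinate_vector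
    by (rule module_hom_coordinate_vector)
  obtain E where E: "f.m1.independent E" "f.m1.span E = log_derivations b \<alpha> \<A> m"
    using assms(2) by (auto simp: free_multiarrangement_def free_submodule_def)
  have "inj_on coordinate_vector (f.m1.span E)"
    unfolding E(2) using inj_on_coordinate_vector by (rule inj_on_subset) (auto simp: log_derivations_def)
  then have "vec.independent (coordinate_vector ` E)"
    using E(1) by (intro f.independent_injective_image)
  moreover have "vec.span (coordinate_vector ` E) = log_vectors b w \<alpha> \<A> m"
    by (simp add: f.span_image E(2) image_log_derivations[OF assms(1)])
  ultimately show thesis
    using that vec_independent_card by blast
qed

lemma free_if_basis:
  fixes \<theta> :: "'j \<Rightarrow> 'j \<Rightarrow> ('i, 'k) mpoly"
  assumes lin: "\<And>H. H \<in> \<A> \<Longrightarrow> Vector_Spaces.linear scale (*) (\<alpha> H)"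
    and mem: "\<And>j. \<theta> j \<in> log_vectors b w \<alpha> \<A> m"
    and span: "\<And>p. p \<in> log_vectors b w \<alpha> \<A> m \<Longrightarrow> \<exists>s. p = (\<Sum>j\<in>UNIV. vec_scale (s j) (\<theta> j))"
    and indep: "\<And>s j. (\<Sum>j\<in>UNIV. vec_scale (s j) (\<theta> j)) = 0 \<Longrightarrow> s j = 0"
  shows "free_multiarrangement b \<alpha> \<A> m"
proof -
  interpret f: module_hom der_scale vec_scale coordinate_vector
    by (rule module_hom_coordinate_vector)
  let ?D = "log_derivations b \<alpha> \<A> m"
  have sub: "f.m1.subspace ?D"
    by (rule subspace_log_derivations)
  have "\<exists>\<delta>\<in>?D. coordinate_vector \<delta> = \<theta> j" for j :: 'j
    using mem[of j] image_log_derivations[of \<A> \<alpha> m, OF lin] by (metis imageE)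
  then obtain \<delta> where \<delta>: "\<And>j. \<delta> j \<in> ?D" "\<And>j. coordinate_vector (\<delta> j) = \<theta> j"
    by metis
  have inj: "inj_on coordinate_vector ?D"
    using inj_on_coordinate_vector by (rule inj_on_subset) (auto simp: log_derivations_def)
  have "inj \<theta>"
  proof (rule injI, rule ccontr)
    fix j k assume *: "\<theta> j = \<theta> k" "j \<noteq> k"
    have "(\<Sum>i\<in>UNIV. vec_scale (if i = j then 1 else if i = k then - 1 else 0) (\<theta> i))
        = (\<Sum>i\<in>{j, k}. vec_scale (if i = j then 1 else if i = k then - 1 else 0) (\<theta> i))"
      by (rule sum.mono_neutral_right) auto
    also have "\<dots> = 0"
      using * by simp
    finally show False
      using indep[of "\<lambda>i. if i = j then 1 else if i = k then - 1 else 0" j] by simp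
  qed
  then have inj\<delta>: "inj \<delta>"
    by (metis \<delta>(2) injI injD)
  have image: "coordinate_vector (\<Sum>j\<in>UNIV. der_scale (s j) (\<delta> j)) = (\<Sum>j\<in>UNIV. vec_scale (s j) (\<theta> j))" for s
    by (simp add: f.sum f.scale \<delta>(2))
  have "f.m1.independent (range \<delta>)"
  proof
    assume "f.m1.dependent (range \<delta>)"
    then obtain u where u: "\<exists>v\<in>range \<delta>. u v \<noteq> 0" "(\<Sum>v\<in>range \<delta>. der_scale (u v) v) = 0"
      by (auto simp: f.m1.dependent_finite)
    have "(\<Sum>j\<in>UNIV. der_scale (u (\<delta> j)) (\<delta> j)) = 0"
      using u(2) by (simp add: sum.reindex[OF inj\<delta>])
    then have "(\<Sum>j\<in>UNIV. vec_scale (u (\<delta> j)) (\<theta> j)) = 0"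
      using image[of "\<lambda>j. u (\<delta> j)"] by (simp add: f.zero)
    then show False
      using indep[of "\<lambda>j. u (\<delta> j)"] u(1) by auto
  qed
  moreover have "f.m1.span (range \<delta>) = ?D"
  proof
    show "f.m1.span (range \<delta>) \<subseteq> ?D"
      using \<delta>(1) sub by (intro f.m1.span_minimal) auto
    show "?D \<subseteq> f.m1.span (range \<delta>)"
    proof
      fix x assume x: "x \<in> ?D"
      obtain s where s: "coordinate_vector x = (\<Sum>j\<in>UNIV. vec_scale (s j) (\<theta> j))"
        using span[of "coordinate_vector x"] x image_log_derivations[of \<A> \<alpha> m, OF lin] by blast
      have "(\<Sum>j\<in>UNIV. der_scale (s j) (\<delta> j)) \<in> ?D"
        by (intro f.m1.subspace_sum[OF sub] f.m1.subspace_scale[OF sub] \<delta>)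
      then have "x = (\<Sum>j\<in>UNIV. der_scale (s j) (\<delta> j))"
        using x s image by (intro inj_onD[OF inj]) auto
      then show "x \<in> f.m1.span (range \<delta>)"
        by (auto intro: f.m1.span_sum f.m1.span_scale f.m1.span_base)
    qed
  qed
  ultimately show ?thesis
    unfolding free_multiarrangement_def free_submodule_def
    using sub \<delta>(1) by blast
qed

end


section \<open>A circuit of four or more hyperplanes\<close>

lemma span_vanish:
  assumes "u \<in> vec.span G" "\<And>g. g \<in> G \<Longrightarrow> g k = 0"
  shows "u k = 0"
proof -
  have "vec.subspace {u. u k = 0}"
    by (auto simp: vec.subspace_def vec_scale_def)
  then show ?thesis
    using vec.span_minimal[of G "{u. u k = 0}"] assms by auto
qed

text \<open>
  After a count of generators by degree, a single generator \<open>h\<close> with a nonzero entry at \<open>k\<close> is left; so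
  the entries at \<open>k\<close> form a principal ideal.
\<close>
lemma span_insert_vanish:
  assumes "u \<in> vec.span (insert h G)" "\<And>g. g \<in> G \<Longrightarrow> g k = 0"
  obtains s where "u k = s * h k" "u - vec_scale s h \<in> vec.span G"
proof -
  obtain s where "u - vec_scale s h \<in> vec.span G"
    using assms(1) by (auto simp: vec.span_breakdown_eq)
  with span_vanish[OF this, of k] assms(2) show thesis
    by (intro that[of s]) (auto simp: vec_scale_def)
qed

lemma axis_pairing: "(\<Sum>k\<in>UNIV. f k * axis j c k) = f j * (c::'r::comm_ring_1)" for j :: "'j::finite"
  by (simp add: axis_def if_distrib[of "(*) _"] cong: if_cong)

lemma vec_homogeneous_axis: "homogeneous d c \<Longrightarrow> vec_homogeneous d (axis j c)"
  by (simp add: vec_homogeneous_def axis_def)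

lemma degree_prod_le:
  fixes f :: "'a \<Rightarrow> 'k::field poly"
  assumes "finite A" "\<And>a. a \<in> A \<Longrightarrow> degree (f a) \<le> n"
  shows "degree (prod f A) \<le> card A * n"
  using assms
proof (induction A rule: finite_induct)
  case (insert a A)
  have "degree (f a * prod f A) \<le> degree (f a) + degree (prod f A)"
    by (rule degree_mult_le)
  also have "\<dots> \<le> n + card A * n"
    using insert by (intro add_mono) auto
  finally show ?case using insert.hyps by simp
qed simp

context two_bases
begin

text \<open>
  The circuit consists of \<open>H0\<close> and the hyperplanes \<open>K k\<close> for \<open>k \<in> T\<close>, on which the coordinates \<open>\<eta> k\<close> vanish.
  The hyperplanes \<open>K k\<close> alone get multiplicities above \<open>1\<close>. In the definition of \<open>N\<close>, the summand
  \<open>card \<A> * CARD('j)\<close> bounds the degree of the product of all forms on the curve chosen in the proof, and \<open>n2\<close> and \<open>n1\<close>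
  exceed the degrees of the vectors \<open>v j\<close> that must have a zero entry at \<open>k2\<close> or \<open>k1\<close>.
\<close>
lemma circuit_imp_not_free:
  fixes K :: "'j \<Rightarrow> 'v set" and \<A> :: "'v set set" and \<alpha> :: "'v set \<Rightarrow> 'v \<Rightarrow> 'k"
  assumes fin: "finite \<A>"
    and lin: "\<And>H. H \<in> \<A> \<Longrightarrow> Vector_Spaces.linear scale (*) (\<alpha> H)"
    and nonzero: "\<And>H. H \<in> \<A> \<Longrightarrow> \<exists>v. \<alpha> H v \<noteq> 0"
    and distinct: "\<And>H H' c. H \<in> \<A> \<Longrightarrow> H' \<in> \<A> \<Longrightarrow> \<forall>v. \<alpha> H v = c * \<alpha> H' v \<Longrightarrow> H = H'"
    and K: "\<And>k. k \<in> T \<Longrightarrow> K k \<in> \<A> \<and> \<alpha> (K k) = \<eta> k"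
    and H0: "H0 \<in> \<A>" "\<And>k. \<alpha> H0 (w k) \<noteq> 0 \<longleftrightarrow> k \<in> T"
    and k: "k1 \<in> T" "k2 \<in> T" "k3 \<in> T" "k1 \<noteq> k2" "k1 \<noteq> k3" "k2 \<noteq> k3"
  shows "\<exists>m. (\<forall>H\<in>\<A>. 0 < m H) \<and> \<not> free_multiarrangement b \<alpha> \<A> m"
proof -
  let ?l = "CARD('j)"
  define \<A>' where "\<A>' = \<A> - K ` T"
  define r where "r = card \<A>'"
  define N where "N = Suc (card \<A> * ?l)"
  define n2 where "n2 = Suc (N + r)"
  define n1 where "n1 = Suc (n2 + r)"
  define m where "m H = (if H = K k1 then n1 else if H = K k2 then n2 else if H \<in> K ` T then N else 1)" for H
  have mpos: "0 < m H" for H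
    by (simp add: m_def n1_def n2_def N_def)
  define D where "D = log_vectors b w \<alpha> \<A> m"
  define L where "L H = form_poly b (\<alpha> H)" for H
  define X where "X k = form_poly b (\<eta> k)" for k
  define \<rho> where "\<rho> = (\<Prod>H\<in>\<A>'. L H)"
  define a where "a k = \<alpha> H0 (w k)" for k
  have a: "a k \<noteq> 0 \<longleftrightarrow> k \<in> T" for k
    using H0 by (simp add: a_def)
  have L_K: "L (K k) = X k" if "k \<in> T" for k
    using K[OF that] by (simp add: L_def X_def)
  have pair_K: "(\<Sum>j\<in>UNIV. Const (\<alpha> (K k) (w j)) * p j) = p k" if "k \<in> T" for p :: "'j \<Rightarrow> ('i, 'k) mpoly" and k
    using K[OF that] by (simp add: w.coordinate_basis Const_simps if_distrib[of Const]
        if_distrib[of "\<lambda>x. x * _"] cong: if_cong)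
  have K_inj: "K j = K k \<longleftrightarrow> j = k" if "j \<in> T" "k \<in> T" for j k
  proof
    assume "K j = K k"
    then have "\<eta> j (w j) = \<eta> k (w j)"
      using K[OF that(1)] K[OF that(2)] by metis
    then show "j = k" by (simp add: w.coordinate_basis split: if_splits)
  qed simp
  have m_K: "m (K k1) = n1" "m (K k2) = n2" "\<And>k. k \<in> T \<Longrightarrow> k \<noteq> k1 \<Longrightarrow> k \<noteq> k2 \<Longrightarrow> m (K k) = N"
    using k by (auto simp: m_def K_inj)
  have m_A': "m H = 1" if "H \<in> \<A>'" for H
    using that k by (auto simp: m_def \<A>'_def)
  have L_nz: "L H \<noteq> 0" if "H \<in> \<A>" for H
    using b.form_poly_eq_0D[OF lin[OF that]] nonzero[OF that] by (auto simp: L_def)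
  have X_nz: "X k \<noteq> 0" for k
    using b.form_poly_eq_0D[OF w.linear_coordinate, of k "w k"] by (auto simp: X_def w.coordinate_basis)
  have finA': "finite \<A>'" and A'_sub: "\<A>' \<subseteq> \<A>"
    using fin by (auto simp: \<A>'_def)
  have H0': "H0 \<in> \<A>'"
  proof -
    have "H0 \<noteq> K k" if "k \<in> T" for k
    proof
      assume "H0 = K k"
      then have "\<eta> k (w k1) \<noteq> 0" "\<eta> k (w k2) \<noteq> 0"
        using K[OF that] H0(2) k by metis+
      then show False using k by (auto simp: w.coordinate_basis split: if_splits)
    qed
    then show ?thesis using H0 by (auto simp: \<A>'_def)
  qed
  define \<rho>0 where "\<rho>0 = (\<Prod>H\<in>\<A>' - {H0}. L H)"
  have \<rho>_split: "\<rho> = L H0 * \<rho>0"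
    using H0' finA' by (simp add: \<rho>_def \<rho>0_def prod.remove)
  have \<rho>_nz: "\<rho> \<noteq> 0"
    using L_nz A'_sub finA' by (auto simp: \<rho>_def mpoly_prod_eq_0_iff)
  have hom_X: "homogeneous n (X k ^ n)" for k n
    using homogeneous_power[OF homogeneous_form_poly[of b "\<eta> k"], of n] by (simp add: X_def)
  have hom_\<rho>: "homogeneous r \<rho>"
    unfolding \<rho>_def r_def using finA' by (intro homogeneous_prod) (auto simp: L_def homogeneous_form_poly simp del: One_nat_def)

  \<comment> \<open>Explicit multiples of the unit vectors in \<open>D\<close>; the counts of generators below rest on their degrees.\<close>
  define e where "e j = (if j \<in> T then m (K j) else 0)" for j
  define v where "v j = axis j (X j ^ e j * \<rho>)" for j
  have v_mem: "v j \<in> D" for j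
    unfolding D_def log_vectors_def
  proof (intro CollectI ballI)
    fix H assume H: "H \<in> \<A>"
    show "form_poly b (\<alpha> H) ^ m H dvd (\<Sum>k\<in>UNIV. Const (\<alpha> H (w k)) * v j k)"
    proof (cases "H \<in> \<A>'")
      case True
      then have "L H dvd \<rho>"
        unfolding \<rho>_def using finA' by (intro dvd_prodI) auto
      then show ?thesis
        using m_A'[OF True] by (simp add: v_def axis_pairing L_def)
    next
      case False
      then obtain k where k: "k \<in> T" "H = K k" using H by (auto simp: \<A>'_def)
      then show ?thesis
        using pair_K[of k "v j"] L_K[of k] by (auto simp: L_def v_def axis_def e_def)
    qed
  qed
  have v_hom: "vec_homogeneous (e j + r) (v j)" for j
    unfolding v_def by (intro vec_homogeneous_axis homogeneous_mult hom_X hom_\<rho>)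
  have v_nz: "X j ^ e j * \<rho> \<noteq> 0" for j
    by (simp add: mpoly_mult_eq_0_iff mpoly_power_eq_0_iff X_nz \<rho>_nz)
  have v_k: "v j j \<noteq> 0" for j
    using v_nz by (simp add: v_def axis_def)

  have D_K: "X k ^ m (K k) dvd p k" if "p \<in> D" "k \<in> T" for p k
  proof -
    have "L (K k) ^ m (K k) dvd (\<Sum>j\<in>UNIV. Const (\<alpha> (K k) (w j)) * p j)"
      using that(1) K[OF that(2)] unfolding D_def log_vectors_def L_def by blast
    then show ?thesis
      using pair_K[OF that(2), of p] L_K[OF that(2)] by simp
  qed

  have "\<not> free_multiarrangement b \<alpha> \<A> m"
  proof
    assume free: "free_multiarrangement b \<alpha> \<A> m"
    obtain E where E: "finite E" "card E \<le> ?l" "vec.span E = D"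
      unfolding D_def by (rule free_imp_small_generating_set[of \<A> \<alpha> m, OF lin free])
    have "\<And>u d. u \<in> D \<Longrightarrow> vec_component d u \<in> D"
      unfolding D_def by (rule graded_log_vectors)
    from homogeneous_generators[OF E(1,3) this] obtain G
      where G: "finite G" "card G \<le> card E" "vec.span G = D" "\<And>g. g \<in> G \<Longrightarrow> \<exists>d. vec_homogeneous d g"
      by metis
    then obtain dg where dg: "\<And>g. g \<in> G \<Longrightarrow> vec_homogeneous (dg g) g"
      by metis
    have G_D: "g \<in> D" if "g \<in> G" for g
      using that G(3) vec.span_base by blast
    have low: "g k = 0" if "g \<in> G" "k \<in> T" "dg g < m (K k)" for g k
      using homogeneous_dvd_lower_degree[OF hom_X, of "dg g" "g k"] D_K[OF G_D[OF that(1)] that(2)] that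
        dg[OF that(1)] by (auto simp: vec_homogeneous_def)
    have v_low: "v j \<in> vec.span {g\<in>G. dg g \<le> e j + r}" for j
      using homogeneous_in_span[OF G(1) dg _ v_hom] v_mem[of j] G(3) by blast

    \<comment> \<open>Generators of degree below \<open>n1\<close> vanish at \<open>k1\<close>; they generate all \<open>v j\<close> with \<open>j \<noteq> k1\<close>, so there are \<open>?l - 1\<close>.\<close>
    define G1 where "G1 = {g\<in>G. g k1 = 0}"
    have v_G1: "v j \<in> vec.span G1" if "j \<noteq> k1" for j
    proof -
      have "e j \<le> n2"
        using that m_K by (auto simp: e_def n2_def) (metis le_add1 le_SucI order_refl)
      then have "{g\<in>G. dg g \<le> e j + r} \<subseteq> G1"
        using low[OF _ k(1)] m_K by (auto simp: G1_def n1_def)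
      then show ?thesis using v_low vec.span_mono by blast
    qed
    have "card (UNIV - {k1}) \<le> card G1"
      using v_G1 v_nz G(1) unfolding v_def
      by (intro card_le_card_spanning[OF mpoly_mult_eq_0, of _ _ "\<lambda>j. X j ^ e j * \<rho>"]) (auto simp: G1_def)
    moreover have "\<exists>h1\<in>G. h1 k1 \<noteq> 0"
      using span_vanish[of "v k1" G k1] v_mem[of k1] v_k[of k1] G(3) by auto
    then obtain h1 where h1: "h1 \<in> G" "h1 k1 \<noteq> 0" by blast
    then have "insert h1 G1 \<subseteq> G" "h1 \<notin> G1" "finite G1"
      using G(1) by (auto simp: G1_def)
    moreover from this have "card (insert h1 G1) \<le> card G"
      using G(1) by (intro card_mono)
    ultimately have card_G1: "card G1 = ?l - 1" and "card (insert h1 G1) = card G"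
      using G(2) E(2) by auto
    then have G_eq: "G = insert h1 G1"
      using card_subset_eq[OF G(1) \<open>insert h1 G1 \<subseteq> G\<close>] by simp
    have G1_k1: "\<And>g. g \<in> G1 \<Longrightarrow> g k1 = 0"
      by (simp add: G1_def)
    have D_G1: "u \<in> vec.span G1" if u: "u \<in> D" "u k1 = 0" for u
    proof -
      have "u \<in> vec.span (insert h1 G1)"
        using u(1) G(3) by (simp flip: G_eq)
      then obtain s where s: "u k1 = s * h1 k1" "u - vec_scale s h1 \<in> vec.span G1"
        using G1_k1 by (rule span_insert_vanish[of u h1 G1 k1])
      then have "s = 0"
        using u(2) h1(2) mpoly_mult_eq_0[of s "h1 k1"] by auto
      then show ?thesis using s(2) by simp
    qed

    \<comment> \<open>The same count among the generators in \<open>G1\<close>, now with degrees below \<open>n2\<close> and the index \<open>k2\<close>.\<close>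
    define G2 where "G2 = {g\<in>G1. g k2 = 0}"
    have v_G2: "v j \<in> vec.span G2" if "j \<noteq> k1" "j \<noteq> k2" for j
    proof -
      have "e j \<le> N"
        using that m_K by (auto simp: e_def)
      then have "{g\<in>G. dg g \<le> e j + r} \<subseteq> G2"
        using low[OF _ k(1)] low[OF _ k(2)] m_K by (auto simp: G1_def G2_def n1_def n2_def)
      then show ?thesis using v_low vec.span_mono by blast
    qed
    have "card (UNIV - {k1, k2}) \<le> card G2"
      using v_G2 v_nz \<open>finite G1\<close> unfolding v_def
      by (intro card_le_card_spanning[OF mpoly_mult_eq_0, of _ _ "\<lambda>j. X j ^ e j * \<rho>"]) (auto simp: G2_def)
    moreover have "card (UNIV - {k1, k2}) = ?l - 2"
      using k by (simp add: card_Diff_subset)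
    moreover have "\<exists>h\<in>G1. h k2 \<noteq> 0"
      using span_vanish[of "v k2" G1 k2] v_G1[of k2] v_k[of k2] k by auto
    then obtain h where h: "h \<in> G1" "h k2 \<noteq> 0" by blast
    then have "insert h G2 \<subseteq> G1" "h \<notin> G2" "finite G2"
      using \<open>finite G1\<close> by (auto simp: G2_def)
    moreover from this have "card (insert h G2) \<le> card G1"
      using \<open>finite G1\<close> by (intro card_mono)
    moreover have "card (UNIV - {k1, k2}) + 2 = ?l"
      using k card_mono[of UNIV "{k1, k2}"] by (simp add: card_Diff_subset)
    ultimately have "card (insert h G2) = card G1"
      using card_G1 by auto
    then have G1_eq: "G1 = insert h G2"
      using card_subset_eq[OF \<open>finite G1\<close> \<open>insert h G2 \<subseteq> G1\<close>] by simp
    have G2_k2: "\<And>g. g \<in> G2 \<Longrightarrow> g k2 = 0"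
      by (simp add: G2_def)
    have g_dvd: "h k2 dvd u k2" if u: "u \<in> D" "u k1 = 0" for u
    proof -
      have "u \<in> vec.span (insert h G2)"
        using D_G1[OF u] by (simp flip: G1_eq)
      then obtain s where "u k2 = s * h k2"
        using G2_k2 by (rule span_insert_vanish[of u h G2 k2])
      then show ?thesis by simp
    qed
    have h_D: "h \<in> D" and h_k1: "h k1 = 0"
      using h(1) G_D by (auto simp: G1_def)

    \<comment> \<open>The second test vector: its entries at \<open>k2\<close> and \<open>k3\<close> cancel in \<open>\<alpha> H0\<close>, so it can do without the factor \<open>L H0\<close>.\<close>
    define Y where "Y = X k2 ^ n2 * \<rho>0"
    define y where "y = (\<lambda>k. axis k2 (Const (a k3) * (Y * X k3 ^ N)) k - axis k3 (Const (a k2) * (Y * X k3 ^ N)) k)"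
    have y_pair: "(\<Sum>k\<in>UNIV. Const (\<alpha> H (w k)) * y k)
        = Const (\<alpha> H (w k2) * a k3 - \<alpha> H (w k3) * a k2) * (Y * X k3 ^ N)" for H
      by (simp add: y_def right_diff_distrib sum_subtractf axis_pairing Const_simps left_diff_distrib mult.assoc)
    have y_mem: "y \<in> D"
      unfolding D_def log_vectors_def
    proof (intro CollectI ballI)
      fix H assume H: "H \<in> \<A>"
      show "form_poly b (\<alpha> H) ^ m H dvd (\<Sum>k\<in>UNIV. Const (\<alpha> H (w k)) * y k)"
      proof (cases "H \<in> \<A>'")
        case True
        show ?thesis
        proof (cases "H = H0")
          case True
          have "\<alpha> H0 (w k2) * a k3 - \<alpha> H0 (w k3) * a k2 = 0"
            by (simp add: a_def)
          with True show ?thesis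
            by (simp add: y_pair Const_simps)
        next
          case False
          then have "L H dvd \<rho>0"
            unfolding \<rho>0_def using finA' True by (intro dvd_prodI) auto
          then have "L H dvd Y"
            by (simp add: Y_def)
          then show ?thesis
            using m_A'[OF True] by (simp add: y_pair L_def)
        qed
      next
        case False
        then obtain j where j: "j \<in> T" "H = K j" using H by (auto simp: \<A>'_def)
        show ?thesis
          using pair_K[OF j(1), of y] L_K[OF j(1)] j(2) k m_K
          by (auto simp: L_def y_def axis_def Y_def)
      qed
    qed
    have unit: "Const (a k3) * Const (inverse (a k3)) = 1"
      using a[of k3] k by (simp flip: Const_simps(2)) (simp add: Const_simps)
    have dvd1: "h k2 dvd Y * L H0"
      using g_dvd[OF v_mem[of k2]] k m_K by (simp add: v_def axis_def e_def \<rho>_split Y_def mult_ac)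
    have "h k2 dvd Const (a k3) * (Y * X k3 ^ N)"
      using g_dvd[OF y_mem] k by (simp add: y_def axis_def)
    then have "h k2 dvd Const (inverse (a k3)) * (Const (a k3) * (Y * X k3 ^ N))"
      by (rule dvd_mult)
    also have "Const (inverse (a k3)) * (Const (a k3) * (Y * X k3 ^ N))
        = (Const (a k3) * Const (inverse (a k3))) * (Y * X k3 ^ N)"
      by (simp only: mult_ac)
    finally have dvd2: "h k2 dvd Y * X k3 ^ N"
      by (simp only: unit mult_1_left)
    obtain u1 where u1: "h k2 \<noteq> 0" "\<alpha> H0 u1 \<noteq> 0"
      using h(2) nonzero[OF H0(1)] by blast
    have not_dvd: "\<not> L H0 dvd X k3"
    proof
      assume "L H0 dvd X k3"
      then obtain c where c: "\<And>x. \<eta> k3 x = c * \<alpha> H0 x"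
        using b.form_poly_dvd_form_polyD[OF lin[OF H0(1)] u1(2) w.linear_coordinate] by (auto simp: L_def X_def)
      from c[of "w k1"] have "c = 0"
        using k a by (auto simp: w.coordinate_basis a_def)
      then show False
        using c[of "w k3"] by (simp add: w.coordinate_basis)
    qed
    have prime: "L H0 dvd p" if "L H0 dvd p * X k3 ^ n" for p n
      using that
    proof (induction n)
      case (Suc n)
      then have "L H0 dvd (p * X k3 ^ n) * X k3"
        by (simp add: mult_ac)
      then show ?case
        using b.form_poly_dvd_multD[OF lin[OF H0(1)] u1(2)] not_dvd Suc.IH unfolding L_def by blast
    qed simp
    \<comment> \<open>As \<open>h k2\<close> divides both \<open>Y * L H0\<close> and \<open>Y * X k3 ^ N\<close>, and \<open>L H0\<close> is prime to \<open>X k3\<close>, it divides \<open>Y\<close>.\<close>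
    have g_dvd_Y: "h k2 dvd Y"
    proof -
      obtain t1 t2 where t: "Y * L H0 = h k2 * t1" "Y * X k3 ^ N = h k2 * t2"
        using dvd1 dvd2 by (auto simp: dvd_def)
      have "h k2 * (t1 * X k3 ^ N) = h k2 * (t2 * L H0)"
        using arg_cong[OF t(1), of "\<lambda>x. x * X k3 ^ N"] arg_cong[OF t(2), of "\<lambda>x. x * L H0"]
        by (simp add: mult_ac)
      then have "t1 * X k3 ^ N = t2 * L H0"
        by (rule mpoly_mult_left_cancel[OF u1(1)])
      then have "L H0 dvd t1"
        by (intro prime[of t1 N]) simp
      then obtain t' where t': "t1 = L H0 * t'" by (auto simp: dvd_def)
      have "L H0 * Y = L H0 * (h k2 * t')"
        using t(1) t' by (simp add: mult_ac)
      then have "Y = h k2 * t'"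
        by (rule mpoly_mult_left_cancel[OF L_nz[OF H0(1)]])
      then show ?thesis by simp
    qed

    \<comment> \<open>A curve in the hyperplane \<open>H0\<close>: distinct powers of the parameter for all coordinates other than \<open>k1\<close>, so that\<close>
    \<comment> \<open>a form vanishes on it only if it is proportional to \<open>\<alpha> H0\<close>; the power \<open>0\<close> at \<open>k2\<close> turns \<open>X k2 ^ n2\<close> into a unit.\<close>
    obtain num :: "'j \<Rightarrow> nat" where num: "bij_betw num UNIV {0..<?l}"
      using ex_bij_betw_finite_nat[of "UNIV :: 'j set"] by auto
    define idx where "idx j = (if j = k2 then 0 else Suc (num j))" for j
    have idx_inj: "idx i = idx j \<longleftrightarrow> i = j" for i j
      using bij_betw_imp_inj_on[OF num] by (auto simp: idx_def inj_eq)
    have idx_le: "idx j \<le> ?l" for j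
      using bij_betwE[OF num] by (auto simp: idx_def Suc_le_eq)
    define q where "q j = (if j = k1 then - (\<Sum>j\<in>UNIV - {k1}. monom (a j / a k1) (idx j)) else monom 1 (idx j))" for j
    have q_k2: "q k2 = 1"
      using k by (simp add: q_def idx_def monom_0 one_pCons)
    define \<phi> where "\<phi> = subst_hom (\<lambda>c. [:c:]) (\<lambda>i. \<Sum>j\<in>UNIV. [:\<xi> i (w j):] * q j)"
    interpret \<phi>: ring_homomorphism \<phi>
      unfolding \<phi>_def by (rule ring_homomorphism_subst_hom[OF ring_homomorphism_constant_poly])
    have \<phi>_Const: "\<phi> (Const c) = [:c:]" for c
      by (simp add: \<phi>_def subst_hom_Const[OF ring_homomorphism_constant_poly])
    have \<phi>_form: "\<phi> (form_poly b \<beta>) = (\<Sum>j\<in>UNIV. [:\<beta> (w j):] * q j)"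
      if "Vector_Spaces.linear scale (*) \<beta>" for \<beta>
      unfolding \<phi>_def using subst_hom_form_poly[OF ring_homomorphism_constant_poly that] .
    have \<phi>_form': "\<phi> (form_poly b \<beta>)
        = (\<Sum>j\<in>UNIV - {k1}. monom (\<beta> (w j) - \<beta> (w k1) * a j / a k1) (idx j))"
      if "Vector_Spaces.linear scale (*) \<beta>" for \<beta>
    proof -
      have "\<phi> (form_poly b \<beta>) = [:\<beta> (w k1):] * q k1 + (\<Sum>j\<in>UNIV - {k1}. [:\<beta> (w j):] * q j)"
        unfolding \<phi>_form[OF that] by (rule sum.remove) auto
      also have "[:\<beta> (w k1):] * q k1 = - (\<Sum>j\<in>UNIV - {k1}. [:\<beta> (w k1):] * monom (a j / a k1) (idx j))"
        by (simp only: q_def simp_thms if_True mult_minus_right sum_distrib_left)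
      also have "\<dots> = (\<Sum>j\<in>UNIV - {k1}. monom (- (\<beta> (w k1) * a j / a k1)) (idx j))"
        unfolding sum_negf[symmetric] by (rule sum.cong) (auto simp: smult_monom minus_monom)
      also have "(\<Sum>j\<in>UNIV - {k1}. [:\<beta> (w j):] * q j) = (\<Sum>j\<in>UNIV - {k1}. monom (\<beta> (w j)) (idx j))"
        by (rule sum.cong) (auto simp: q_def smult_monom)
      finally show ?thesis
        by (simp add: sum.distrib[symmetric] add_monom)
    qed
    have \<phi>_X: "\<phi> (X j) = q j" for j
      by (simp add: X_def \<phi>_form[OF w.linear_coordinate] w.coordinate_basis if_distrib[of "\<lambda>c. [:c:]"]
          if_distrib[of "\<lambda>x. x * _"] cong: if_cong)
    have \<phi>_H0: "\<phi> (L H0) = 0"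
      using k a by (simp add: L_def \<phi>_form'[OF lin[OF H0(1)]] flip: a_def)
    have \<phi>_deg: "degree (\<phi> (L H)) \<le> ?l" if "H \<in> \<A>" for H
      unfolding L_def \<phi>_form'[OF lin[OF that]]
      by (rule degree_sum_le) (auto intro: order_trans[OF degree_monom_le idx_le])
    have \<phi>_nz: "\<phi> (L H) \<noteq> 0" if "H \<in> \<A>" "H \<noteq> H0" for H
    proof
      assume zero: "\<phi> (L H) = 0"
      have "\<alpha> H (w j) - \<alpha> H (w k1) * a j / a k1 = 0" if "j \<noteq> k1" for j
      proof -
        have "coeff (\<phi> (L H)) (idx j) = (\<Sum>i\<in>UNIV - {k1}. if i = j then \<alpha> H (w i) - \<alpha> H (w k1) * a i / a k1 else 0)"
          unfolding L_def \<phi>_form'[OF lin[OF \<open>H \<in> \<A>\<close>]] by (simp add: coeff_sum idx_inj)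
        then show ?thesis using zero that by simp
      qed
      note coeff_0 = this
      define c where "c = \<alpha> H (w k1) / a k1"
      have on_basis: "\<alpha> H (w j) = c * \<alpha> H0 (w j)" for j
      proof (cases "j = k1")
        case True
        then show ?thesis using k(1) a[of k1] by (simp add: c_def a_def)
      next
        case False
        from coeff_0[OF this] show ?thesis by (simp add: c_def a_def)
      qed
      have "Vector_Spaces.linear scale (*) (\<lambda>v. c * \<alpha> H0 v)"
        using lin[OF H0(1)] by (simp add: Vector_Spaces.linear_iff algebra_simps)
      then have "\<alpha> H = (\<lambda>v. c * \<alpha> H0 v)"
        using on_basis by (rule w.linear_form_eqI[OF lin[OF that(1)]])
      then show False
        using distinct[OF that(1) H0(1), of c] that(2) by (simp add: fun_eq_iff)
    qed
    have \<phi>_\<rho>0: "\<phi> \<rho>0 \<noteq> 0"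
      using \<phi>_nz finA' A'_sub by (auto simp: \<rho>0_def \<phi>.prod)
    have "degree (\<phi> \<rho>0) \<le> card (\<A>' - {H0}) * ?l"
      unfolding \<rho>0_def \<phi>.prod using finA' A'_sub \<phi>_deg by (intro degree_prod_le) auto
    also have "\<dots> \<le> card \<A> * ?l"
      using fin A'_sub by (intro mult_right_mono card_mono) auto
    finally have deg: "degree (\<phi> \<rho>0) < N"
      by (simp add: N_def)

    \<comment> \<open>Along the curve, the condition at \<open>H0\<close> expresses \<open>h k2\<close> by the \<open>h j\<close> with \<open>j \<in> T - {k1, k2}\<close>, as \<open>h k1 = 0\<close>.\<close>
    have "L H0 ^ m H0 dvd (\<Sum>j\<in>UNIV. Const (a j) * h j)"
      using h_D H0(1) by (simp add: D_def log_vectors_def L_def a_def)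
    then have "\<phi> (L H0) dvd \<phi> (\<Sum>j\<in>UNIV. Const (a j) * h j)"
      using m_A'[OF H0'] \<phi>.dvd by simp
    then have "(\<Sum>j\<in>UNIV. [:a j:] * \<phi> (h j)) = 0"
      by (simp add: \<phi>_H0 \<phi>.sum \<phi>.mult \<phi>_Const)
    then have solved: "[:a k2:] * \<phi> (h k2) = - (\<Sum>j\<in>UNIV - {k2}. [:a j:] * \<phi> (h j))"
      by (subst (asm) sum.remove[of _ k2]) (auto simp: eq_neg_iff_add_eq_0)
    have "monom 1 N dvd [:a j:] * \<phi> (h j)" if "j \<noteq> k2" for j
    proof (cases "j \<in> T \<and> j \<noteq> k1")
      case True
      then have "\<phi> (X j ^ N) dvd \<phi> (h j)"
        using D_K[OF h_D, of j] m_K that \<phi>.dvd by auto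
      moreover have "monom 1 N dvd \<phi> (X j ^ N)"
      proof -
        have "\<phi> (X j ^ N) = monom 1 (Suc (num j) * N)"
          using True that by (simp add: \<phi>.power \<phi>_X q_def idx_def monom_power)
        also have "\<dots> = monom 1 N * monom 1 (num j * N)"
          by (simp add: mult_monom)
        finally show ?thesis by simp
      qed
      ultimately show ?thesis by (meson dvd_trans dvd_mult)
    next
      case False
      then show ?thesis using a[of j] h_k1 by (auto simp: \<phi>.zero)
    qed
    then have "monom 1 N dvd [:a k2:] * \<phi> (h k2)"
      unfolding solved dvd_minus_iff by (intro dvd_sum) blast
    also have "[:a k2:] * \<phi> (h k2) dvd [:a k2:] * \<phi> Y"
      using g_dvd_Y by (intro mult_dvd_mono \<phi>.dvd dvd_refl)
    also have "\<phi> Y = \<phi> \<rho>0"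
      by (simp add: Y_def \<phi>.mult \<phi>.power \<phi>_X q_k2)
    finally have "monom 1 N dvd smult (a k2) (\<phi> \<rho>0)"
      by simp
    moreover have "smult (a k2) (\<phi> \<rho>0) \<noteq> 0"
      using \<phi>_\<rho>0 a[of k2] k by simp
    ultimately have "N \<le> degree (\<phi> \<rho>0)"
      using dvd_imp_degree_le[of "monom 1 N" "smult (a k2) (\<phi> \<rho>0)"] by (auto simp: degree_monom_eq)
    with deg show False by simp
  qed
  with mpos show ?thesis by blast
qed

end


section \<open>Products of arrangements of rank at most two\<close>

definition combination :: "('j::finite \<Rightarrow> 'r) \<Rightarrow> ('j \<Rightarrow> 'j \<Rightarrow> 'r) \<Rightarrow> 'j \<Rightarrow> 'r::comm_ring_1"
  where "combination s \<theta> = (\<Sum>j\<in>UNIV. vec_scale (s j) (\<theta> j))"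

definition vec_basis :: "('j::finite \<Rightarrow> 'j \<Rightarrow> 'r::comm_ring_1) \<Rightarrow> ('j \<Rightarrow> 'r) set \<Rightarrow> bool"
  where "vec_basis \<theta> M \<longleftrightarrow> (\<forall>j. \<theta> j \<in> M) \<and> (\<forall>p\<in>M. \<exists>s. p = combination s \<theta>) \<and>
    (\<forall>s. combination s \<theta> = 0 \<longrightarrow> (\<forall>j. s j = 0))"

lemma combination_apply: "combination s \<theta> k = (\<Sum>j\<in>UNIV. s j * \<theta> j k)"
  by (simp add: combination_def vec_sum_apply vec_scale_def)

text \<open>
  One step of elimination: the pivot \<open>\<theta> j0\<close> clears the contributions of the other vectors to the linear form
  \<open>\<Sum>\<^sub>j s\<^sub>j \<sigma>\<^sub>j\<close>, which is then divisible by \<open>L\<close> exactly if the coefficient of the pivot is.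
\<close>

lemma vec_basis_pivot:
  fixes \<theta> :: "'j::finite \<Rightarrow> 'j \<Rightarrow> ('i::finite, 'k::field) mpoly"
  assumes basis: "vec_basis \<theta> M'" and "M \<subseteq> M'" "L \<noteq> 0" "\<sigma> j0 = 1"
    and mem: "\<And>s. combination s \<theta> \<in> M \<longleftrightarrow> L dvd (\<Sum>j\<in>UNIV. s j * \<sigma> j)"
  shows "vec_basis (\<lambda>j. if j = j0 then vec_scale L (\<theta> j0) else \<theta> j - vec_scale (\<sigma> j) (\<theta> j0)) M"
    (is "vec_basis ?\<theta> M")
proof -
  define old where "old s j = (if j = j0 then L * s j0 - (\<Sum>k\<in>UNIV - {j0}. s k * \<sigma> k) else s j)" for s j
  have old: "combination s ?\<theta> = combination (old s) \<theta>" for s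
  proof
    fix k
    have "combination s ?\<theta> k = s j0 * (L * \<theta> j0 k) + (\<Sum>j\<in>UNIV - {j0}. s j * (\<theta> j k - \<sigma> j * \<theta> j0 k))"
      unfolding combination_apply
      by (subst sum.remove[of _ j0]) (auto simp: vec_scale_def intro!: sum.cong)
    also have "\<dots> = old s j0 * \<theta> j0 k + (\<Sum>j\<in>UNIV - {j0}. s j * \<theta> j k)"
      by (simp add: old_def algebra_simps sum_subtractf sum_distrib_left)
    also have "\<dots> = combination (old s) \<theta> k"
      unfolding combination_apply by (subst (2) sum.remove[of _ j0]) (auto simp: old_def)
    finally show "combination s ?\<theta> k = combination (old s) \<theta> k" .
  qed
  have "(\<Sum>j\<in>UNIV. old s j * \<sigma> j) = L * s j0" for s
    by (subst sum.remove[of _ j0]) (auto simp: old_def assms(4))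
  then have comb_mem: "combination s ?\<theta> \<in> M" for s
    by (simp add: old mem)
  show ?thesis
    unfolding vec_basis_def
  proof (intro conjI allI ballI impI)
    fix j
    have "combination (\<lambda>k. if k = j then 1 else 0) ?\<theta> = ?\<theta> j"
      by (rule ext) (simp add: combination_apply if_distrib[of "\<lambda>x. x * _"] cong: if_cong)
    then show "?\<theta> j \<in> M"
      using comb_mem[of "\<lambda>k. if k = j then 1 else 0"] by simp
  next
    fix p assume "p \<in> M"
    then obtain s where s: "p = combination s \<theta>"
      using basis \<open>M \<subseteq> M'\<close> unfolding vec_basis_def by blast
    then obtain v where v: "(\<Sum>j\<in>UNIV. s j * \<sigma> j) = L * v"
      using mem \<open>p \<in> M\<close> by (auto simp: dvd_def)
    have "s j0 = L * v - (\<Sum>k\<in>UNIV - {j0}. s k * \<sigma> k)"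
      unfolding v[symmetric] by (subst sum.remove[of _ j0]) (auto simp: assms(4))
    then have "old (s(j0 := v)) = s"
      by (auto simp: old_def fun_eq_iff intro!: sum.cong)
    with old[of "s(j0 := v)"] s have "p = combination (s(j0 := v)) ?\<theta>"
      by (simp only:)
    then show "\<exists>s. p = combination s ?\<theta>" by blast
  next
    fix s j assume "combination s ?\<theta> = 0"
    then have zero: "old s j = 0" for j
      using old[of s] basis by (simp add: vec_basis_def)
    have other: "s j = 0" if "j \<noteq> j0" for j
      using zero[of j] that by (simp add: old_def)
    then have "L * s j0 = 0"
      using zero[of j0] by (simp add: old_def)
    then show "s j = 0"
      using other \<open>L \<noteq> 0\<close> by (cases "j = j0") (auto simp: mpoly_mult_eq_0_iff)
  qed
qed

text \<open>
  Possible entries of the basis vectors that belong to a block \<open>c\<close>; the zero polynomial is a form of every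
  degree, since an entry of a vector of degree \<open>d\<close> may vanish.
\<close>

inductive block_form :: "('j \<Rightarrow> ('i::finite, 'k::field) mpoly) \<Rightarrow> 'j set \<Rightarrow> nat \<Rightarrow> ('i, 'k) mpoly \<Rightarrow> bool"
  for X c where
    zero: "block_form X c d 0"
  | unit: "block_form X c 0 (Const a)"
  | times: "block_form X c d p \<Longrightarrow> k \<in> c \<Longrightarrow> block_form X c (Suc d) (X k * p)"
  | add: "block_form X c d p \<Longrightarrow> block_form X c d q \<Longrightarrow> block_form X c d (p + q)"

lemma block_form_Const_mult: "block_form X c d p \<Longrightarrow> block_form X c d (Const a * p)"
proof (induction rule: block_form.induct)
  case (unit a')
  then show ?case by (simp add: block_form.unit flip: Const_simps(2))
next
  case (times d p k)
  then show ?case using block_form.times[of X c d "Const a * p" k] by (simp add: mult_ac)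
qed (auto simp: distrib_left intro: block_form.zero block_form.add)

lemma block_form_sum: "(\<And>a. a \<in> A \<Longrightarrow> block_form X c d (f a)) \<Longrightarrow> block_form X c d (sum f A)"
  by (induction A rule: infinite_finite_induct) (auto intro: block_form.zero block_form.add)

lemma block_form_linear_mult:
  assumes "block_form X c d p"
  shows "block_form X c (Suc d) ((\<Sum>k\<in>c. Const (a k) * X k) * p)"
  unfolding sum_distrib_right mult.assoc
  by (intro block_form_sum block_form_Const_mult block_form.times assms)

text \<open>
  The ring of a block modulo \<open>L\<close>: every form of degree \<open>d\<close> is congruent to a multiple of \<open>t ^ d\<close>. In a block
  with two elements, \<open>t\<close> is a variable that is independent of \<open>L\<close>; in a block with one element, \<open>t = 0\<close> is possible, and
  \<open>t ^ 0 = 1\<close> then still represents the constants.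
\<close>
locale rank_two_block =
  fixes X :: "'j \<Rightarrow> ('i::finite, 'k::field) mpoly" and c :: "'j set" and L t :: "('i, 'k) mpoly"
  assumes L_nz: "L \<noteq> 0"
    and L_mult: "block_form X c d p \<Longrightarrow> block_form X c (Suc d) (L * p)"
    and t_mult: "block_form X c d p \<Longrightarrow> block_form X c (Suc d) (t * p)"
    and generates: "k \<in> c \<Longrightarrow> \<exists>x y. X k = Const x * t + Const y * L"
    and not_dvd: "L dvd Const a * t ^ d \<Longrightarrow> Const a * t ^ d = 0"
begin

lemma t_power_mult: "block_form X c d p \<Longrightarrow> block_form X c (e + d) (t ^ e * p)"
  by (induction e) (auto simp: mult.assoc intro: t_mult)

lemma remainder:
  assumes "block_form X c d p"
  shows "\<exists>a q. p = Const a * t ^ d + L * q \<and> block_form X c (d - 1) q \<and> (d = 0 \<longrightarrow> q = 0)"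
  using assms
proof (induction rule: block_form.induct)
  case (zero d)
  show ?case
    by (intro exI[of _ 0]) (auto simp: Const_simps block_form.zero)
next
  case (unit a)
  show ?case
    by (intro exI[of _ a] exI[of _ 0]) (auto simp: block_form.zero)
next
  case (times d p k)
  then obtain a q where q: "p = Const a * t ^ d + L * q" "block_form X c (d - 1) q" "d = 0 \<longrightarrow> q = 0"
    by blast
  obtain x y where xy: "X k = Const x * t + Const y * L"
    using generates times by blast
  have "X k * p = Const (x * a) * t ^ Suc d + L * (Const (y * a) * t ^ d + X k * q)"
    by (subst q(1), simp add: Const_simps algebra_simps, simp add: xy algebra_simps)
  moreover have "block_form X c d (Const (y * a) * t ^ d)"
    using t_power_mult[OF block_form.unit[of X c 1], of d]
    by (intro block_form_Const_mult) (simp add: Const_simps)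
  moreover have "block_form X c d (X k * q)"
  proof (cases d)
    case 0
    then show ?thesis using q(3) by (simp add: block_form.zero)
  next
    case (Suc d')
    then show ?thesis using block_form.times[OF q(2) times(2)] by simp
  qed
  ultimately show ?case
    by (intro exI[of _ "x * a"] exI[of _ "Const (y * a) * t ^ d + X k * q"]) (simp add: block_form.add)
next
  case (add d p q)
  then obtain a a' p' q' where "p = Const a * t ^ d + L * p'" "block_form X c (d - 1) p'" "d = 0 \<longrightarrow> p' = 0"
      "q = Const a' * t ^ d + L * q'" "block_form X c (d - 1) q'" "d = 0 \<longrightarrow> q' = 0"
    by metis
  then show ?case
    by (intro exI[of _ "a + a'"] exI[of _ "p' + q'"]) (auto simp: Const_simps algebra_simps block_form.add)
qed

lemma quotient:
  assumes "block_form X c d p" "L ^ n dvd p"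
  shows "\<exists>q. p = L ^ n * q \<and> block_form X c (d - n) q \<and> (q \<noteq> 0 \<longrightarrow> n \<le> d)"
  using assms
proof (induction n arbitrary: d p)
  case (Suc n)
  obtain a q where q: "p = Const a * t ^ d + L * q" "block_form X c (d - 1) q" "d = 0 \<longrightarrow> q = 0"
    using remainder[OF Suc.prems(1)] by blast
  have "L dvd p"
    using Suc.prems(2) by (metis dvd_mult_left power_Suc)
  then have "Const a * t ^ d = 0"
    using not_dvd q(1) by (simp add: dvd_add_left_iff)
  then have p: "p = L * q"
    using q(1) by simp
  show ?case
  proof (cases "q = 0")
    case True
    then show ?thesis using p by (intro exI[of _ 0]) (simp add: block_form.zero)
  next
    case False
    obtain s where "L * q = L * (L ^ n * s)"
      using Suc.prems(2) p by (auto simp: dvd_def mult.assoc)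
    then have "L ^ n dvd q"
      using mpoly_mult_left_cancel[OF L_nz] by (metis dvd_triv_left)
    from Suc.IH[OF q(2) this] obtain q' where q': "q = L ^ n * q'" "block_form X c (d - 1 - n) q'" "q' \<noteq> 0 \<longrightarrow> n \<le> d - 1"
      by blast
    have "d \<noteq> 0" "q' \<noteq> 0"
      using False q(3) q'(1) by auto
    then show ?thesis
      using p q' by (intro exI[of _ q']) (auto simp: mult.assoc)
  qed
qed auto

end

context two_bases
begin

lemma rank_two_block_exists:
  assumes lin: "Vector_Spaces.linear scale (*) \<beta>" and nz: "\<beta> u \<noteq> 0"
    and c: "card c \<le> 2" "\<And>k. k \<notin> c \<Longrightarrow> \<beta> (w k) = 0"
  shows "\<exists>t. rank_two_block (\<lambda>k. form_poly b (\<eta> k)) c (form_poly b \<beta>) t"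
proof -
  define X where "X k = form_poly b (\<eta> k)" for k
  define L where "L = form_poly b \<beta>"
  have L: "L = (\<Sum>k\<in>c. Const (\<beta> (w k)) * X k)"
  proof -
    have "L = (\<Sum>k\<in>UNIV. Const (\<beta> (w k)) * X k)"
      unfolding L_def X_def by (rule form_poly_expansion[OF lin])
    also have "\<dots> = (\<Sum>k\<in>c. Const (\<beta> (w k)) * X k)"
      using c(2) by (intro sum.mono_neutral_right) (auto simp: Const_simps)
    finally show ?thesis .
  qed
  have L_nz: "L \<noteq> 0"
    using b.form_poly_eq_0D[OF lin] nz by (auto simp: L_def)
  have L_mult: "block_form X c (Suc d) (L * p)" if "block_form X c d p" for d p
    unfolding L by (rule block_form_linear_mult[OF that])
  have power: "Const a * t ^ d = 0" if "t = 0 \<or> \<not> L dvd t" "L dvd Const a * t ^ d" for t a d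
    using that(2)
  proof (induction d)
    case 0
    obtain v where v: "\<beta> v = 1"
      using b.linear_form_normalize[OF lin nz] by blast
    show ?case
      using 0 b.form_poly_dvd_iff[OF lin v] by (simp add: L_def b.kill_form_Const)
  next
    case (Suc d)
    show ?case
    proof (cases "t = 0")
      case False
      have "L dvd t * (Const a * t ^ d)"
        using Suc.prems by (simp add: mult_ac)
      then have "L dvd Const a * t ^ d"
        using b.form_poly_dvd_multD[OF lin nz] that(1) False unfolding L_def by blast
      then have "Const a * t ^ d = 0"
        by (rule Suc.IH)
      then show ?thesis by (auto simp: mpoly_mult_eq_0_iff)
    qed simp
  qed
  have "\<exists>k0\<in>c. \<beta> (w k0) \<noteq> 0"
    using L_nz by (subst (asm) L) (metis (no_types, lifting) Const_simps(4) mult_zero_left sum.neutral)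
  then obtain k0 where k0: "k0 \<in> c" "\<beta> (w k0) \<noteq> 0" by blast
  have "finite c" by simp
  show ?thesis
  proof (cases "c = {k0}")
    case True
    have "X k0 = Const 0 * 0 + Const (inverse (\<beta> (w k0))) * L"
      unfolding L True using k0 by (simp add: mult.assoc[symmetric] flip: Const_simps(2)) (simp add: Const_simps)
    then have "rank_two_block X c L 0"
      using L_nz L_mult power[of 0] True by unfold_locales (auto intro: block_form.zero)
    then show ?thesis unfolding X_def L_def by blast
  next
    case False
    then obtain k1 where k1: "k1 \<in> c" "k1 \<noteq> k0" using k0 by blast
    have c_eq: "c = {k0, k1}"
      using card_seteq[OF \<open>finite c\<close>, of "{k0, k1}"] k0 k1 c(1) by auto
    have not_dvd: "\<not> L dvd X k1"
    proof
      assume "L dvd X k1"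
      then obtain x where x: "\<And>v. \<eta> k1 v = x * \<beta> v"
        using b.form_poly_dvd_form_polyD[OF lin nz w.linear_coordinate] by (auto simp: L_def X_def)
      from x[of "w k0"] have "x = 0"
        using k0 k1 by (auto simp: w.coordinate_basis)
      then show False
        using x[of "w k1"] by (simp add: w.coordinate_basis)
    qed
    have "Const (inverse (\<beta> (w k0))) * L = Const (inverse (\<beta> (w k0)) * \<beta> (w k0)) * X k0
        + Const (inverse (\<beta> (w k0)) * \<beta> (w k1)) * X k1"
      unfolding L c_eq using k1 by (simp add: Const_simps distrib_left mult.assoc)
    then have "X k0 = Const (- (inverse (\<beta> (w k0)) * \<beta> (w k1))) * X k1 + Const (inverse (\<beta> (w k0))) * L"
      using k0 by (simp add: Const_simps)
    moreover have "X k1 = Const 1 * X k1 + Const 0 * L"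
      by (simp add: Const_simps)
    ultimately have "rank_two_block X c L (X k1)"
      using L_nz L_mult power[of "X k1"] not_dvd k1
      by unfold_locales (auto simp: c_eq intro: block_form.times)
    then show ?thesis unfolding X_def L_def by blast
  qed
qed

definition adapted_basis ::
    "('j \<Rightarrow> 'c) \<Rightarrow> ('j \<Rightarrow> 'j \<Rightarrow> ('i, 'k) mpoly) \<Rightarrow> ('j \<Rightarrow> nat) \<Rightarrow> ('j \<Rightarrow> ('i, 'k) mpoly) set \<Rightarrow> bool"
  where "adapted_basis blk \<theta> d M \<longleftrightarrow> vec_basis \<theta> M \<and>
    (\<forall>j k. blk k \<noteq> blk j \<longrightarrow> \<theta> j k = 0) \<and>
    (\<forall>j k. block_form (\<lambda>k. form_poly b (\<eta> k)) {i. blk i = blk j} (d j) (\<theta> j k))"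

text \<open>
  Induction on the total multiplicity, where \<open>m = 0\<close> is allowed at intermediate steps. The quotients
  \<open>r j\<close> of \<open>pair (\<theta> j)\<close> by \<open>L ^ n\<close> are constant multiples of powers of \<open>t\<close> modulo \<open>L\<close>, and the vector with the least degree among those
  with \<open>r j\<close> not divisible by \<open>L\<close> is the pivot. If there is no such vector, the module has not changed.
\<close>
lemma adapted_basis_exists:
  fixes \<A> :: "'v set set" and \<alpha> :: "'v set \<Rightarrow> 'v \<Rightarrow> 'k" and blk :: "'j \<Rightarrow> 'c"
  assumes fin: "finite \<A>"
    and lin: "\<And>H. H \<in> \<A> \<Longrightarrow> Vector_Spaces.linear scale (*) (\<alpha> H)"
    and nonzero: "\<And>H. H \<in> \<A> \<Longrightarrow> \<exists>v. \<alpha> H v \<noteq> 0"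
    and blk: "\<And>c. card {i. blk i = c} \<le> 2"
    and supp: "\<And>H. H \<in> \<A> \<Longrightarrow> \<exists>c. \<forall>k. blk k \<noteq> c \<longrightarrow> \<alpha> H (w k) = 0"
  shows "\<exists>\<theta> d. adapted_basis blk \<theta> d (log_vectors b w \<alpha> \<A> m)"
proof (induction "\<Sum>H\<in>\<A>. m H" arbitrary: m)
  case 0
  then have "log_vectors b w \<alpha> \<A> m = UNIV"
    using fin by (auto simp: log_vectors_def)
  moreover have "vec_basis (\<lambda>j. axis j 1) (UNIV :: ('j \<Rightarrow> ('i, 'k) mpoly) set)"
  proof -
    have "combination s (\<lambda>j. axis j 1) = s" for s :: "'j \<Rightarrow> ('i, 'k) mpoly"
      by (rule ext) (simp add: combination_apply axis_def if_distrib[of "(*) _"] cong: if_cong)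
    then show ?thesis by (auto simp: vec_basis_def)
  qed
  moreover have "block_form X c 0 (axis j 1 k)" for X :: "'j \<Rightarrow> ('i, 'k) mpoly" and c and j k :: 'j
    using block_form.unit[of X c 1] by (auto simp: axis_def Const_simps intro: block_form.zero)
  ultimately show ?case
    by (intro exI[of _ "\<lambda>j. axis j 1"] exI[of _ "\<lambda>_. 0"]) (auto simp: adapted_basis_def axis_def)
next
  case (Suc N)
  then obtain H where H: "H \<in> \<A>" "0 < m H"
    by (metis gr0I nat.simps(3) sum.neutral)
  define n where "n = m H - 1"
  define m' where "m' = m(H := n)"
  define M where "M = log_vectors b w \<alpha> \<A> m"
  define M' where "M' = log_vectors b w \<alpha> \<A> m'"
  define L where "L = form_poly b (\<alpha> H)"
  define pair where "pair p = (\<Sum>k\<in>UNIV. Const (\<alpha> H (w k)) * p k)" for p :: "'j \<Rightarrow> ('i, 'k) mpoly"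
  define X where "X = (\<lambda>k. form_poly b (\<eta> k))"
  have mH: "m H = Suc n" "m' H = n" "\<And>H'. H' \<noteq> H \<Longrightarrow> m' H' = m H'"
    using H by (auto simp: n_def m'_def)
  have "(\<Sum>H\<in>\<A> - {H}. m H) = (\<Sum>H\<in>\<A> - {H}. m' H)"
    by (rule sum.cong) (auto simp: mH(3))
  then have "(\<Sum>H\<in>\<A>. m H) = Suc (\<Sum>H\<in>\<A>. m' H)"
    using fin H(1) by (simp add: sum.remove[of \<A> H] mH(1,2))
  then obtain \<theta> d where "adapted_basis blk \<theta> d M'"
    using Suc.hyps(1)[of m'] Suc.hyps(2) unfolding M'_def by auto
  then have basis: "vec_basis \<theta> M'" and \<theta>_off: "\<And>j k. blk k \<noteq> blk j \<Longrightarrow> \<theta> j k = 0"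
    and \<theta>_form: "\<And>j k. block_form X {i. blk i = blk j} (d j) (\<theta> j k)"
    by (auto simp: adapted_basis_def X_def)
  have M'_dvd: "L ^ n dvd pair p" if "p \<in> M'" for p
    using that H(1) mH by (auto simp: M'_def log_vectors_def L_def pair_def)
  have M_iff: "p \<in> M \<longleftrightarrow> p \<in> M' \<and> L ^ Suc n dvd pair p" for p
  proof -
    define Q where "Q H' e \<longleftrightarrow> form_poly b (\<alpha> H') ^ e dvd (\<Sum>k\<in>UNIV. Const (\<alpha> H' (w k)) * p k)" for H' e
    have split: "(\<forall>H'\<in>\<A>. Q H' (e H')) \<longleftrightarrow> Q H (e H) \<and> (\<forall>H'\<in>\<A> - {H}. Q H' (e H'))" for e
      using H(1) by auto
    have "Q H (Suc n) \<Longrightarrow> Q H n"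
      unfolding Q_def by (rule power_le_dvd) auto
    moreover have "(\<forall>H'\<in>\<A> - {H}. Q H' (m H')) \<longleftrightarrow> (\<forall>H'\<in>\<A> - {H}. Q H' (m' H'))"
      by (intro ball_cong refl) (simp add: mH(3))
    ultimately have "(\<forall>H'\<in>\<A>. Q H' (m H')) \<longleftrightarrow> (\<forall>H'\<in>\<A>. Q H' (m' H')) \<and> Q H (Suc n)"
      unfolding split[of m] split[of m'] mH(1,2) by blast
    then show ?thesis
      by (simp add: M_def M'_def log_vectors_def Q_def L_def pair_def del: power_Suc)
  qed
  have pair_comb: "pair (combination s \<theta>) = (\<Sum>j\<in>UNIV. s j * pair (\<theta> j))" for s
    unfolding pair_def combination_apply sum_distrib_left by (subst sum.swap) (simp add: mult_ac)
  obtain c where c: "\<And>k. blk k \<noteq> c \<Longrightarrow> \<alpha> H (w k) = 0"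
    using supp[OF H(1)] by blast
  define C where "C = {i. blk i = c}"
  obtain u where u: "\<alpha> H u \<noteq> 0" using nonzero[OF H(1)] by blast
  have "card C \<le> 2" "\<And>k. k \<notin> C \<Longrightarrow> \<alpha> H (w k) = 0"
    using blk c by (auto simp: C_def)
  from rank_two_block_exists[OF lin[OF H(1)] u this] obtain t where t: "rank_two_block X C L t"
    by (auto simp: X_def L_def)
  interpret rank_two_block X C L t by (rule t)
  have "\<exists>r x. pair (\<theta> j) = L ^ n * r \<and> (blk j \<noteq> c \<longrightarrow> r = 0) \<and> (r \<noteq> 0 \<longrightarrow> n \<le> d j) \<and>
      L dvd r - Const x * t ^ (d j - n)" for j
  proof (cases "blk j = c")
    case True
    have "block_form X C (d j) (pair (\<theta> j))"
      unfolding pair_def using \<theta>_form[of j] True by (intro block_form_sum block_form_Const_mult) (simp add: C_def)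
    from quotient[OF this M'_dvd[of "\<theta> j"]] obtain r
      where r: "pair (\<theta> j) = L ^ n * r" "block_form X C (d j - n) r" "r \<noteq> 0 \<longrightarrow> n \<le> d j"
      using basis by (auto simp: vec_basis_def)
    from remainder[OF r(2)] obtain x q where "r = Const x * t ^ (d j - n) + L * q"
      by blast
    then show ?thesis using r True by (intro exI[of _ r] exI[of _ x]) simp
  next
    case False
    then have "\<alpha> H (w k) = 0 \<or> \<theta> j k = 0" for k
      using c[of k] \<theta>_off[of k j] False by metis
    then have "pair (\<theta> j) = 0"
      unfolding pair_def by (intro sum.neutral) (metis Const_simps(4) mult_zero_left mult_zero_right)
    then show ?thesis by (intro exI[of _ 0]) (simp add: Const_simps)
  qed
  then obtain r x where r: "\<And>j. pair (\<theta> j) = L ^ n * r j" "\<And>j. blk j \<noteq> c \<Longrightarrow> r j = 0"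
      "\<And>j. r j \<noteq> 0 \<Longrightarrow> n \<le> d j" "\<And>j. L dvd r j - Const (x j) * t ^ (d j - n)"
    by metis
  have comb_M': "combination s \<theta> \<in> M'" for s
    unfolding combination_def M'_def
    using basis by (intro vec.subspace_sum vec.subspace_scale subspace_log_vectors) (auto simp: vec_basis_def M'_def)
  have Ln: "L ^ n \<noteq> 0"
    using L_nz by (simp add: mpoly_power_eq_0_iff)
  have comb_M: "combination s \<theta> \<in> M \<longleftrightarrow> L dvd (\<Sum>j\<in>UNIV. s j * r j)" for s
  proof -
    have "pair (combination s \<theta>) = L ^ n * (\<Sum>j\<in>UNIV. s j * r j)"
      by (simp add: pair_comb r(1) sum_distrib_left mult_ac)
    then have "combination s \<theta> \<in> M \<longleftrightarrow> L ^ n * L dvd L ^ n * (\<Sum>j\<in>UNIV. s j * r j)"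
      by (simp add: M_iff comb_M' mult.commute)
    also have "\<dots> \<longleftrightarrow> L dvd (\<Sum>j\<in>UNIV. s j * r j)"
    proof
      assume "L ^ n * L dvd L ^ n * (\<Sum>j\<in>UNIV. s j * r j)"
      then obtain q where "L ^ n * (\<Sum>j\<in>UNIV. s j * r j) = L ^ n * (L * q)"
        by (auto simp: dvd_def mult.assoc)
      then have "(\<Sum>j\<in>UNIV. s j * r j) = L * q"
        by (rule mpoly_mult_left_cancel[OF Ln])
      then show "L dvd (\<Sum>j\<in>UNIV. s j * r j)" by simp
    qed (rule mult_dvd_mono[OF dvd_refl])
    finally show ?thesis .
  qed
  show ?case
  proof (cases "\<forall>j. L dvd r j")
    case True
    have "M' \<subseteq> M"
    proof
      fix p assume "p \<in> M'"
      then obtain s where s: "p = combination s \<theta>"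
        using basis unfolding vec_basis_def by blast
      have "L dvd (\<Sum>j\<in>UNIV. s j * r j)"
        using True by (intro dvd_sum) auto
      then show "p \<in> M" by (simp add: s comb_M)
    qed
    then have "M = M'"
      using M_iff by blast
    then show ?thesis
      using \<open>adapted_basis blk \<theta> d M'\<close> unfolding M_def by blast
  next
    case False
    then obtain j0 where j0: "\<not> L dvd r j0" and min: "\<And>j. \<not> L dvd r j \<Longrightarrow> d j0 \<le> d j"
      using ex_has_least_nat[of "\<lambda>j. \<not> L dvd r j" _ d] by blast
    have blk_j: "blk j = c \<and> n \<le> d j" if "\<not> L dvd r j" for j
      using r(2,3)[of j] that by fastforce
    have x0: "x j0 \<noteq> 0"
      using r(4)[of j0] j0 by (auto simp: Const_simps)
    \<comment> \<open>The degree of \<open>t\<close> in the quotient \<open>r j / r j0\<close>, which is nonnegative by the choice of \<open>j0\<close>, keeps \<open>\<theta> j - \<sigma> j \<theta> j0\<close> homogeneous.\<close>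
    define \<sigma> where "\<sigma> j = (if L dvd r j then 0 else Const (x j / x j0) * t ^ (d j - d j0))" for j
    have \<sigma>0: "\<sigma> j0 = 1"
      using j0 x0 by (simp add: \<sigma>_def Const_simps)
    have \<sigma>: "L dvd r j - \<sigma> j * r j0" for j
    proof (cases "L dvd r j")
      case False
      have "d j - n = (d j - d j0) + (d j0 - n)"
        using min[OF False] blk_j[OF j0] by simp
      then have "Const (x j) * t ^ (d j - n) = \<sigma> j * (Const (x j0) * t ^ (d j0 - n))"
        using False x0 by (simp add: \<sigma>_def power_add mult.assoc mult.left_commute[of "t ^ _" "Const _"])
          (simp add: mult.assoc[symmetric] flip: Const_simps(2))
      then have "r j - \<sigma> j * r j0 = (r j - Const (x j) * t ^ (d j - n))
          - \<sigma> j * (r j0 - Const (x j0) * t ^ (d j0 - n))"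
        by (simp add: algebra_simps)
      then show ?thesis
        using r(4) by (simp only: dvd_diff dvd_mult)
    qed (simp add: \<sigma>_def)
    have mem: "combination s \<theta> \<in> M \<longleftrightarrow> L dvd (\<Sum>j\<in>UNIV. s j * \<sigma> j)" for s
    proof -
      have "L dvd (\<Sum>j\<in>UNIV. s j * (r j - \<sigma> j * r j0))"
        using \<sigma> by (intro dvd_sum) auto
      also have "(\<Sum>j\<in>UNIV. s j * (r j - \<sigma> j * r j0)) = (\<Sum>j\<in>UNIV. s j * r j) - (\<Sum>j\<in>UNIV. s j * \<sigma> j) * r j0"
        by (simp add: algebra_simps sum_subtractf sum_distrib_left)
      finally have "L dvd (\<Sum>j\<in>UNIV. s j * r j) \<longleftrightarrow> L dvd (\<Sum>j\<in>UNIV. s j * \<sigma> j) * r j0"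
        using dvd_add_right_iff[of L "(\<Sum>j\<in>UNIV. s j * r j) - (\<Sum>j\<in>UNIV. s j * \<sigma> j) * r j0"
            "(\<Sum>j\<in>UNIV. s j * \<sigma> j) * r j0"] by (simp only: diff_add_cancel)
      also have "\<dots> \<longleftrightarrow> L dvd (\<Sum>j\<in>UNIV. s j * \<sigma> j)"
        using b.form_poly_dvd_multD[OF lin[OF H(1)] u, folded L_def] j0 by (blast intro: dvd_mult2)
      finally show ?thesis by (simp add: comb_M)
    qed
    define \<theta>' where "\<theta>' j = (if j = j0 then vec_scale L (\<theta> j0) else \<theta> j - vec_scale (\<sigma> j) (\<theta> j0))" for j
    define d' where "d' j = (if j = j0 then Suc (d j0) else d j)" for j
    have "vec_basis \<theta>' M"
      unfolding \<theta>'_def using M_iff by (intro vec_basis_pivot[OF basis _ L_nz \<sigma>0 mem]) auto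
    moreover have "\<theta>' j k = 0" if "blk k \<noteq> blk j" for j k
    proof -
      have "\<sigma> j = 0 \<or> \<theta> j0 k = 0"
        using that blk_j[of j] blk_j[OF j0] \<theta>_off[of k j0] by (auto simp: \<sigma>_def)
      then show ?thesis
        using that \<theta>_off[of k] by (auto simp: \<theta>'_def vec_scale_def)
    qed
    moreover have "block_form X {i. blk i = blk j} (d' j) (\<theta>' j k)" for j k
    proof (cases "j = j0")
      case True
      then show ?thesis
        using L_mult[of "d j0" "\<theta> j0 k"] \<theta>_form[of j0 k] blk_j[OF j0]
        by (simp add: \<theta>'_def d'_def vec_scale_def C_def)
    next
      case False
      show ?thesis
      proof (cases "L dvd r j")
        case True
        then show ?thesis using False \<theta>_form[of j k] by (simp add: \<theta>'_def d'_def \<sigma>_def vec_scale_def)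
      next
        case not: False
        have "block_form X C (d j) (t ^ (d j - d j0) * \<theta> j0 k)"
          using t_power_mult[of "d j0" "\<theta> j0 k" "d j - d j0"] \<theta>_form[of j0 k] blk_j[OF j0] min[OF not]
          by (simp add: C_def)
        from block_form_Const_mult[OF this, of "- (x j / x j0)"]
        have "block_form X C (d j) (- (\<sigma> j * \<theta> j0 k))"
          using not by (simp add: \<sigma>_def Const_simps mult.assoc)
        with \<theta>_form[of j k] show ?thesis
          using False blk_j[OF not] block_form.add[of X C "d j" "\<theta> j k" "- (\<sigma> j * \<theta> j0 k)"]
          by (simp add: \<theta>'_def d'_def vec_scale_def C_def)
      qed
    qed
    ultimately have "adapted_basis blk \<theta>' d' M"
      by (simp add: adapted_basis_def X_def)
    then show ?thesis unfolding M_def by blast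
  qed
qed

lemma blocks_imp_free:
  fixes \<A> :: "'v set set" and \<alpha> :: "'v set \<Rightarrow> 'v \<Rightarrow> 'k" and blk :: "'j \<Rightarrow> 'c"
  assumes "finite \<A>"
    and "\<And>H. H \<in> \<A> \<Longrightarrow> Vector_Spaces.linear scale (*) (\<alpha> H)"
    and "\<And>H. H \<in> \<A> \<Longrightarrow> \<exists>v. \<alpha> H v \<noteq> 0"
    and "\<And>c. card {i. blk i = c} \<le> 2"
    and "\<And>H. H \<in> \<A> \<Longrightarrow> \<exists>c. \<forall>k. blk k \<noteq> c \<longrightarrow> \<alpha> H (w k) = 0"
  shows "free_multiarrangement b \<alpha> \<A> m"
proof -
  obtain \<theta> d where "adapted_basis blk \<theta> d (log_vectors b w \<alpha> \<A> m)"
    using adapted_basis_exists[of \<A> \<alpha> blk m, OF assms] by blast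
  then have "vec_basis \<theta> (log_vectors b w \<alpha> \<A> m)"
    by (simp add: adapted_basis_def)
  then show ?thesis
    by (intro free_if_basis[of \<A> \<alpha> \<theta>, OF assms(2)]) (auto simp: vec_basis_def combination_def)
qed

end


section \<open>Bases adapted to an arrangement\<close>

context coordinates
begin

text \<open>When \<open>\<beta>\<close> takes the place of \<open>\<xi> j\<close>, the other basis vectors are projected to the kernel of \<open>\<beta>\<close> along \<open>b j\<close>.\<close>

lemma exchange:
  assumes lin: "Vector_Spaces.linear scale (*) \<beta>" and nz: "\<beta> (b j) \<noteq> 0"
  defines "b' \<equiv> (\<lambda>i. if i = j then scale (inverse (\<beta> (b j))) (b j) else b i - scale (\<beta> (b i) / \<beta> (b j)) (b j))"
  shows "coordinates scale b' (\<xi>(j := \<beta>))"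
proof (rule coordinates.intro[OF vector_space_axioms], unfold coordinates_axioms_def, intro conjI allI)
  have diff: "\<gamma> (u - v) = \<gamma> u - \<gamma> v" if "Vector_Spaces.linear scale (*) \<gamma>" for \<gamma> u v
    using linear_form_add[OF that, of "u - v" v] by (simp add: algebra_simps)
  show "Vector_Spaces.linear scale (*) ((\<xi>(j := \<beta>)) i)" for i
    by (simp add: lin linear_coordinate)
  show "(\<xi>(j := \<beta>)) i (b' k) = (if i = k then 1 else 0)" for i k
    using nz by (auto simp: b'_def diff[OF lin] diff[OF linear_coordinate] linear_form_scale[OF lin]
        linear_form_scale[OF linear_coordinate] coordinate_basis)
  show "v = (\<Sum>i\<in>UNIV. scale ((\<xi>(j := \<beta>)) i v) (b' i))" for v
  proof -
    let ?c = "\<lambda>i. \<xi> i v * (\<beta> (b i) / \<beta> (b j))"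
    have "(\<Sum>i\<in>UNIV. scale ((\<xi>(j := \<beta>)) i v) (b' i))
        = scale (\<beta> v * inverse (\<beta> (b j))) (b j) + (\<Sum>i\<in>UNIV - {j}. scale (\<xi> i v) (b i) - scale (?c i) (b j))"
      by (subst sum.remove[of _ j]) (auto simp: b'_def scale_right_diff_distrib intro!: sum.cong)
    also have "\<dots> = scale (\<beta> v * inverse (\<beta> (b j)) - (\<Sum>i\<in>UNIV - {j}. ?c i)) (b j)
        + (\<Sum>i\<in>UNIV - {j}. scale (\<xi> i v) (b i))"
      by (simp add: sum_subtractf scale_left_diff_distrib scale_sum_left)
    also have "\<beta> v * inverse (\<beta> (b j)) - (\<Sum>i\<in>UNIV - {j}. ?c i) = \<xi> j v"
    proof -
      have "\<beta> v = \<xi> j v * \<beta> (b j) + (\<Sum>i\<in>UNIV - {j}. \<xi> i v * \<beta> (b i))"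
        unfolding linear_form_expansion[OF lin, of v] by (rule sum.remove) auto
      moreover have "(\<Sum>i\<in>UNIV - {j}. ?c i) = (\<Sum>i\<in>UNIV - {j}. \<xi> i v * \<beta> (b i)) / \<beta> (b j)"
        by (simp add: sum_divide_distrib)
      ultimately show ?thesis
        using nz by (simp add: field_simps)
    qed
    also have "scale (\<xi> j v) (b j) + (\<Sum>i\<in>UNIV - {j}. scale (\<xi> i v) (b i)) = (\<Sum>i\<in>UNIV. scale (\<xi> i v) (b i))"
      by (rule sum.remove[symmetric]) auto
    finally show ?thesis
      using coordinate_expansion[of v] by simp
  qed
qed

lemma inj_basis: "inj b"
proof (rule injI)
  fix i j assume "b i = b j"
  then have "\<xi> i (b i) = \<xi> i (b j)" by simp
  then show "i = j" by (simp add: coordinate_basis split: if_splits)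
qed

lemma span_range_basis: "span (range b) = UNIV"
proof -
  have "v \<in> span (range b)" for v
    by (subst coordinate_expansion[of v]) (intro span_sum span_scale span_base, simp)
  then show ?thesis by auto
qed

lemma independent_range_basis: "independent (range b)"
proof (rule independent_if_scalars_zero)
  fix f x assume *: "(\<Sum>x\<in>range b. scale (f x) x) = 0" "x \<in> range b"
  then obtain i where i: "x = b i" by auto
  have "\<xi> i (\<Sum>j\<in>UNIV. scale (f (b j)) (b j)) = f (b i)"
    by (simp add: linear_form_sum[OF linear_coordinate] linear_form_scale[OF linear_coordinate]
        coordinate_basis if_distrib[of "(*) _"] cong: if_cong)
  then show "f x = 0"
    using *(1) i by (simp add: sum.reindex[OF inj_basis] linear_form_0[OF linear_coordinate])
qed simp

lemma finite_if_independent: "independent B \<Longrightarrow> finite B"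
  using independent_span_bound[of "range b" B] span_range_basis by auto

lemma dim_kernel:
  assumes lin: "Vector_Spaces.linear scale (*) \<beta>" and U: "subspace U" "u \<in> U" "\<beta> u \<noteq> 0"
  shows "dim U = dim (U \<inter> {v. \<beta> v = 0}) + 1"
proof -
  let ?Z = "U \<inter> {v. \<beta> v = 0}"
  have Z: "subspace ?Z"
    using U(1) by (auto simp: subspace_def linear_form_0[OF lin] linear_form_add[OF lin] linear_form_scale[OF lin])
  obtain B where B: "B \<subseteq> ?Z" "independent B" "?Z \<subseteq> span B" "card B = dim ?Z"
    using basis_exists[of ?Z] by blast
  have span_B: "span B = ?Z"
    using B(1,3) span_minimal[OF B(1) Z] by blast
  have u: "u \<notin> span B"
    using U(3) by (simp add: span_B)
  have "span (insert u B) = U"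
  proof
    show "span (insert u B) \<subseteq> U"
      using U B(1) by (intro span_minimal) auto
    show "U \<subseteq> span (insert u B)"
    proof
      fix v assume v: "v \<in> U"
      have "v - scale (\<beta> v / \<beta> u) u \<in> U"
        using U v by (intro subspace_diff subspace_scale)
      moreover have "\<beta> (v - scale (\<beta> v / \<beta> u) u) = 0"
        using U(3) linear_form_add[OF lin, of "v - scale (\<beta> v / \<beta> u) u" "scale (\<beta> v / \<beta> u) u"]
        by (simp add: linear_form_scale[OF lin])
      ultimately have "v - scale (\<beta> v / \<beta> u) u \<in> span B"
        by (simp add: span_B)
      then show "v \<in> span (insert u B)"
        by (auto simp: span_breakdown_eq)
    qed
  qed
  then have "span (insert u B) = span U"
    using U(1) by (simp add: span_eq_iff[THEN iffD2])
  moreover have "independent (insert u B)"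
    using u B(2) by (rule independent_insertI)
  ultimately have "dim U = card (insert u B)"
    by (rule dim_eq_card)
  moreover have "u \<notin> B" "finite B"
    using u span_base finite_if_independent B(2) by auto
  ultimately show ?thesis
    using B(4) by simp
qed

text \<open>
  A coordinate system in which as many coordinates as possible are defining forms of \<open>\<A>\<close>: the
  other basis vectors lie in the center of \<open>\<A>\<close>, by \<open>exchange\<close>.
\<close>

lemma maximal_coordinates:
  assumes lin: "\<And>H. H \<in> \<A> \<Longrightarrow> Vector_Spaces.linear scale (*) (\<alpha> H)"
  obtains w :: "'i \<Rightarrow> 'v" and \<eta> where "coordinates scale w \<eta>"
    "\<And>H j. H \<in> \<A> \<Longrightarrow> \<alpha> H (w j) \<noteq> 0 \<Longrightarrow> \<eta> j \<in> \<alpha> ` \<A>"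
proof -
  let ?P = "\<lambda>(w :: 'i \<Rightarrow> 'v, \<eta>). coordinates scale w \<eta>"
  let ?f = "\<lambda>(w :: 'i \<Rightarrow> 'v, \<eta>). card {j :: 'i. \<eta> j \<in> \<alpha> ` \<A>}"
  have "\<exists>x. ?P x \<and> (\<forall>y. ?P y \<longrightarrow> ?f y \<le> ?f x)"
  proof (rule ex_has_greatest_nat[of ?P "(b, \<xi>)" ?f "Suc CARD('i)"])
    show "?P (b, \<xi>)" by (simp add: coordinates_axioms)
    show "\<forall>y. ?P y \<longrightarrow> ?f y < Suc CARD('i)" by (auto simp: less_Suc_eq_le intro: card_mono)
  qed
  then obtain w :: "'i \<Rightarrow> 'v" and \<eta> where w: "coordinates scale w \<eta>"
    and max: "\<And>w' \<eta>'. coordinates scale w' \<eta>' \<Longrightarrow> card {j :: 'i. \<eta>' j \<in> \<alpha> ` \<A>} \<le> card {j. \<eta> j \<in> \<alpha> ` \<A>}"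
    by auto
  have "\<eta> j \<in> \<alpha> ` \<A>" if H: "H \<in> \<A>" "\<alpha> H (w j) \<noteq> 0" for H j
  proof (rule ccontr)
    assume j: "\<eta> j \<notin> \<alpha> ` \<A>"
    have "{i. (\<eta>(j := \<alpha> H)) i \<in> \<alpha> ` \<A>} = insert j {i. \<eta> i \<in> \<alpha> ` \<A>}"
      using H(1) by auto
    with max[OF coordinates.exchange[OF w lin[OF H(1)] H(2)]] j show False
      by (simp add: card_insert_if)
  qed
  with w show thesis by (rule that)
qed

end

text \<open>
  In a totally free arrangement the supports of the forms in maximal coordinates have at most two
  elements, as larger ones give circuits. Two different supports \<open>{i, j}\<close> and \<open>{j, k}\<close> would give the
  circuit formed by the coordinates \<open>i\<close> and \<open>k\<close> and the two forms. So supports of size two are disjoint.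
\<close>

lemma totally_free_imp_blocks:
  fixes scale :: "'k::field \<Rightarrow> 'v::ab_group_add \<Rightarrow> 'v" and b :: "'i::finite \<Rightarrow> 'v"
  assumes b: "coordinates scale b \<xi>" and fin: "finite \<A>"
    and lin: "\<And>H. H \<in> \<A> \<Longrightarrow> Vector_Spaces.linear scale (*) (\<alpha> H)"
    and nonzero: "\<And>H. H \<in> \<A> \<Longrightarrow> \<exists>v. \<alpha> H v \<noteq> 0"
    and distinct: "\<And>H H' c. H \<in> \<A> \<Longrightarrow> H' \<in> \<A> \<Longrightarrow> \<forall>v. \<alpha> H v = c * \<alpha> H' v \<Longrightarrow> H = H'"
    and free: "totally_free b \<alpha> \<A>"
  obtains w :: "'i \<Rightarrow> 'v" and \<eta> and blk :: "'i \<Rightarrow> 'i set" where "coordinates scale w \<eta>"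
    "\<And>c. card {i. blk i = c} \<le> 2"
    "\<And>H. H \<in> \<A> \<Longrightarrow> \<exists>c. \<forall>k. blk k \<noteq> c \<longrightarrow> \<alpha> H (w k) = 0"
proof -
  obtain w :: "'i \<Rightarrow> 'v" and \<eta> where w: "coordinates scale w \<eta>"
    and \<eta>: "\<And>H j. H \<in> \<A> \<Longrightarrow> \<alpha> H (w j) \<noteq> 0 \<Longrightarrow> \<eta> j \<in> \<alpha> ` \<A>"
    using coordinates.maximal_coordinates[OF b, of \<A> \<alpha>, OF lin] by blast
  interpret w: coordinates scale w \<eta> by (rule w)
  have no_circuit: False
    if w': "coordinates scale w' \<eta>'" and H: "H \<in> \<A>"
      and \<eta>': "\<And>k. \<alpha> H (w' k) \<noteq> 0 \<Longrightarrow> \<eta>' k \<in> \<alpha> ` \<A>"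
      and k: "\<alpha> H (w' k1) \<noteq> 0" "\<alpha> H (w' k2) \<noteq> 0" "\<alpha> H (w' k3) \<noteq> 0" "k1 \<noteq> k2" "k1 \<noteq> k3" "k2 \<noteq> k3"
    for w' :: "'i \<Rightarrow> 'v" and \<eta>' H k1 k2 k3
  proof -
    define T where "T = {k. \<alpha> H (w' k) \<noteq> 0}"
    have "\<forall>k\<in>T. \<exists>H'. H' \<in> \<A> \<and> \<alpha> H' = \<eta>' k"
      using \<eta>' by (auto simp: T_def) (metis imageE)
    then obtain K where K: "\<And>k. k \<in> T \<Longrightarrow> K k \<in> \<A> \<and> \<alpha> (K k) = \<eta>' k"
      by metis
    have "two_bases scale b \<xi> w' \<eta>'"
      using b w' by (rule two_bases.intro)
    moreover have "\<And>k. \<alpha> H (w' k) \<noteq> 0 \<longleftrightarrow> k \<in> T"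
      by (simp add: T_def)
    moreover have "k1 \<in> T" "k2 \<in> T" "k3 \<in> T"
      using k by (auto simp: T_def)
    ultimately obtain m where "\<forall>H\<in>\<A>. 0 < m H" "\<not> free_multiarrangement b \<alpha> \<A> m"
      using two_bases.circuit_imp_not_free[of scale b \<xi> w' \<eta>' \<A> \<alpha> T K H k1 k2 k3]
        fin lin nonzero distinct K H k by blast
    then show False
      using free by (auto simp: totally_free_def)
  qed
  define supp where "supp H = {k. \<alpha> H (w k) \<noteq> 0}" for H
  have card_supp: "card (supp H) \<le> 2" if H: "H \<in> \<A>" for H
  proof (rule ccontr)
    assume "\<not> card (supp H) \<le> 2"
    then obtain T where T: "T \<subseteq> supp H" "card T = 3"
      using obtain_subset_with_card_n[of 3 "supp H"] by auto
    then obtain k1 k2 k3 where "T = {k1, k2, k3}" "k1 \<noteq> k2" "k1 \<noteq> k3" "k2 \<noteq> k3"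
      by (auto simp: card_3_iff)
    then show False
      using no_circuit[OF w H \<eta>[OF H], of k1 k2 k3] T(1) by (auto simp: supp_def)
  qed
  have unique: "supp H = supp H'"
    if H: "H \<in> \<A>" "H' \<in> \<A>" "card (supp H) = 2" "card (supp H') = 2" "j \<in> supp H" "j \<in> supp H'" for H H' j
  proof (rule ccontr)
    assume neq: "supp H \<noteq> supp H'"
    have "card (supp H - {j}) = 1" "card (supp H' - {j}) = 1"
      using H by simp_all
    then obtain i k where "supp H - {j} = {i}" "supp H' - {j} = {k}"
      by (metis card_1_singletonE)
    then have i: "supp H = {i, j}" "i \<noteq> j" and k: "supp H' = {j, k}" "k \<noteq> j"
      using H(5,6) by auto
    have "i \<noteq> k"
      using neq i k by auto
    have a: "\<alpha> H (w i) \<noteq> 0" "\<alpha> H (w j) \<noteq> 0" "\<alpha> H (w k) = 0"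
      using i k \<open>i \<noteq> k\<close> by (auto simp: supp_def set_eq_iff)
    have a': "\<alpha> H' (w i) = 0" "\<alpha> H' (w j) \<noteq> 0" "\<alpha> H' (w k) \<noteq> 0"
      using i k \<open>i \<noteq> k\<close> by (auto simp: supp_def set_eq_iff)
    \<comment> \<open>The form of \<open>H\<close> takes the place of the coordinate \<open>j\<close>; then the form of \<open>H'\<close> has support \<open>{i, j, k}\<close>.\<close>
    define w' where "w' = (\<lambda>i. if i = j then scale (inverse (\<alpha> H (w j))) (w j)
      else w i - scale (\<alpha> H (w i) / \<alpha> H (w j)) (w j))"
    have w': "coordinates scale w' (\<eta>(j := \<alpha> H))"
      unfolding w'_def using lin[OF H(1)] a(2) by (rule w.exchange)
    have diff: "\<alpha> H' (u - v) = \<alpha> H' u - \<alpha> H' v" for u v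
      using linear_form_add[OF lin[OF H(2)], of "u - v" v] by (simp add: algebra_simps)
    have val: "\<alpha> H' (w' l) = (if l = j then \<alpha> H' (w j) / \<alpha> H (w j)
        else \<alpha> H' (w l) - \<alpha> H (w l) / \<alpha> H (w j) * \<alpha> H' (w j))" for l
      by (simp add: w'_def diff linear_form_scale[OF lin[OF H(2)]] field_simps)
    have "(\<eta>(j := \<alpha> H)) l \<in> \<alpha> ` \<A>" if "\<alpha> H' (w' l) \<noteq> 0" for l
    proof (cases "l = j")
      case False
      then have "\<alpha> H' (w l) \<noteq> 0 \<or> \<alpha> H (w l) \<noteq> 0"
        using that by (auto simp: val)
      then show ?thesis
        using \<eta> H False by auto
    qed (use H in simp)
    then show False
      using no_circuit[OF w' H(2), of i j k] a a' i k \<open>i \<noteq> k\<close> by (simp add: val)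
  qed
  \<comment> \<open>The block of \<open>j\<close> is the support of size two that contains \<open>j\<close>, if there is one. Blocks are named by their sets of indices.\<close>
  define blk where "blk j = {j} \<union> \<Union> (supp ` {H \<in> \<A>. card (supp H) = 2 \<and> j \<in> supp H})" for j
  have blk_pair: "blk j = supp H" if "H \<in> \<A>" "card (supp H) = 2" "j \<in> supp H" for H j
  proof -
    have "supp ` {H \<in> \<A>. card (supp H) = 2 \<and> j \<in> supp H} = {supp H}"
      using that unique[OF _ that(1) _ that(2) _ that(3)] by blast
    then show ?thesis
      using that(3) by (auto simp: blk_def)
  qed
  have blk_single: "blk j = {j}" if "\<And>H. H \<in> \<A> \<Longrightarrow> card (supp H) = 2 \<Longrightarrow> j \<notin> supp H" for j
    using that by (auto simp: blk_def)
  have "card (blk j) \<le> 2" for j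
  proof (cases "\<exists>H\<in>\<A>. card (supp H) = 2 \<and> j \<in> supp H")
    case True
    then show ?thesis using blk_pair by force
  next
    case False
    then have "blk j = {j}" by (intro blk_single) blast
    then show ?thesis by simp
  qed
  moreover have "{i. blk i = blk j} \<subseteq> blk j" for j
    by (auto simp: blk_def)
  ultimately have fibre: "card {i. blk i = c} \<le> 2" for c
  proof (cases "\<exists>j. blk j = c")
    case True
    then obtain j where "blk j = c" by blast
    then show ?thesis
      using \<open>{i. blk i = blk j} \<subseteq> blk j\<close> \<open>card (blk j) \<le> 2\<close> card_mono[of "blk j" "{i. blk i = blk j}"] by auto
  qed auto
  have "\<exists>c. \<forall>k. blk k \<noteq> c \<longrightarrow> \<alpha> H (w k) = 0" if H: "H \<in> \<A>" for H
  proof (cases "card (supp H) = 2")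
    case True
    then have "\<forall>k\<in>supp H. blk k = supp H"
      using H blk_pair by blast
    then show ?thesis
      by (intro exI[of _ "supp H"]) (auto simp: supp_def)
  next
    case False
    then have "card (supp H) \<le> Suc 0"
      using card_supp[OF H] by auto
    then have "\<forall>k\<in>supp H. \<forall>k'\<in>supp H. k = k'"
      using card_le_Suc0_iff_eq[of "supp H"] by simp
    then have single: "blk k = blk k'" if "k \<in> supp H" "k' \<in> supp H" for k k'
      using that by (metis (no_types))
    show ?thesis
    proof (cases "supp H = {}")
      case False
      then obtain j where "j \<in> supp H" by blast
      then have "\<forall>k. blk k \<noteq> blk j \<longrightarrow> k \<notin> supp H"
        using single by blast
      then show ?thesis by (intro exI[of _ "blk j"]) (simp add: supp_def)
    qed (simp add: supp_def)
  qed
  from that[OF w fibre this] show thesis .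
qed


section \<open>Products of arrangements\<close>

definition family_sum :: "nat \<Rightarrow> (nat \<Rightarrow> 'v::ab_group_add set) \<Rightarrow> 'v set"
  where "family_sum s W = {(\<Sum>i<s. f i) | f. \<forall>i<s. f i \<in> W i}"

lemma family_sum_0: "family_sum 0 W = {0}"
  by (auto simp: family_sum_def)

lemma family_sum_Suc: "family_sum (Suc s) W = family_sum s W + W s"
proof (rule set_eqI, rule iffI)
  fix v assume "v \<in> family_sum (Suc s) W"
  then obtain f where f: "v = (\<Sum>i<Suc s. f i)" "\<forall>i<Suc s. f i \<in> W i"
    by (auto simp: family_sum_def)
  then have "(\<Sum>i<s. f i) \<in> family_sum s W" "f s \<in> W s" "v = (\<Sum>i<s. f i) + f s"
    by (auto simp: family_sum_def)
  then show "v \<in> family_sum s W + W s"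
    by (auto intro: set_plus_intro)
next
  fix v assume "v \<in> family_sum s W + W s"
  then obtain f y where f: "v = (\<Sum>i<s. f i) + y" "\<forall>i<s. f i \<in> W i" "y \<in> W s"
    by (auto simp: family_sum_def elim!: set_plus_elim)
  then have "v = (\<Sum>i<Suc s. (f(s := y)) i)" "\<forall>i<Suc s. (f(s := y)) i \<in> W i"
    by (auto simp: less_Suc_eq)
  then show "v \<in> family_sum (Suc s) W"
    unfolding family_sum_def by blast
qed

lemma family_sum_cong: "(\<And>i. i < s \<Longrightarrow> W i = W' i) \<Longrightarrow> family_sum s W = family_sum s W'"
  unfolding family_sum_def by auto

text \<open>
  In closed form, a hyperplane of the product is the sum of all factors but one with a hyperplane of that one.
\<close>
lemma arr_prods_eq:
  "arr_prods s (\<lambda>i. (W i, \<B> i)) = (family_sum s W, {family_sum s (W(j := H)) | j H. j < s \<and> H \<in> \<B> j})"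
proof (induction s)
  case (Suc s)
  have last: "family_sum (Suc s) (W(s := H)) = family_sum s W + H" for H
    using family_sum_cong[of s "W(s := H)" W] by (simp add: family_sum_Suc)
  have earlier: "family_sum (Suc s) (W(j := H)) = family_sum s (W(j := H)) + W s" if "j < s" for j H
    using that by (simp add: family_sum_Suc)
  define A where "A = {family_sum s (W(j := H)) | j H. j < s \<and> H \<in> \<B> j}"
  have "{H1 + W s | H1. H1 \<in> A} = {family_sum (Suc s) (W(j := H)) | j H. j < s \<and> H \<in> \<B> j}"
  proof -
    have "{H1 + W s | H1. H1 \<in> A} = {family_sum s (W(j := H)) + W s | j H. j < s \<and> H \<in> \<B> j}"
      unfolding A_def by blast
    also have "\<dots> = {family_sum (Suc s) (W(j := H)) | j H. j < s \<and> H \<in> \<B> j}"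
      by (intro Collect_cong ex_cong1) (metis earlier)
    finally show ?thesis .
  qed
  moreover have "{family_sum s W + H2 | H2. H2 \<in> \<B> s} = {family_sum (Suc s) (W(s := H)) | H. H \<in> \<B> s}"
    unfolding last ..
  moreover have "{family_sum (Suc s) (W(j := H)) | j H. j < Suc s \<and> H \<in> \<B> j}
      = {family_sum (Suc s) (W(j := H)) | j H. j < s \<and> H \<in> \<B> j} \<union> {family_sum (Suc s) (W(s := H)) | H. H \<in> \<B> s}"
    by (auto simp: less_Suc_eq simp del: fun_upd_apply)
  moreover have "arr_prods (Suc s) (\<lambda>i. (W i, \<B> i))
      = (family_sum s W + W s, {H1 + W s | H1. H1 \<in> A} \<union> {family_sum s W + H2 | H2. H2 \<in> \<B> s})"
    by (simp only: arr_prods.simps Suc.IH arr_prod_def A_def prod.case)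
  ultimately show ?case
    by (simp only: family_sum_Suc[of s W])
qed (simp add: family_sum_0)

context vector_space
begin

lemma direct_sum_unique:
  assumes "direct_sum_decomposition scale s W" "\<And>i. i < s \<Longrightarrow> f i \<in> W i" "\<And>i. i < s \<Longrightarrow> g i \<in> W i"
    and "(\<Sum>i<s. f i) = (\<Sum>i<s. g i)" "i < s"
  shows "f i = g i"
proof -
  have "\<exists>!h. h \<in> (\<Pi>\<^sub>E i\<in>{..<s}. W i) \<and> (\<Sum>i<s. f i) = (\<Sum>i<s. h i)"
    using assms(1) by (simp add: direct_sum_decomposition_def)
  moreover have "restrict f {..<s} \<in> (\<Pi>\<^sub>E i\<in>{..<s}. W i)" "restrict g {..<s} \<in> (\<Pi>\<^sub>E i\<in>{..<s}. W i)"
    using assms(2,3) by auto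
  moreover have "(\<Sum>i<s. f i) = (\<Sum>i<s. restrict f {..<s} i)" "(\<Sum>i<s. f i) = (\<Sum>i<s. restrict g {..<s} i)"
    using assms(4) by auto
  ultimately have "restrict f {..<s} = restrict g {..<s}"
    by blast
  then have "restrict f {..<s} i = restrict g {..<s} i"
    by (rule fun_cong)
  with \<open>i < s\<close> show ?thesis by simp
qed

lemma direct_sum_exists:
  assumes "direct_sum_decomposition scale s W"
  obtains f where "\<And>i. i < s \<Longrightarrow> f i \<in> W i" "v = (\<Sum>i<s. f i)"
proof -
  obtain f where "f \<in> (\<Pi>\<^sub>E i\<in>{..<s}. W i)" "v = (\<Sum>i<s. f i)"
    using assms unfolding direct_sum_decomposition_def by blast
  then show thesis by (intro that[of f]) auto
qed

lemma direct_sum_basis: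
  assumes dec: "direct_sum_decomposition scale s W"
    and B: "\<And>i. i < s \<Longrightarrow> finite (B i) \<and> B i \<subseteq> W i \<and> independent (B i) \<and> W i \<subseteq> span (B i)"
  shows "independent (\<Union>i<s. B i)" "span (\<Union>i<s. B i) = UNIV"
proof -
  have sub: "subspace (W i)" if "i < s" for i
    using dec that by (simp add: direct_sum_decomposition_def)
  have disj: "B i \<inter> B j = {}" if "i < s" "j < s" "i \<noteq> j" for i j
  proof (rule ccontr)
    assume "B i \<inter> B j \<noteq> {}"
    then obtain x where x: "x \<in> B i" "x \<in> B j" by blast
    have "x \<in> W i" "x \<in> W j"
      using B x that by blast+
    then have mem: "(if k = i then x else 0) \<in> W k" "(if k = j then x else 0) \<in> W k" if "k < s" for k
      using sub[OF that] by (auto simp: subspace_0)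
    have "(\<Sum>k<s. if k = i then x else 0) = (\<Sum>k<s. if k = j then x else 0)"
      using that by simp
    from direct_sum_unique[OF dec mem this that(1)] have "x = 0"
      using that(3) by simp
    then show False
      using B[OF that(1)] x dependent_zero by blast
  qed
  have fin: "finite (\<Union>i<s. B i)"
    using B by auto
  show "independent (\<Union>i<s. B i)"
  proof (rule independent_if_scalars_zero[OF fin])
    fix f x assume *: "(\<Sum>x\<in>(\<Union>i<s. B i). scale (f x) x) = 0" "x \<in> (\<Union>i<s. B i)"
    then obtain i where i: "i < s" "x \<in> B i" by auto
    have "(\<Sum>i<s. \<Sum>x\<in>B i. scale (f x) x) = (\<Sum>i<s. 0)"
      using *(1) B disj by (subst (asm) sum.UNION_disjoint) auto
    then have "(\<Sum>x\<in>B i. scale (f x) x) = 0"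
      using B sub i(1) by (intro direct_sum_unique[OF dec, where g = "\<lambda>_. 0"])
        (auto intro!: subspace_sum subspace_scale simp: subspace_0)
    then show "f x = 0"
      using B[OF i(1)] i(2) independentD[of "B i" "B i" f x] by auto
  qed
  have "v \<in> span (\<Union>i<s. B i)" for v
  proof -
    obtain f where f: "\<And>i. i < s \<Longrightarrow> f i \<in> W i" "v = (\<Sum>i<s. f i)"
      using direct_sum_exists[OF dec] by blast
    have "f i \<in> span (\<Union>i<s. B i)" if "i < s" for i
      using f(1)[OF that] B[OF that] span_mono[of "B i" "\<Union>i<s. B i"] that by blast
    then show ?thesis
      unfolding f(2) by (intro span_sum) auto
  qed
  then show "span (\<Union>i<s. B i) = UNIV" by auto
qed

end

context coordinates
begin

text \<open>
  A hyperplane of the product contains all factors but one, so its form vanishes on the basis vectors of these.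
\<close>
lemma decomposition_imp_blocks:
  fixes \<A> :: "'v set set"
  assumes lin: "\<And>H. H \<in> \<A> \<Longrightarrow> Vector_Spaces.linear scale (*) (\<alpha> H)"
    and ker: "\<And>H. H \<in> \<A> \<Longrightarrow> {v. \<alpha> H v = 0} = H"
    and dec: "direct_sum_decomposition scale s W"
    and W: "\<And>i. i < s \<Longrightarrow> dim (W i) \<in> {1, 2} \<and> central_arrangement scale (W i) (\<B> i)"
    and eq: "(UNIV, \<A>) = arr_prods s (\<lambda>i. (W i, \<B> i))"
  obtains w :: "'i \<Rightarrow> 'v" and \<eta> and blk :: "'i \<Rightarrow> nat" where "coordinates scale w \<eta>"
    "\<And>c. card {i. blk i = c} \<le> 2"
    "\<And>H. H \<in> \<A> \<Longrightarrow> \<exists>c. \<forall>k. blk k \<noteq> c \<longrightarrow> \<alpha> H (w k) = 0"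
proof -
  have sub: "subspace (W i)" if "i < s" for i
    using dec that by (simp add: direct_sum_decomposition_def)
  have "\<exists>B. B \<subseteq> W i \<and> independent B \<and> W i \<subseteq> span B \<and> card B = dim (W i)" for i
    by (rule basis_exists[of "W i"]) blast
  then obtain B where B: "\<And>i. B i \<subseteq> W i \<and> independent (B i) \<and> W i \<subseteq> span (B i) \<and> card (B i) = dim (W i)"
    by metis
  have B_fin: "finite (B i)" for i
    using B finite_if_independent by blast
  define U where "U = (\<Union>i<s. B i)"
  have U: "independent U" "span U = UNIV"
    using direct_sum_basis[OF dec, of B] B B_fin by (auto simp: U_def)
  have "finite U"
    using B_fin by (simp add: U_def)
  have "card U = dim (UNIV :: 'v set)" "card (range b) = dim (UNIV :: 'v set)"
    using U span_range_basis independent_range_basis by (auto intro!: basis_card_eq_dim)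
  then have "card (UNIV :: 'i set) = card U"
    using card_image[OF inj_basis] by simp
  then obtain w where w: "bij_betw w (UNIV :: 'i set) U"
    using finite_same_card_bij[of "UNIV :: 'i set" U] \<open>finite U\<close> by auto
  have "indexed_basis scale w"
    using w U by (auto simp: indexed_basis_def bij_betw_def)
  then obtain \<eta> where \<eta>: "coordinates scale w \<eta>"
    using coordinates_exist[OF vector_space_axioms] by blast
  have "\<forall>k. \<exists>i. i < s \<and> w k \<in> B i"
    using bij_betwE[OF w] by (auto simp: U_def)
  then obtain blk where blk: "\<And>k. blk k < s \<and> w k \<in> B (blk k)"
    by metis
  have "card {i. blk i = c} \<le> 2" for c
  proof (cases "c < s")
    case True
    have "w ` {i. blk i = c} \<subseteq> B c"
      using blk by auto
    moreover have "inj_on w {i. blk i = c}"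
      using w by (auto simp: bij_betw_def intro: inj_on_subset)
    ultimately have "card {i. blk i = c} \<le> card (B c)"
      using B_fin by (metis card_image card_mono)
    also have "\<dots> \<le> 2"
      using B[of c] W[OF True] by auto
    finally show ?thesis .
  next
    case False
    then have "{i. blk i = c} = {}"
      using blk by auto
    then show ?thesis by simp
  qed
  moreover have "\<exists>c. \<forall>k. blk k \<noteq> c \<longrightarrow> \<alpha> H (w k) = 0" if H: "H \<in> \<A>" for H
  proof -
    have "\<A> = {family_sum s (W(j := H)) | j H. j < s \<and> H \<in> \<B> j}"
      using eq unfolding arr_prods_eq by simp
    then obtain j H' where j: "H = family_sum s (W(j := H'))" "j < s" "H' \<in> \<B> j"
      using H by blast
    have "0 \<in> H'"
      using W[OF j(2)] j(3) by (auto simp: central_arrangement_def hyperplane_def subspace_0)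
    have "W i \<subseteq> H" if i: "i < s" "i \<noteq> j" for i
    proof
      fix x assume x: "x \<in> W i"
      have "x = (\<Sum>k<s. if k = i then x else 0)"
        using i by simp
      moreover have "\<forall>k<s. (if k = i then x else 0) \<in> (W(j := H')) k"
        using i x \<open>0 \<in> H'\<close> sub by (auto simp: subspace_0)
      ultimately show "x \<in> H"
        unfolding j(1) family_sum_def by blast
    qed
    then have "\<alpha> H (w k) = 0" if "blk k \<noteq> j" for k
      using that blk[of k] B[of "blk k"] ker[OF H] by blast
    then show ?thesis by blast
  qed
  ultimately show thesis
    using that \<eta> by blast
qed

text \<open>
  The factor of a block is spanned by its basis vectors, and consists of the intersections with those hyperplanes
  whose forms involve only coordinates of this block; the blocks in use are numbered for this purpose.
\<close>
lemma blocks_imp_decomposition: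
  fixes \<A> :: "'v set set" and blk :: "'i \<Rightarrow> 'c"
  assumes fin: "finite \<A>"
    and lin: "\<And>H. H \<in> \<A> \<Longrightarrow> Vector_Spaces.linear scale (*) (\<alpha> H)"
    and ker: "\<And>H. H \<in> \<A> \<Longrightarrow> {v. \<alpha> H v = 0} = H"
    and nonzero: "\<And>H. H \<in> \<A> \<Longrightarrow> \<exists>v. \<alpha> H v \<noteq> 0"
    and blk: "\<And>c. card {i. blk i = c} \<le> 2"
    and supp: "\<And>H. H \<in> \<A> \<Longrightarrow> \<exists>c. \<forall>k. blk k \<noteq> c \<longrightarrow> \<alpha> H (b k) = 0"
  shows "\<exists>s W \<B>. direct_sum_decomposition scale s W \<and>
      (\<forall>i<s. dim (W i) \<in> {1, 2} \<and> central_arrangement scale (W i) (\<B> i)) \<and>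
      (UNIV, \<A>) = arr_prods s (\<lambda>i. (W i, \<B> i))"
proof -
  obtain num where num: "bij_betw num (range blk) {0..<card (range blk)}"
    using ex_bij_betw_finite_nat[of "range blk"] by auto
  define s where "s = card (range blk)"
  define nb where "nb i = num (blk i)" for i
  have nb_eq: "nb i = nb j \<longleftrightarrow> blk i = blk j" for i j
    using bij_betw_imp_inj_on[OF num] by (auto simp: nb_def inj_on_eq_iff)
  have nb_less: "nb i < s" for i
    using bij_betwE[OF num] by (auto simp: nb_def s_def)
  have nb_surj: "\<exists>i. nb i = c" if "c < s" for c
  proof -
    have "c \<in> num ` range blk"
      using bij_betw_imp_surj_on[OF num] that by (simp add: s_def)
    then show ?thesis by (auto simp: nb_def)
  qed
  define W where "W c = {v. \<forall>i. nb i \<noteq> c \<longrightarrow> \<xi> i v = 0}" for c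
  define \<B> where "\<B> c = {H \<inter> W c | H. H \<in> \<A> \<and> (\<forall>i. nb i \<noteq> c \<longrightarrow> \<alpha> H (b i) = 0)}" for c
  have sub: "subspace (W c)" for c
    by (auto simp: W_def subspace_def linear_form_0[OF linear_coordinate] linear_form_add[OF linear_coordinate]
        linear_form_scale[OF linear_coordinate])
  have b_W: "b i \<in> W (nb i)" for i
    by (auto simp: W_def coordinate_basis)
  define part where "part c v = (\<Sum>i\<in>{i. nb i = c}. scale (\<xi> i v) (b i))" for c v
  have part_W: "part c v \<in> W c" for c v
    unfolding part_def using b_W by (intro subspace_sum[OF sub] subspace_scale[OF sub]) auto
  have sum_part: "v = (\<Sum>c<s. part c v)" for v
  proof -
    have "(\<Sum>c<s. part c v) = (\<Sum>i\<in>(\<Union>c<s. {i. nb i = c}). scale (\<xi> i v) (b i))"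
      unfolding part_def by (rule sum.UNION_disjoint[symmetric]) auto
    also have "(\<Union>c<s. {i. nb i = c}) = UNIV"
      using nb_less by auto
    finally show ?thesis
      using coordinate_expansion[of v] by simp
  qed
  have part_unique: "part c (\<Sum>c<s. f c) = f c" if f: "\<And>c. c < s \<Longrightarrow> f c \<in> W c" and c: "c < s" for f c
  proof -
    have "\<xi> i (\<Sum>c<s. f c) = \<xi> i (f (nb i))" for i
    proof -
      have "\<xi> i (\<Sum>c<s. f c) = (\<Sum>c<s. \<xi> i (f c))"
        by (rule linear_form_sum[OF linear_coordinate])
      also have "\<dots> = (\<Sum>c<s. if c = nb i then \<xi> i (f c) else 0)"
        using f by (intro sum.cong) (auto simp: W_def)
      finally show ?thesis using nb_less by simp
    qed
    then have "part c (\<Sum>c<s. f c) = (\<Sum>i\<in>{i. nb i = c}. scale (\<xi> i (f c)) (b i))"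
      by (simp add: part_def)
    also have "\<dots> = (\<Sum>i\<in>UNIV. scale (\<xi> i (f c)) (b i))"
      using f[OF c] by (intro sum.mono_neutral_left) (auto simp: W_def)
    finally show ?thesis
      using coordinate_expansion[of "f c"] by simp
  qed
  have dec: "direct_sum_decomposition scale s W"
    unfolding direct_sum_decomposition_def
  proof (intro conjI allI impI)
    fix v
    show "\<exists>!f. f \<in> (\<Pi>\<^sub>E i\<in>{..<s}. W i) \<and> v = (\<Sum>i<s. f i)"
    proof (rule ex1I[of _ "restrict (\<lambda>c. part c v) {..<s}"])
      show "restrict (\<lambda>c. part c v) {..<s} \<in> (\<Pi>\<^sub>E i\<in>{..<s}. W i) \<and> v = (\<Sum>i<s. restrict (\<lambda>c. part c v) {..<s} i)"
        using part_W sum_part[of v, symmetric] by simp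
    next
      fix f assume f: "f \<in> (\<Pi>\<^sub>E i\<in>{..<s}. W i) \<and> v = (\<Sum>i<s. f i)"
      then have mem: "\<And>c. c < s \<Longrightarrow> f c \<in> W c" and v: "v = (\<Sum>i<s. f i)"
        by auto
      have "part c v = f c" if "c < s" for c
        unfolding v using mem that by (rule part_unique)
      then show "f = restrict (\<lambda>c. part c v) {..<s}"
        using f by (intro extensionalityI[of f "{..<s}"]) (auto simp: PiE_def)
    qed
  qed (rule sub)
  have dim_W: "dim (W c) \<in> {1, 2}" if c: "c < s" for c
  proof -
    let ?I = "{i. nb i = c}"
    have "v \<in> span (b ` ?I)" if "v \<in> W c" for v
    proof -
      have "v = (\<Sum>i\<in>?I. scale (\<xi> i v) (b i))"
        using coordinate_expansion[of v] that
        by (subst sum.mono_neutral_left[of UNIV]) (auto simp: W_def)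
      also have "\<dots> \<in> span (b ` ?I)"
        by (intro span_sum span_scale span_base) auto
      finally show ?thesis .
    qed
    moreover have "independent (b ` ?I)"
      using independent_range_basis by (rule independent_mono) auto
    moreover have "b ` ?I \<subseteq> W c"
      using b_W by auto
    ultimately have "card (b ` ?I) = dim (W c)"
      by (intro basis_card_eq_dim) auto
    then have "dim (W c) = card ?I"
      using card_image[of b ?I] inj_on_subset[OF inj_basis] by auto
    moreover obtain i where i: "nb i = c"
      using nb_surj[OF c] by blast
    then have "?I = {j. blk j = blk i}"
      using nb_eq by auto
    then have "card ?I \<le> 2"
      using blk by simp
    moreover have "0 < card ?I"
      using i by (auto simp: card_gt_0_iff)
    ultimately have "dim (W c) = 1 \<or> dim (W c) = 2"
      by linarith
    then show ?thesis by simp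
  qed
  have vanish: "\<alpha> H v = 0" if "H \<in> \<A>" "\<forall>i. nb i \<noteq> c \<longrightarrow> \<alpha> H (b i) = 0" "v \<in> W c'" "c' \<noteq> c" for H c c' v
    unfolding linear_form_expansion[OF lin[OF that(1)], of v] using that(2-4)
    by (intro sum.neutral) (auto simp: W_def)
  have block: "\<exists>c<s. \<forall>i. nb i \<noteq> c \<longrightarrow> \<alpha> H (b i) = 0" if H: "H \<in> \<A>" for H
  proof -
    obtain c where c: "\<And>k. blk k \<noteq> c \<Longrightarrow> \<alpha> H (b k) = 0"
      using supp[OF H] by blast
    have "\<exists>i. \<alpha> H (b i) \<noteq> 0"
    proof (rule ccontr)
      assume "\<not> (\<exists>i. \<alpha> H (b i) \<noteq> 0)"
      then have "\<alpha> H v = 0" for v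
        by (subst linear_form_expansion[OF lin[OF H], of v]) simp
      then show False using nonzero[OF H] by blast
    qed
    then obtain i where "blk i = c" using c by blast
    then show ?thesis
      using c nb_less nb_eq by (intro exI[of _ "nb i"]) auto
  qed
  have central: "central_arrangement scale (W c) (\<B> c)" for c
    unfolding central_arrangement_def
  proof (intro conjI ballI)
    show "finite (\<B> c)"
      using fin by (simp add: \<B>_def)
    fix H' assume "H' \<in> \<B> c"
    then obtain H where H: "H' = H \<inter> W c" "H \<in> \<A>" "\<forall>i. nb i \<noteq> c \<longrightarrow> \<alpha> H (b i) = 0"
      by (auto simp: \<B>_def)
    have H'_eq: "H' = W c \<inter> {v. \<alpha> H v = 0}"
      using ker[OF H(2)] H(1) by auto
    have "\<exists>u\<in>W c. \<alpha> H u \<noteq> 0"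
    proof (rule ccontr)
      assume "\<not> (\<exists>u\<in>W c. \<alpha> H u \<noteq> 0)"
      then have "\<alpha> H (b i) = 0" for i
        using H(3) b_W[of i] by (cases "nb i = c") auto
      then have "\<alpha> H v = 0" for v
        by (subst linear_form_expansion[OF lin[OF H(2)], of v]) simp
      then show False using nonzero[OF H(2)] by blast
    qed
    then obtain u where u: "u \<in> W c" "\<alpha> H u \<noteq> 0" by blast
    have "subspace {v. \<alpha> H v = 0}"
      using lin[OF H(2)] by (auto simp: subspace_def linear_form_0 linear_form_add linear_form_scale)
    then have "subspace H'"
      unfolding H'_eq using sub by (intro subspace_inter)
    then show "hyperplane scale (W c) H'"
      using dim_kernel[OF lin[OF H(2)] sub u] by (auto simp: hyperplane_def H'_eq)
  qed
  have family_sum_W: "family_sum s (W(c := H \<inter> W c)) = H"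
    if "H \<in> \<A>" "c < s" "\<forall>i. nb i \<noteq> c \<longrightarrow> \<alpha> H (b i) = 0" for H c
  proof -
    have form_sum: "\<alpha> H (\<Sum>i<s. f i) = \<alpha> H (f c)" if f: "\<And>i. i < s \<Longrightarrow> f i \<in> W i" for f
    proof -
      have "\<alpha> H (\<Sum>i<s. f i) = (\<Sum>i<s. if i = c then \<alpha> H (f i) else 0)"
        unfolding linear_form_sum[OF lin[OF \<open>H \<in> \<A>\<close>]]
        using f vanish[OF \<open>H \<in> \<A>\<close> \<open>\<forall>i. nb i \<noteq> c \<longrightarrow> \<alpha> H (b i) = 0\<close>] by (intro sum.cong) auto
      then show ?thesis using \<open>c < s\<close> by simp
    qed
    have ker': "v \<in> H \<longleftrightarrow> \<alpha> H v = 0" for v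
      using ker[OF \<open>H \<in> \<A>\<close>] by blast
    show ?thesis
    proof (rule set_eqI, rule iffI)
      fix v assume "v \<in> family_sum s (W(c := H \<inter> W c))"
      then obtain f where f: "v = (\<Sum>i<s. f i)" "\<forall>i<s. f i \<in> (W(c := H \<inter> W c)) i"
        by (auto simp: family_sum_def)
      have "f i \<in> W i" if "i < s" for i
        using f(2) that by (auto split: if_splits)
      moreover have "f c \<in> H"
        using f(2) \<open>c < s\<close> by auto
      ultimately show "v \<in> H"
        using form_sum[of f] by (simp add: ker' f(1))
    next
      fix v assume "v \<in> H"
      then have "\<alpha> H (part c v) = 0"
        using form_sum[of "\<lambda>i. part i v"] part_W sum_part[of v] by (simp add: ker')
      then have "\<forall>i<s. part i v \<in> (W(c := H \<inter> W c)) i"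
        using part_W by (auto simp: ker')
      then show "v \<in> family_sum s (W(c := H \<inter> W c))"
        unfolding family_sum_def using sum_part[of v] by blast
    qed
  qed
  have "family_sum s W = UNIV"
    unfolding family_sum_def using sum_part part_W by blast
  moreover have "{family_sum s (W(j := H)) | j H. j < s \<and> H \<in> \<B> j} = \<A>"
  proof (rule set_eqI, rule iffI)
    fix H assume "H \<in> {family_sum s (W(j := H)) | j H. j < s \<and> H \<in> \<B> j}"
    then show "H \<in> \<A>"
      using family_sum_W by (auto simp: \<B>_def)
  next
    fix H assume H: "H \<in> \<A>"
    then obtain c where c: "c < s" "\<forall>i. nb i \<noteq> c \<longrightarrow> \<alpha> H (b i) = 0"
      using block by blast
    then have "H \<inter> W c \<in> \<B> c"
      using H by (auto simp: \<B>_def)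
    then show "H \<in> {family_sum s (W(j := H)) | j H. j < s \<and> H \<in> \<B> j}"
      using family_sum_W[OF H c] c(1) by blast
  qed
  ultimately have "(UNIV, \<A>) = arr_prods s (\<lambda>i. (W i, \<B> i))"
    by (simp add: arr_prods_eq)
  then show ?thesis
    using dec dim_W central by blast
qed

end

theorem theorem1p2:
  fixes scale :: "'k::field \<Rightarrow> 'v::ab_group_add \<Rightarrow> 'v"
    and b :: "'i::finite \<Rightarrow> 'v"
    and \<A> :: "'v set set"
    and \<alpha> :: "'v set \<Rightarrow> 'v \<Rightarrow> 'k"
  assumes "vector_space scale"
    and "indexed_basis scale b"
    and "central_arrangement scale UNIV \<A>"
    and "\<And>H. H \<in> \<A> \<Longrightarrow> defining_form scale H (\<alpha> H)"
  shows "totally_free b \<alpha> \<A> \<longleftrightarrow>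
    (\<exists>s W \<B>. direct_sum_decomposition scale s W \<and>
      (\<forall>i<s. vector_space.dim scale (W i) \<in> {1, 2} \<and> central_arrangement scale (W i) (\<B> i)) \<and>
      (UNIV, \<A>) = arr_prods s (\<lambda>i. (W i, \<B> i)))"
    (is "_ \<longleftrightarrow> ?decomposable")
proof -
  obtain \<xi> where b: "coordinates scale b \<xi>"
    using coordinates_exist[OF assms(1,2)] by blast
  interpret b: coordinates scale b \<xi> by (rule b)
  have fin: "finite \<A>"
    using assms(3) by (simp add: central_arrangement_def)
  have lin: "Vector_Spaces.linear scale (*) (\<alpha> H)" and ker: "{v. \<alpha> H v = 0} = H" if "H \<in> \<A>" for H
    using assms(4)[OF that] by (auto simp: defining_form_def)
  have nonzero: "\<exists>v. \<alpha> H v \<noteq> 0" if "H \<in> \<A>" for H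
  proof (rule ccontr)
    assume "\<not> (\<exists>v. \<alpha> H v \<noteq> 0)"
    then have "H = UNIV" using ker[OF that] by auto
    moreover have "hyperplane scale UNIV H"
      using assms(3) that by (simp add: central_arrangement_def)
    ultimately show False by (simp add: hyperplane_def)
  qed
  have distinct: "H = H'" if "H \<in> \<A>" "H' \<in> \<A>" "\<forall>v. \<alpha> H v = c * \<alpha> H' v" for H H' c
  proof -
    have "c \<noteq> 0"
      using nonzero[OF that(1)] that(3) by auto
    then have "{v. \<alpha> H v = 0} = {v. \<alpha> H' v = 0}"
      using that(3) by simp
    then show ?thesis
      using ker[OF that(1)] ker[OF that(2)] by simp
  qed
  show ?thesis
  proof
    assume free: "totally_free b \<alpha> \<A>"
    show ?decomposable
    proof (rule totally_free_imp_blocks[of scale b \<xi> \<A> \<alpha>])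
      fix w :: "'i \<Rightarrow> 'v" and \<eta> and blk :: "'i \<Rightarrow> 'i set"
      assume "coordinates scale w \<eta>" "\<And>c. card {i. blk i = c} \<le> 2"
        "\<And>H. H \<in> \<A> \<Longrightarrow> \<exists>c. \<forall>k. blk k \<noteq> c \<longrightarrow> \<alpha> H (w k) = 0"
      then show ?decomposable
        using fin lin ker nonzero by (intro coordinates.blocks_imp_decomposition[of scale w \<eta> \<A> \<alpha> blk])
    qed (fact b fin lin nonzero distinct free)+
  next
    assume ?decomposable
    then obtain s W \<B> where dec: "direct_sum_decomposition scale s W"
      and W: "\<And>i. i < s \<Longrightarrow> b.dim (W i) \<in> {1, 2} \<and> central_arrangement scale (W i) (\<B> i)"
      and eq: "(UNIV, \<A>) = arr_prods s (\<lambda>i. (W i, \<B> i))"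
      by blast
    obtain w :: "'i \<Rightarrow> 'v" and \<eta> and blk :: "'i \<Rightarrow> nat" where w: "coordinates scale w \<eta>"
      and blk: "\<And>c. card {i. blk i = c} \<le> 2"
      and supp: "\<And>H. H \<in> \<A> \<Longrightarrow> \<exists>c. \<forall>k. blk k \<noteq> c \<longrightarrow> \<alpha> H (w k) = 0"
      using b.decomposition_imp_blocks[of \<A> \<alpha>, OF lin ker dec W eq] by blast
    have "two_bases scale b \<xi> w \<eta>"
      using b w by (rule two_bases.intro)
    then have "free_multiarrangement b \<alpha> \<A> m" for m
      using fin lin nonzero blk supp by (rule two_bases.blocks_imp_free)
    then show "totally_free b \<alpha> \<A>"
      by (simp add: totally_free_def)
  qed
qed

end
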